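(* Let $\mathbb{F}$ be a field of characteristic zero and fix $K\in\mathbb{N}$. There exists $N\in\mathbb{N}$ such that the following holds: if $W_{N,N+K}\cong\bigoplus_{\lambda\vdash N+K}m^{\lambda}S^{\lambda}$ is the decomposition of $W_{N,N+K}$ into irreducible $S_{N+K}$-representations, then for every $n\geq N$ there is an isomorphism of $S_{n+K}$-representations $$W_{n,n+K}\cong\bigoplus_{\lambda\vdash N+K}m^{\lambda}S^{\lambda^{(n-N)}}.$$
   Context: $\mathbb{F}\langle X\rangle$ is the free non-unitary associative algebra over $\mathbb{F}$ on countably many non-commuting variables $X=\{x_1,x_2,\dots\}$. A $T$-ideal is a two-sided ideal of $\mathbb{F}\langle X\rangle$ invariant under all algebra endomorphisms of $\mathbb{F}\langle X\rangle$; $(x^n)^T$ denotes the smallest $T$-ideal containing $x^n$. $V_m$ is the span of the monomials $x_{\sigma(1)}\cdots x_{\sigma(m)}$, $\sigma\in S_m$ (multilinear polynomials of degree $m$ in $x_1,\dots,x_m$), and $W_{n,m}:=V_m\cap(x^n)^T$ for $n\le m$. $S_m$ acts on $V_m$ on the left by $(\sigma.f)(x_1,\dots,x_m)=f(x_{\sigma(1)},\dots,x_{\sigma(m)})$, making $W_{n,m}$ an $S_m$-representation. $S^{\lambda}$ denotes the irreducible $S_m$-representation corresponding to the partition $\lambda\vdash m$. For a partition $\lambda=(\lambda_1,\dots,\lambda_r)$ and $s\in\mathbb{Z}_{\ge0}$, $\lambda^{(s)}:=(\lambda_1+s,\lambda_2,\dots,\lambda_r)$. *)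

theory Defs
  imports "HOL-Combinatorics.Permutations"
begin

text \<open>Elements of F<X> are represented by their coefficient functions on words
  (monomials) over the variable indices; variable x_(i+1) has index i.
  The empty word (the unit) carries coefficient 0 (non-unitary algebra).\<close>

definition FA :: "(nat list \<Rightarrow> 'a::field) set" where
  "FA = {p. finite {w. p w \<noteq> 0} \<and> p [] = 0}"

definition fmul :: "(nat list \<Rightarrow> 'a::field) \<Rightarrow> (nat list \<Rightarrow> 'a) \<Rightarrow> nat list \<Rightarrow> 'a" where
  "fmul p q = (\<lambda>w. \<Sum>k\<le>length w. p (take k w) * q (drop k w))"

definition xpow :: "nat \<Rightarrow> nat list \<Rightarrow> 'a::field" where
  "xpow n = (\<lambda>w. if w = replicate n 0 then 1 else 0)"

definition is_endo :: "((nat list \<Rightarrow> 'a::field) \<Rightarrow> (nat list \<Rightarrow> 'a)) \<Rightarrow> bool" where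
  "is_endo \<phi> \<longleftrightarrow>
     (\<forall>p\<in>FA. \<phi> p \<in> FA) \<and>
     (\<forall>p\<in>FA. \<forall>q\<in>FA. \<phi> (\<lambda>w. p w + q w) = (\<lambda>w. \<phi> p w + \<phi> q w)) \<and>
     (\<forall>c. \<forall>p\<in>FA. \<phi> (\<lambda>w. c * p w) = (\<lambda>w. c * \<phi> p w)) \<and>
     (\<forall>p\<in>FA. \<forall>q\<in>FA. \<phi> (fmul p q) = fmul (\<phi> p) (\<phi> q))"

definition is_Tideal :: "(nat list \<Rightarrow> 'a::field) set \<Rightarrow> bool" where
  "is_Tideal I \<longleftrightarrow>
     I \<subseteq> FA \<and> (\<lambda>w. 0) \<in> I \<and>
     (\<forall>p\<in>I. \<forall>q\<in>I. (\<lambda>w. p w + q w) \<in> I) \<and>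
     (\<forall>c. \<forall>p\<in>I. (\<lambda>w. c * p w) \<in> I) \<and>
     (\<forall>p\<in>I. \<forall>q\<in>FA. fmul p q \<in> I \<and> fmul q p \<in> I) \<and>
     (\<forall>\<phi>. is_endo \<phi> \<longrightarrow> \<phi> ` I \<subseteq> I)"

definition Tgen :: "(nat list \<Rightarrow> 'a::field) \<Rightarrow> (nat list \<Rightarrow> 'a) set" where
  "Tgen p = \<Inter>{I. is_Tideal I \<and> p \<in> I}"

definition Vm :: "nat \<Rightarrow> (nat list \<Rightarrow> 'a::field) set" where
  "Vm m = {p \<in> FA. \<forall>w. p w \<noteq> 0 \<longrightarrow> distinct w \<and> set w = {..<m}}"

definition Wnm :: "nat \<Rightarrow> nat \<Rightarrow> (nat list \<Rightarrow> 'a::field) set" where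
  "Wnm n m = Vm m \<inter> Tgen (xpow n)"

text \<open>Action (sigma.f)(x_1,..,x_m) = f(x_sigma(1),..,x_sigma(m)): substituting
  x_i by x_sigma(i) sends the monomial w to map sigma w.\<close>
definition wact :: "(nat \<Rightarrow> nat) \<Rightarrow> (nat list \<Rightarrow> 'a) \<Rightarrow> nat list \<Rightarrow> 'a" where
  "wact \<sigma> f = (\<lambda>w. f (map (inv \<sigma>) w))"

definition is_partition :: "nat \<Rightarrow> nat list \<Rightarrow> bool" where
  "is_partition m lam \<longleftrightarrow> sorted_wrt (\<ge>) lam \<and> 0 \<notin> set lam \<and> sum_list lam = m"

fun shiftp :: "nat \<Rightarrow> nat list \<Rightarrow> nat list" where
  "shiftp s [] = []"
| "shiftp s (a # l) = (a + s) # l"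

definition cells :: "nat list \<Rightarrow> (nat \<times> nat) set" where
  "cells lam = {(i, j). i < length lam \<and> j < lam ! i}"

text \<open>A tabloid of shape lambda (lambda |- m) is encoded as a word r of length m:
  r ! k is the row containing the entry k.  Permutations act by moving entries.\<close>
definition tact :: "(nat \<Rightarrow> nat) \<Rightarrow> nat list \<Rightarrow> nat list" where
  "tact \<sigma> r = map (\<lambda>k. r ! (inv \<sigma> k)) [0..<length r]"

text \<open>A tableau T: bijection from cells onto the entries {0..m-1}; its tabloid.\<close>
definition tabloid_of :: "nat list \<Rightarrow> (nat \<times> nat \<Rightarrow> nat) \<Rightarrow> nat list" where
  "tabloid_of lam T = map (\<lambda>k. fst (inv_into (cells lam) T k)) [0..<sum_list lam]"

definition col_stab :: "nat list \<Rightarrow> (nat \<times> nat \<Rightarrow> nat) \<Rightarrow> (nat \<Rightarrow> nat) set" where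
  "col_stab lam T = {\<pi>. \<pi> permutes {..<sum_list lam} \<and>
      (\<forall>k<sum_list lam. snd (inv_into (cells lam) T (\<pi> k)) = snd (inv_into (cells lam) T k))}"

definition polytabloid :: "nat list \<Rightarrow> (nat \<times> nat \<Rightarrow> nat) \<Rightarrow> nat list \<Rightarrow> 'a::field" where
  "polytabloid lam T = (\<lambda>r. \<Sum>\<pi>\<in>col_stab lam T.
      if tact \<pi> (tabloid_of lam T) = r then of_int (sign \<pi>) else 0)"

definition fspan :: "('x \<Rightarrow> 'a::field) set \<Rightarrow> ('x \<Rightarrow> 'a) set" where
  "fspan S = {f. \<exists>A c. finite A \<and> A \<subseteq> S \<and> f = (\<lambda>x. \<Sum>a\<in>A. c a * a x)}"

definition Specht :: "nat list \<Rightarrow> (nat list \<Rightarrow> 'a::field) set" where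
  "Specht lam = fspan {polytabloid lam T | T. bij_betw T (cells lam) {..<sum_list lam}}"

text \<open>Direct sum of mlt(lambda) copies of S^(f lambda), lambda ranging over P.
  Components are indexed by (lambda, copy number j, tabloid).\<close>
definition DSum :: "nat list set \<Rightarrow> (nat list \<Rightarrow> nat) \<Rightarrow> (nat list \<Rightarrow> nat list)
     \<Rightarrow> ((nat list \<times> nat \<times> nat list) \<Rightarrow> 'a::field) set" where
  "DSum P mlt f = {F. (\<forall>lam j r. F (lam, j, r) \<noteq> 0 \<longrightarrow> lam \<in> P \<and> j < mlt lam) \<and>
      (\<forall>lam j. (\<lambda>r. F (lam, j, r)) \<in> Specht (f lam))}"

definition dsact :: "(nat \<Rightarrow> nat) \<Rightarrow> ((nat list \<times> nat \<times> nat list) \<Rightarrow> 'a)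
     \<Rightarrow> (nat list \<times> nat \<times> nat list) \<Rightarrow> 'a" where
  "dsact \<sigma> F = (\<lambda>(lam, j, r). F (lam, j, tact (inv \<sigma>) r))"

definition rep_iso :: "nat \<Rightarrow> ('x \<Rightarrow> 'a::field) set \<Rightarrow> ((nat \<Rightarrow> nat) \<Rightarrow> ('x \<Rightarrow> 'a) \<Rightarrow> ('x \<Rightarrow> 'a))
     \<Rightarrow> ('y \<Rightarrow> 'a) set \<Rightarrow> ((nat \<Rightarrow> nat) \<Rightarrow> ('y \<Rightarrow> 'a) \<Rightarrow> ('y \<Rightarrow> 'a)) \<Rightarrow> bool" where
  "rep_iso m V actV U actU \<longleftrightarrow> (\<exists>\<phi>. bij_betw \<phi> V U \<and>
     (\<forall>u\<in>V. \<forall>v\<in>V. \<phi> (\<lambda>x. u x + v x) = (\<lambda>y. \<phi> u y + \<phi> v y)) \<and>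
     (\<forall>c. \<forall>u\<in>V. \<phi> (\<lambda>x. c * u x) = (\<lambda>y. c * \<phi> u y)) \<and>
     (\<forall>\<sigma>. \<sigma> permutes {..<m} \<longrightarrow> (\<forall>v\<in>V. \<phi> (actV \<sigma> v) = actU \<sigma> (\<phi> v))))"

end

theory Submission
  imports Defs
    "HOL-Computational_Algebra.Formal_Power_Series"
    "HOL-Computational_Algebra.Polynomial"
    "HOL-Library.Function_Algebras"
    "HOL-Combinatorics.Multiset_Permutations"
begin

text \<open>
  The multilinear part \<open>W\<^sub>n\<close> of degree \<open>n + K\<close> of the T-ideal is spanned by the elements
  \<open>u s\<^sub>n(w\<^sub>1, \<dots>, w\<^sub>n) v\<close>, where \<open>s\<^sub>n\<close> is the symmetrized product; all but at most
  \<open>K\<close> of the words \<open>w\<^sub>i\<close> are single letters.  Symmetrize such an element over all letters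
  except the first \<open>b\<close>: up to a factorial, its coefficient at a word depends only on the
  pattern obtained by identifying the remaining letters with one letter \<open>y\<close>, on finitely many data
  that do not involve \<open>n\<close>, and it is an eventually polynomial function of the length of every run
  of \<open>y\<close>.  Hence dimensions such as \<open>dim \<theta> Sym W\<^sub>n\<close>, with \<open>\<theta>\<close> in a fixed group algebra, are
  ranks of matrices of polynomials in \<open>n\<close>, and so they are constant for large \<open>n\<close>.

  Taking for \<open>\<theta> Sym\<close> the Young symmetrizer of shape \<open>\<lambda>\<^sup>(\<^sup>n\<^sup>-\<^sup>N\<^sup>)\<close>, the multiplicity of this
  Specht module in \<open>W\<^sub>n\<close> does not depend on \<open>n\<close>, which embeds \<open>\<Oplus> m\<^sup>\<lambda> S\<^sup>\<lambda>\<^sup>(\<^sup>n\<^sup>-\<^sup>N\<^sup>)\<close> into \<open>W\<^sub>n\<close>.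
  The image is everything: \<open>W\<^sub>n\<close> is generated by its invariants under the symmetric group on all
  letters but the first \<open>2 K\<close>, these invariants have constant dimension, and those of
  \<open>S\<^sup>\<lambda>\<close> inject into those of \<open>S\<^sup>\<lambda>\<^sup>(\<^sup>n\<^sup>-\<^sup>N\<^sup>)\<close>.
\<close>

section \<open>Finite differences and functions polynomial along runs\<close>

text \<open>The number \<open>2 * K\<close> has one source. In degree n + K a generator has at least
  n - K one-letter words and is invariant under permutations of their letters; up to conjugation
  this is the symmetric group on all but the first \<open>2 * K\<close> letters. A column
  antisymmetrizer kills a generator with more such letters than columns, so a shape occurring in
  degree n + K has first row at least n - K: its lower rows form one of finitely many tails
  \<open>mu\<close> of size at most \<open>2 * K\<close>, whatever n is.

  The obstacle is uniformity in n. Putting a geometric series 1 + y + y^2 + ... between the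
  remaining words gives one function on words that does not mention n; only the words at which it is
  evaluated grow. Interpolation reduces these to finitely many patterns around one long run of y,
  and elimination without division over the polynomials leaves a single common factor, whose
  finitely many roots are avoided.

  The ground field may carry no order, so positivity of the form on a Specht module is replaced by
  integrality: a sum of squares of integers, one of them positive, is nonzero in characteristic
  zero.\<close>

definition fdiff :: "(nat \<Rightarrow> 'a::ab_group_add) \<Rightarrow> nat \<Rightarrow> 'a" where
  "fdiff a = (\<lambda>n. a (Suc n) - a n)"

text \<open>Encodes "polynomial of degree below \<open>D\<close> from \<open>E\<close> on", with
  \<open>D = 0\<close> meaning zero from \<open>E\<close> on. In terms of differences, closure under
  convolution becomes a computation with power series.\<close>

definition evpoly :: "nat \<Rightarrow> nat \<Rightarrow> (nat \<Rightarrow> 'a::ab_group_add) \<Rightarrow> bool" where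
  "evpoly D E a \<longleftrightarrow> (\<forall>n\<ge>E. (fdiff ^^ D) a n = 0)"

lemma fdiff_pow_zero: "(fdiff ^^ D) (\<lambda>_. 0) = (\<lambda>_. 0)"
  by (induction D) (auto simp: fdiff_def)

lemma fdiff_pow_add: "(fdiff ^^ D) (\<lambda>n. a n + b n) = (\<lambda>n. (fdiff ^^ D) a n + (fdiff ^^ D) b n)"
  by (induction D) (auto simp: fdiff_def algebra_simps)

lemma fdiff_pow_mult: "(fdiff ^^ D) (\<lambda>n. c * a n) = (\<lambda>n. c * (fdiff ^^ D) a n)"
  for c :: "'a::ring"
  by (induction D) (auto simp: fdiff_def algebra_simps)

lemma fdiff_pow_sum: "(fdiff ^^ D) (\<lambda>n. \<Sum>i\<in>I. a i n) = (\<lambda>n. \<Sum>i\<in>I. (fdiff ^^ D) (a i) n)"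
proof (induction I rule: infinite_finite_induct)
  case (insert x F)
  then show ?case by (simp add: fdiff_pow_add)
qed (simp_all add: fdiff_pow_zero)

lemma evpoly_mono:
  assumes "evpoly D E a" "D \<le> D'" "E \<le> E'"
  shows "evpoly D' E' a"
proof -
  have "evpoly (D + k) E a" for k
    by (induction k) (use assms(1) in \<open>auto simp: evpoly_def fdiff_def\<close>)
  from this[of "D' - D"] show ?thesis using assms by (auto simp: evpoly_def)
qed

lemma evpoly_add: "evpoly D E a \<Longrightarrow> evpoly D E b \<Longrightarrow> evpoly D E (\<lambda>n. a n + b n)"
  by (auto simp: evpoly_def fdiff_pow_add)

lemma evpoly_mult: "evpoly D E a \<Longrightarrow> evpoly D E (\<lambda>n. c * a n)" for c :: "'a::ring"
  by (auto simp: evpoly_def fdiff_pow_mult)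

lemma evpoly_mult2: "evpoly D E a \<Longrightarrow> evpoly D E (\<lambda>n. a n * c)" for c :: "'a::comm_ring"
  using evpoly_mult[of D E a c] by (simp add: mult.commute)

lemma evpoly_sum: "(\<And>i. i \<in> I \<Longrightarrow> evpoly D E (a i)) \<Longrightarrow> evpoly D E (\<lambda>n. \<Sum>i\<in>I. a i n)"
  by (auto simp: evpoly_def fdiff_pow_sum)

lemma fdiff_pow_shift: "(fdiff ^^ D) (\<lambda>n. a (n + k)) = (\<lambda>n. (fdiff ^^ D) a (n + k))"
  by (induction D) (auto simp: fdiff_def)

text \<open>Multiplying a generating series by 1 - X takes differences of its coefficients, shifting
  the index by one each time.\<close>

lemma fps_fdiff:
  fixes a :: "nat \<Rightarrow> 'a::field"
  shows "fps_nth ((1 - fps_X) ^ D * Abs_fps a) (n + D) = (fdiff ^^ D) a n"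
proof (induction D arbitrary: n)
  case 0 show ?case by simp
next
  case (Suc D)
  have "(1 - fps_X) ^ Suc D * Abs_fps a
      = (1 - fps_X) ^ D * Abs_fps a - fps_X * ((1 - fps_X) ^ D * Abs_fps a)"
    by (simp add: algebra_simps)
  then show ?case using Suc[of "Suc n"] Suc[of n] by (simp add: fdiff_def)
qed

text \<open>Multiplied by suitable powers of 1 - X, the two series become polynomials of degrees
  below \<open>E1 + D1\<close> and \<open>E2 + D2\<close>, so their product has no coefficient from
  index \<open>E1 + E2 + D1 + D2\<close> on.\<close>

lemma evpoly_conv:
  fixes a b :: "nat \<Rightarrow> 'a::field"
  assumes a: "evpoly D1 E1 a" and b: "evpoly D2 E2 b"
  shows "evpoly (D1 + D2) (E1 + E2) (\<lambda>n. \<Sum>i\<le>n. a i * b (n - i))"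
  unfolding evpoly_def
proof (intro allI impI)
  fix n assume n: "E1 + E2 \<le> n"
  let ?P = "(1 - fps_X) ^ D1 * Abs_fps a" and ?Q = "(1 - fps_X) ^ D2 * Abs_fps b"
  have P: "fps_nth ?P k = 0" if "E1 + D1 \<le> k" for k
    using fps_fdiff[of D1 a "k - D1"] a that by (auto simp: evpoly_def)
  have Q: "fps_nth ?Q k = 0" if "E2 + D2 \<le> k" for k
    using fps_fdiff[of D2 b "k - D2"] b that by (auto simp: evpoly_def)
  have c: "Abs_fps (\<lambda>n. \<Sum>i\<le>n. a i * b (n - i)) = Abs_fps a * Abs_fps b"
    by (auto simp: fps_eq_iff fps_mult_nth atMost_atLeast0)
  have PQ: "(1 - fps_X) ^ (D1 + D2) * Abs_fps (\<lambda>n. \<Sum>i\<le>n. a i * b (n - i)) = ?P * ?Q"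
    unfolding c by (simp add: power_add mult_ac)
  have "fps_nth (?P * ?Q) (n + (D1 + D2)) = 0"
    unfolding fps_mult_nth[of ?P ?Q]
  proof (intro sum.neutral ballI)
    fix i assume "i \<in> {0..n + (D1 + D2)}"
    then have "E1 + D1 \<le> i \<or> E2 + D2 \<le> n + (D1 + D2) - i" using n by auto
    then show "fps_nth ?P i * fps_nth ?Q (n + (D1 + D2) - i) = 0"
    proof
      assume "E1 + D1 \<le> i" then show ?thesis using P[of i] by simp
    next
      assume "E2 + D2 \<le> n + (D1 + D2) - i" then show ?thesis using Q by simp
    qed
  qed
  then show "(fdiff ^^ (D1 + D2)) (\<lambda>n. \<Sum>i\<le>n. a i * b (n - i)) n = 0"
    using fps_fdiff[of "D1 + D2" "\<lambda>n. \<Sum>i\<le>n. a i * b (n - i)" n] unfolding PQ by simp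
qed

lemma newton_forward:
  fixes a :: "nat \<Rightarrow> 'a::comm_ring_1"
  shows "a n = (\<Sum>j\<le>n. of_nat (n choose j) * (fdiff ^^ j) a 0)"
proof (induction n arbitrary: a)
  case 0 show ?case by simp
next
  case (Suc n)
  have step: "a (Suc n) = a n + fdiff a n" by (simp add: fdiff_def)
  have "fdiff a n = (\<Sum>j\<le>n. of_nat (n choose j) * (fdiff ^^ Suc j) a 0)"
    using Suc[of "fdiff a"] by (simp add: funpow_swap1)
  moreover have "a n = (\<Sum>j\<le>Suc n. of_nat (n choose j) * (fdiff ^^ j) a 0)"
    using Suc[of a] by (simp add: binomial_eq_0)
  moreover have "\<dots> = a 0 + (\<Sum>j\<le>n. of_nat (n choose Suc j) * (fdiff ^^ Suc j) a 0)"
    by (subst sum.atMost_Suc_shift) simp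
  moreover have "(\<Sum>j\<le>Suc n. of_nat (Suc n choose j) * (fdiff ^^ j) a 0)
     = a 0 + (\<Sum>j\<le>n. of_nat (Suc n choose Suc j) * (fdiff ^^ Suc j) a 0)"
    by (subst sum.atMost_Suc_shift) simp
  ultimately show ?case unfolding step
    by (simp add: sum.distrib[symmetric] algebra_simps)
qed

lemma evpoly_newton:
  fixes a :: "nat \<Rightarrow> 'a::comm_ring_1"
  assumes "evpoly D E a"
  shows "a (n + E) = (\<Sum>j\<le>D. of_nat (n choose j) * (fdiff ^^ j) a E)"
proof -
  have z: "(fdiff ^^ j) a E = 0" if "j > D" for j
    using evpoly_mono[OF assms, of j E] that by (auto simp: evpoly_def)
  have "a (n + E) = (\<Sum>j\<le>n. of_nat (n choose j) * (fdiff ^^ j) a E)"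
    using newton_forward[of "\<lambda>n. a (n + E)" n] by (simp add: fdiff_pow_shift)
  also have "\<dots> = (\<Sum>j\<le>n + D. of_nat (n choose j) * (fdiff ^^ j) a E)"
    by (rule sum.mono_neutral_left) (auto simp: not_le binomial_eq_0)
  also have "\<dots> = (\<Sum>j\<le>D. of_nat (n choose j) * (fdiff ^^ j) a E)"
    by (rule sum.mono_neutral_right) (auto simp: not_le z)
  finally show ?thesis .
qed

lemma choose_poly: "\<exists>p :: 'a::field_char_0 poly. degree p \<le> j \<and> (\<forall>n. poly p (of_nat n) = of_nat (n choose j))"
proof (intro exI conjI allI)
  let ?p = "smult (1 / fact j) (\<Prod>i<j. [:- of_nat i, 1:]) :: 'a poly"
  have "degree (\<Prod>i<j. [:- of_nat i, 1:] :: 'a poly) \<le> (\<Sum>i<j. degree [:- of_nat i, 1:: 'a:])"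
    using degree_prod_sum_le[of "{..<j}" "\<lambda>i. [:- of_nat i, 1:: 'a:]"] by (simp add: comp_def)
  then show "degree ?p \<le> j" by simp
  show "poly ?p (of_nat n) = of_nat (n choose j)" for n
    by (simp add: binomial_gbinomial gbinomial_prod_rev poly_prod lessThan_atLeast0)
qed

text \<open>Newton interpolation with base point \<open>E\<close>; in characteristic zero the
  binomial coefficients are polynomials in n.\<close>

lemma evpoly_imp_poly:
  fixes a :: "nat \<Rightarrow> 'a::field_char_0"
  assumes "evpoly D E a"
  shows "\<exists>p. degree p \<le> D \<and> (\<forall>n\<ge>E. a n = poly p (of_nat n))"
proof -
  obtain b :: "nat \<Rightarrow> 'a poly" where b: "degree (b j) \<le> j" "poly (b j) (of_nat n) = of_nat (n choose j)" for j n
    using choose_poly by metis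
  let ?p = "\<Sum>j\<le>D. smult ((fdiff ^^ j) a E) (b j \<circ>\<^sub>p [:- of_nat E, 1:])"
  have "degree ?p \<le> D"
    by (rule degree_sum_le) (auto intro!: order.trans[OF degree_smult_le] order.trans[OF degree_pcompose_le] b
        intro: order.trans[OF b(1)])
  moreover have "a n = poly ?p (of_nat n)" if "E \<le> n" for n
    using evpoly_newton[OF assms, of "n - E"] that b(2)[of _ "n - E"]
    by (simp add: poly_sum poly_pcompose of_nat_diff mult.commute)
  ultimately show ?thesis by blast
qed

section \<open>Functions on words that are polynomial along every run of a letter\<close>

text \<open>\<open>D\<close> and \<open>E\<close> are uniform in the context \<open>u\<close>,
  \<open>w\<close>, which may itself contain \<open>y\<close>; on a word with several runs of
  \<open>y\<close> the function is therefore controlled in each run length separately.\<close>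

definition runp :: "nat \<Rightarrow> nat \<Rightarrow> nat \<Rightarrow> (nat list \<Rightarrow> 'a::field) \<Rightarrow> bool" where
  "runp y D E f \<longleftrightarrow> (\<forall>u w. evpoly D E (\<lambda>s. f (u @ replicate s y @ w)))"

lemma runp_mono: "runp y D E f \<Longrightarrow> D \<le> D' \<Longrightarrow> E \<le> E' \<Longrightarrow> runp y D' E' f"
  unfolding runp_def by (blast intro: evpoly_mono)

lemma runp_sum: "(\<And>i. i \<in> I \<Longrightarrow> runp y D E (f i)) \<Longrightarrow> runp y D E (\<lambda>x. \<Sum>i\<in>I. f i x)"
  unfolding runp_def by (intro allI evpoly_sum) auto

lemma runp_mult: "runp y D E f \<Longrightarrow> runp y D E (\<lambda>x. c * f x)"
  unfolding runp_def by (intro allI evpoly_mult) auto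

lemma sum_lessThan_add: "sum h {..<a + b} = sum h {..<a} + (\<Sum>i<b. h (a + i))"
  for h :: "nat \<Rightarrow> 'a::comm_monoid_add"
  by (induction b) (auto simp: add.assoc)

text \<open>The cut falls before the end of \<open>u\<close>, anywhere in the run including both its
  ends, or after at least one letter of \<open>w\<close>; the \<open>Suc j\<close> keeps the
  boundary between run and \<open>w\<close> from being counted twice. The middle sum is a
  convolution in \<open>s\<close>, and in the outer sums one factor is constant in
  \<open>s\<close>.\<close>

lemma fmul_run:
  "fmul f g (u @ replicate s y @ w) =
     (\<Sum>k<length u. f (take k u) * g (drop k u @ replicate s y @ w))
   + (\<Sum>i\<le>s. f (u @ replicate i y) * g (replicate (s - i) y @ w))
   + (\<Sum>j<length w. f (u @ replicate s y @ take (Suc j) w) * g (drop (Suc j) w))"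
proof -
  let ?x = "u @ replicate s y @ w"
  let ?h = "\<lambda>k. f (take k ?x) * g (drop k ?x)"
  have "fmul f g ?x = sum ?h {..<length u + (Suc s + length w)}"
    unfolding fmul_def by (simp add: lessThan_Suc_atMost)
  also have "\<dots> = sum ?h {..<length u} + (\<Sum>i<Suc s + length w. ?h (length u + i))"
    by (rule sum_lessThan_add)
  also have "(\<Sum>i<Suc s + length w. ?h (length u + i))
     = (\<Sum>i<Suc s. ?h (length u + i)) + (\<Sum>j<length w. ?h (length u + (Suc s + j)))"
    by (rule sum_lessThan_add)
  also have "sum ?h {..<length u} = (\<Sum>k<length u. f (take k u) * g (drop k u @ replicate s y @ w))"
    by (rule sum.cong) auto
  also have "(\<Sum>i<Suc s. ?h (length u + i)) = (\<Sum>i\<le>s. f (u @ replicate i y) * g (replicate (s - i) y @ w))"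
    unfolding lessThan_Suc_atMost by (rule sum.cong) (auto simp: min_def)
  also have "(\<Sum>j<length w. ?h (length u + (Suc s + j)))
    = (\<Sum>j<length w. f (u @ replicate s y @ take (Suc j) w) * g (drop (Suc j) w))"
    by (rule sum.cong) (auto simp: Suc_diff_le)
  finally show ?thesis by (simp add: add.assoc)
qed

lemma runp_fmul:
  assumes f: "runp y D1 E1 f" and g: "runp y D2 E2 g"
  shows "runp y (D1 + D2) (E1 + E2) (fmul f g)"
  unfolding runp_def fmul_run
proof (intro allI evpoly_add evpoly_sum)
  fix u w :: "nat list" and k
  have "evpoly D2 E2 (\<lambda>s. g (drop k u @ replicate s y @ w))" using g by (simp add: runp_def)
  then show "evpoly (D1 + D2) (E1 + E2) (\<lambda>s. f (take k u) * g (drop k u @ replicate s y @ w))"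
    by (rule evpoly_mult[OF evpoly_mono]) auto
next
  fix u w :: "nat list" and k
  have "evpoly D1 E1 (\<lambda>s. f (u @ replicate s y @ take (Suc k) w))" using f by (simp add: runp_def)
  then show "evpoly (D1 + D2) (E1 + E2) (\<lambda>s. f (u @ replicate s y @ take (Suc k) w) * g (drop (Suc k) w))"
    by (rule evpoly_mult2[OF evpoly_mono]) auto
next
  fix u w :: "nat list"
  have "evpoly D1 E1 (\<lambda>i. f (u @ replicate i y))" using f[unfolded runp_def, rule_format, of u "[]"] by simp
  moreover have "evpoly D2 E2 (\<lambda>i. g (replicate i y @ w))" using g[unfolded runp_def, rule_format, of "[]" w] by simp
  ultimately show "evpoly (D1 + D2) (E1 + E2) (\<lambda>s. \<Sum>i\<le>s. f (u @ replicate i y) * g (replicate (s - i) y @ w))"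
    by (rule evpoly_conv)
qed

definition wmono :: "nat list \<Rightarrow> nat list \<Rightarrow> 'a::field" where
  "wmono x = (\<lambda>w. if w = x then 1 else 0)"

text \<open>A word cannot contain a run longer than itself, so the coefficient is zero from run
  length \<open>length x + 1\<close> on.\<close>

lemma runp_mono_word: "runp y 0 (Suc (length x)) (wmono x)"
  by (auto simp: runp_def evpoly_def wmono_def)

lemma runp_all: "runp y 1 0 (\<lambda>w. if set w \<subseteq> {y} then 1 else 0 :: 'a::field)"
  by (auto simp: runp_def evpoly_def fdiff_def)

text \<open>Along the line \<open>s + t = T\<close> the values of \<open>f\<close> are polynomial of degree at most \<open>2 * D\<close>.\<close>
lemma runp_line_zero:
  fixes f :: "nat list \<Rightarrow> 'a::field_char_0"
  assumes f: "runp y D E f"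
    and z: "\<And>j. j \<in> J \<Longrightarrow> f (u @ replicate j y @ v @ replicate (T - j) y @ w) = 0"
    and J: "\<And>j. j \<in> J \<Longrightarrow> E \<le> j \<and> j + E \<le> T" "2 * D < card J" and i: "E \<le> i" "i + E \<le> T"
  shows "f (u @ replicate i y @ v @ replicate (T - i) y @ w) = 0"
proof -
  define H where "H s t = f (u @ replicate s y @ v @ replicate t y @ w)" for s t
  have H1: "evpoly D E (\<lambda>s. H s t)" for t using f by (simp add: runp_def H_def)
  have H2: "evpoly D E (H s)" for s unfolding H_def
    using f[unfolded runp_def, rule_format, of "u @ replicate s y @ v" w] by simp
  \<comment> \<open>For fixed \<open>s\<close> these differences are linear combinations of
    functions of \<open>t\<close> that share the bounds \<open>D\<close> and
    \<open>E\<close>.\<close>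
  have dH: "evpoly D E (\<lambda>t. (fdiff ^^ j) (\<lambda>s. H s t) s)" for j s
  proof (induction j arbitrary: s)
    case 0 show ?case using H2[of s] by simp
  next
    case (Suc j)
    have "evpoly D E (\<lambda>t. (fdiff ^^ j) (\<lambda>s. H s t) (Suc s) + (-1) * (fdiff ^^ j) (\<lambda>s. H s t) s)"
      by (intro evpoly_add evpoly_mult Suc)
    then show ?case by (simp add: fdiff_def[of "(fdiff ^^ j) _"])
  qed
  obtain q where q: "\<And>j. degree (q j) \<le> D"
    "\<And>j t. t \<ge> E \<Longrightarrow> (fdiff ^^ j) (\<lambda>s. H s t) E = poly (q j) (of_nat t)"
    using evpoly_imp_poly[OF dH[of _ E]] by metis
  obtain b :: "nat \<Rightarrow> 'a poly" where b: "degree (b j) \<le> j" "poly (b j) (of_nat n) = of_nat (n choose j)" for j n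
    using choose_poly by metis
  \<comment> \<open>Newton expansion in \<open>s\<close> at base point \<open>E\<close>, with
    \<open>t = T - s\<close> inserted in its polynomial coefficients. Both factors have degree at
    most \<open>D\<close>, whence the bound \<open>2 * D\<close>.\<close>
  define p where "p = (\<Sum>j\<le>D. (b j \<circ>\<^sub>p [:- of_nat E, 1:]) * (q j \<circ>\<^sub>p [:of_nat T, -1:]))"
  have hp: "H s (T - s) = poly p (of_nat s)" if "E \<le> s" "s + E \<le> T" for s
  proof -
    have "H s (T - s) = (\<Sum>j\<le>D. of_nat ((s - E) choose j) * (fdiff ^^ j) (\<lambda>s. H s (T - s')) E)"
      if "s' = s" for s'
      using evpoly_newton[OF H1[of "T - s"], of "s - E"] \<open>E \<le> s\<close> that by simp
    from this[OF refl] show ?thesis using that b(2)[of _ "s - E"]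
      by (simp add: p_def poly_sum poly_pcompose of_nat_diff q(2))
  qed
  have dp: "degree p \<le> 2 * D" unfolding p_def
  proof (rule degree_sum_le)
    fix j assume j: "j \<in> {..D}"
    have "degree (b j \<circ>\<^sub>p [:- of_nat E, 1:]) \<le> D"
      using degree_pcompose_le[of "b j" "[:- of_nat E, 1:]"] b(1)[of j] j by simp
    moreover have "degree (q j \<circ>\<^sub>p [:of_nat T, -1:]) \<le> D"
      using degree_pcompose_le[of "q j" "[:of_nat T, -1:]"] q(1)[of j] by simp
    ultimately show "degree ((b j \<circ>\<^sub>p [:- of_nat E, 1:]) * (q j \<circ>\<^sub>p [:of_nat T, -1:])) \<le> 2 * D"
      using degree_mult_le[of "b j \<circ>\<^sub>p [:- of_nat E, 1:]" "q j \<circ>\<^sub>p [:of_nat T, -1:]"] by linarith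
  qed simp
  have "p = 0"
  proof (rule ccontr)
    assume p: "p \<noteq> 0"
    have sub: "of_nat ` J \<subseteq> {x. poly p x = 0}"
      using hp z J(1) by (fastforce simp: H_def)
    have "card (of_nat ` J :: 'a set) \<le> card {x. poly p x = 0}"
      by (rule card_mono[OF poly_roots_finite[OF p] sub])
    also have "card (of_nat ` J :: 'a set) = card J"
      by (subst card_image) (auto simp: inj_on_def)
    also have "card {x. poly p x = 0} \<le> degree p" by (rule card_poly_roots_bound[OF p])
    finally show False using dp J(2) by simp
  qed
  then show ?thesis using hp[OF i] by (simp add: H_def)
qed

text \<open>Pigeonhole on the at most \<open>k + 1\<close> blocks of \<open>y\<close> separated by
  the other letters. The induction strips an initial block shorter than \<open>L\<close> together
  with the letter that ends it.\<close>

lemma long_run: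
  assumes "length (filter (\<lambda>x. x \<noteq> y) x) \<le> k" "(k + 1) * (L + 1) \<le> length x + 1"
  shows "\<exists>u w. x = u @ replicate L y @ w"
  using assms
proof (induction k arbitrary: x)
  case 0
  then have "x = replicate (length x) y"
    by (metis (mono_tags, lifting) filter_False filter_empty_conv le_zero_eq length_0_conv replicate_eqI)
  moreover have "length x = L + (length x - L)" using 0 by simp
  ultimately have "x = [] @ replicate L y @ replicate (length x - L) y"
    by (metis append_Nil replicate_add)
  then show ?case by blast
next
  case (Suc k)
  let ?t = "takeWhile (\<lambda>x. x = y) x" and ?d = "dropWhile (\<lambda>x. x = y) x"
  have t: "?t = replicate (length ?t) y"
    by (metis (mono_tags, lifting) replicate_eqI set_takeWhileD)
  show ?case
  proof (cases "L \<le> length ?t")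
    case True
    then have "length ?t = L + (length ?t - L)" by simp
    with t have "?t = replicate L y @ replicate (length ?t - L) y" by (metis replicate_add)
    then have "x = [] @ replicate L y @ (replicate (length ?t - L) y @ ?d)"
      by (metis append.assoc append_Nil takeWhile_dropWhile_id)
    then show ?thesis by blast
  next
    case False
    have lx: "length x = length ?t + length ?d" by (metis length_append takeWhile_dropWhile_id)
    have "length ?d > 0" using False Suc.prems(2) lx by (simp del: length_greater_0_conv)
    then have "?d \<noteq> []" by (metis length_greater_0_conv)
    then obtain z d' where d: "?d = z # d'" by (cases ?d) auto
    then have "z \<noteq> y" using hd_dropWhile[of "\<lambda>x. x = y" x] by simp
    have xe: "x = ?t @ z # d'" using d by (metis takeWhile_dropWhile_id)
    then have "length (filter (\<lambda>x. x \<noteq> y) x) = length (filter (\<lambda>x. x \<noteq> y) ?t) + Suc (length (filter (\<lambda>x. x \<noteq> y) d'))"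
      using \<open>z \<noteq> y\<close> by (metis (mono_tags, lifting) filter.simps(2) filter_append length_Cons length_append)
    then have "length (filter (\<lambda>x. x \<noteq> y) d') \<le> k" using Suc.prems(1) by simp
    moreover have "(k + 1) * (L + 1) \<le> length d' + 1"
      using Suc.prems(2) False lx d by simp
    ultimately obtain u w where "d' = u @ replicate L y @ w" using Suc.IH by blast
    then have "x = (?t @ z # u) @ replicate L y @ w" using xe by (metis append.assoc append_Cons)
    then show ?thesis by blast
  qed
qed

text \<open>Rearrangements of \<open>x\<close> with one run and short surroundings form a test set.
  If \<open>u\<close> or \<open>w\<close> is long it contains a second run of length
  \<open>L\<close>; moving letters between the two runs keeps the content, and at
  \<open>2 * D + 1\<close> nodes the surroundings get shorter, so induction and interpolation along
  the line give the value. \<open>L\<close> exceeds all nodes \<open>E\<close>, ...,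
  \<open>E + 2 * D\<close>, and surroundings longer than \<open>L0\<close> leave one side long
  enough for \<open>long_run\<close>.\<close>

lemma runp_determined:
  fixes f :: "nat list \<Rightarrow> 'a::field_char_0"
  assumes f: "runp y D E f"
    and L: "L = E + 2 * D + 1" and L0: "L0 = 2 * (k + 1) * (L + 1)"
    and k: "length (filter (\<lambda>x. x \<noteq> y) x) \<le> k" and x: "(k + 1) * (L + 1) \<le> length x"
    and z: "\<And>u s w. mset (u @ replicate s y @ w) = mset x \<Longrightarrow> length u + length w \<le> L0 \<Longrightarrow>
       f (u @ replicate s y @ w) = 0"
  shows "f x = 0"
proof -
  have len: "length (filter (\<lambda>x. x \<noteq> y) x') \<le> k" if "mset x' = mset x" for x'
    using k that by (metis mset_filter size_mset)
  have main: "mset (u @ replicate s y @ w) = mset x \<Longrightarrow> E \<le> s \<Longrightarrow> f (u @ replicate s y @ w) = 0" for u s w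
  proof (induction "length u + length w" arbitrary: u s w rule: less_induct)
    case less
    show ?case
    proof (cases "length u + length w \<le> L0")
      case True then show ?thesis using z less.prems by blast
    next
      case False
      then have big: "(k + 1) * (L + 1) \<le> length u \<or> (k + 1) * (L + 1) \<le> length w" unfolding L0 by auto
      have fu: "length (filter (\<lambda>x. x \<noteq> y) u) \<le> k" "length (filter (\<lambda>x. x \<noteq> y) w) \<le> k"
        using len[OF less.prems(1)] by auto
      from big show ?thesis
      proof
        assume "(k + 1) * (L + 1) \<le> length u"
        then obtain u1 u2 where u: "u = u1 @ replicate L y @ u2" using long_run[OF fu(1)] by fastforce
        have "f (u1 @ replicate L y @ u2 @ replicate ((L + s) - L) y @ w) = 0"
        proof (rule runp_line_zero[OF f, where J = "{E..E + 2 * D}"])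
          fix j assume "j \<in> {E..E + 2 * D}"
          then have j: "E \<le> j" "j \<le> E + 2 * D" by auto
          have "f ((u1 @ replicate j y @ u2) @ replicate (L + s - j) y @ w) = 0"
          proof (rule less.hyps)
            show "length (u1 @ replicate j y @ u2) + length w < length u + length w" using j u L by simp
            have "replicate_mset j y + replicate_mset (L + s - j) y = replicate_mset L y + replicate_mset s y"
              using j L by (intro multiset_eqI) simp
            then have "mset ((u1 @ replicate j y @ u2) @ replicate (L + s - j) y @ w)
               = mset (u @ replicate s y @ w)"
              unfolding u by (simp add: algebra_simps)
            then show "mset ((u1 @ replicate j y @ u2) @ replicate (L + s - j) y @ w) = mset x"
              by (rule trans[OF _ less.prems(1)])
            show "E \<le> L + s - j" using j less.prems L by simp
          qed
          then show "f (u1 @ replicate j y @ u2 @ replicate (L + s - j) y @ w) = 0" by simp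
        qed (use less.prems L in auto)
        then show ?thesis using u by simp
      next
        assume "(k + 1) * (L + 1) \<le> length w"
        then obtain u1 u2 where u: "w = u1 @ replicate L y @ u2" using long_run[OF fu(2)] by fastforce
        have "f (u @ replicate s y @ u1 @ replicate ((L + s) - s) y @ u2) = 0"
        \<comment> \<open>Here the main run comes first on the line, so the nodes are its lengths
          beyond \<open>s\<close>; the second run keeps at least \<open>L - 1 - 2 * D = E\<close>
          letters.\<close>
        proof (rule runp_line_zero[OF f, where J = "{s + 1..s + 1 + 2 * D}"])
          fix j assume "j \<in> {s + 1..s + 1 + 2 * D}"
          then have j: "s < j" "j \<le> s + 1 + 2 * D" by auto
          show "f (u @ replicate j y @ u1 @ replicate (L + s - j) y @ u2) = 0"
          proof (rule less.hyps)
            show "length u + length (u1 @ replicate (L + s - j) y @ u2) < length u + length w" using j u L by simp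
            have "replicate_mset j y + replicate_mset (L + s - j) y = replicate_mset L y + replicate_mset s y"
              using j L by (intro multiset_eqI) simp
            then have "mset (u @ replicate j y @ u1 @ replicate (L + s - j) y @ u2)
               = mset (u @ replicate s y @ w)"
              unfolding u by (simp add: algebra_simps)
            then show "mset (u @ replicate j y @ u1 @ replicate (L + s - j) y @ u2) = mset x"
              by (rule trans[OF _ less.prems(1)])
            show "E \<le> j" using j less.prems by simp
          qed
        qed (use less.prems L in auto)
        then show ?thesis using u by simp
      qed
    qed
  qed
  obtain u w where "x = u @ replicate E y @ w"
  proof -
    have "(k + 1) * (E + 1) \<le> (k + 1) * (L + 1)" unfolding L by (rule mult_le_mono) auto
    then have "(k + 1) * (E + 1) \<le> length x + 1" using x by linarith
    then show ?thesis using long_run[OF k] that by blast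
  qed
  then show ?thesis using main[of u E w] by simp
qed

section \<open>Linear algebra over function spaces and stable ranks\<close>

text \<open>Independence of the indexed family rather than of its range: repeated vectors count as a
  dependence, so on a finite index set the number of indices is a rank.\<close>

definition findep :: "'i set \<Rightarrow> ('i \<Rightarrow> 'x \<Rightarrow> 'a::field) \<Rightarrow> bool" where
  "findep I v \<longleftrightarrow> (\<forall>c. (\<forall>x. (\<Sum>i\<in>I. c i * v i x) = 0) \<longrightarrow> (\<forall>i\<in>I. c i = 0))"

definition subsp :: "('x \<Rightarrow> 'a::field) set \<Rightarrow> bool" where
  "subsp X \<longleftrightarrow> (\<lambda>x. 0) \<in> X \<and> (\<forall>p\<in>X. \<forall>q\<in>X. (\<lambda>x. p x + q x) \<in> X) \<and> (\<forall>c. \<forall>p\<in>X. (\<lambda>x. c * p x) \<in> X)"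

lemma subspI:
  assumes "(\<lambda>x. 0) \<in> X" "\<And>p q. p \<in> X \<Longrightarrow> q \<in> X \<Longrightarrow> (\<lambda>x. p x + q x) \<in> X"
    "\<And>c p. p \<in> X \<Longrightarrow> (\<lambda>x. c * p x) \<in> X"
  shows "subsp X"
  using assms by (auto simp: subsp_def)

lemma subsp_lcomb:
  assumes "subsp X" "\<And>i. i \<in> I \<Longrightarrow> v i \<in> X"
  shows "(\<lambda>x. \<Sum>i\<in>I. c i * v i x) \<in> X"
  using assms(2)
proof (induction I rule: infinite_finite_induct)
  case (insert i F)
  have "(\<lambda>x. c i * v i x) \<in> X" using assms(1) insert by (auto simp: subsp_def)
  then show ?case using assms(1) insert by (auto simp: subsp_def)
qed (use assms(1) in \<open>auto simp: subsp_def\<close>)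

lemma subsp_sum:
  assumes "subsp X" "\<And>i. i \<in> I \<Longrightarrow> v i \<in> X"
  shows "(\<lambda>x. \<Sum>i\<in>I. v i x) \<in> X"
  using subsp_lcomb[OF assms, of I "\<lambda>i. i" "\<lambda>_. 1"] by simp

lemma subsp_fspan: "subsp (fspan S)"
proof (rule subspI)
  show "(\<lambda>x. 0) \<in> fspan S" unfolding fspan_def by (auto intro!: exI[of _ "{}"])
next
  fix p q assume "p \<in> fspan S" "q \<in> fspan S"
  then obtain A c B d where AB: "finite A" "A \<subseteq> S" "p = (\<lambda>x. \<Sum>a\<in>A. c a * a x)"
     "finite B" "B \<subseteq> S" "q = (\<lambda>x. \<Sum>a\<in>B. d a * a x)" unfolding fspan_def by blast
  let ?c = "\<lambda>a. (if a \<in> A then c a else 0) + (if a \<in> B then d a else 0)"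
  have "(\<lambda>x. p x + q x) = (\<lambda>x. \<Sum>a\<in>A \<union> B. ?c a * a x)"
  proof
    fix x
    have "p x = (\<Sum>a\<in>A \<union> B. (if a \<in> A then c a else 0) * a x)" unfolding AB(3)
      by (rule sum.mono_neutral_cong_left) (use AB in auto)
    moreover have "q x = (\<Sum>a\<in>A \<union> B. (if a \<in> B then d a else 0) * a x)" unfolding AB(6)
      by (rule sum.mono_neutral_cong_left) (use AB in auto)
    ultimately show "p x + q x = (\<Sum>a\<in>A \<union> B. ?c a * a x)"
      by (simp add: sum.distrib[symmetric] distrib_right)
  qed
  then show "(\<lambda>x. p x + q x) \<in> fspan S" unfolding fspan_def
    using AB by (intro CollectI exI[of _ "A \<union> B"] exI[of _ ?c]) auto
next
  fix k p assume "p \<in> fspan S"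
  then obtain A c where AB: "finite A" "A \<subseteq> S" "p = (\<lambda>x. \<Sum>a\<in>A. c a * a x)" unfolding fspan_def by blast
  then show "(\<lambda>x. k * p x) \<in> fspan S" unfolding fspan_def
    by (intro CollectI exI[of _ A] exI[of _ "\<lambda>a. k * c a"]) (auto simp: sum_distrib_left mult.assoc)
qed

lemma fspan_base: "a \<in> S \<Longrightarrow> a \<in> fspan S"
  unfolding fspan_def by (intro CollectI exI[of _ "{a}"] exI[of _ "\<lambda>_. 1"]) auto

lemma fspan_minimal: "subsp X \<Longrightarrow> S \<subseteq> X \<Longrightarrow> fspan S \<subseteq> X"
  unfolding fspan_def by (auto intro!: subsp_lcomb)

lemma fspan_image_iff:
  assumes "finite I"
  shows "x \<in> fspan (v ` I) \<longleftrightarrow> (\<exists>c. x = (\<lambda>y. \<Sum>i\<in>I. c i * v i y))"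
proof
  let ?X = "{x. \<exists>c. x = (\<lambda>y. \<Sum>i\<in>I. c i * v i y)}"
  have "subsp ?X"
  proof (rule subspI)
    show "(\<lambda>x. 0) \<in> ?X" by (auto intro!: exI[of _ "\<lambda>_. 0"])
  next
    fix p q assume "p \<in> ?X" "q \<in> ?X"
    then obtain c d where "p = (\<lambda>y. \<Sum>i\<in>I. c i * v i y)" "q = (\<lambda>y. \<Sum>i\<in>I. d i * v i y)" by auto
    then show "(\<lambda>x. p x + q x) \<in> ?X"
      by (auto intro!: exI[of _ "\<lambda>i. c i + d i"] simp: sum.distrib distrib_right)
  next
    fix k p assume "p \<in> ?X"
    then obtain c where "p = (\<lambda>y. \<Sum>i\<in>I. c i * v i y)" by auto
    then show "(\<lambda>x. k * p x) \<in> ?X"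
      by (auto intro!: exI[of _ "\<lambda>i. k * c i"] simp: sum_distrib_left mult.assoc)
  qed
  moreover have "v ` I \<subseteq> ?X"
  proof
    fix a assume "a \<in> v ` I"
    then obtain i where i: "i \<in> I" "a = v i" by auto
    have "a = (\<lambda>y. \<Sum>j\<in>I. (if j = i then 1 else 0) * v j y)"
      using i assms by (simp add: if_distrib[of "\<lambda>z. z * _"] cong: if_cong)
    then have "\<exists>c. a = (\<lambda>y. \<Sum>i\<in>I. c i * v i y)" by (rule exI[of _ "\<lambda>j. if j = i then 1 else 0"])
    then show "a \<in> ?X" by simp
  qed
  ultimately have "fspan (v ` I) \<subseteq> ?X" by (rule fspan_minimal)
  then show "x \<in> fspan (v ` I) \<Longrightarrow> \<exists>c. x = (\<lambda>y. \<Sum>i\<in>I. c i * v i y)" by blast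
  show "\<exists>c. x = (\<lambda>y. \<Sum>i\<in>I. c i * v i y) \<Longrightarrow> x \<in> fspan (v ` I)"
    by (elim exE) (simp add: subsp_lcomb[OF subsp_fspan] fspan_base)
qed

text \<open>The pointwise operations form a \<open>vector_space\<close> in the sense of the library,
  whose exchange lemma applies; independence makes \<open>v\<close> injective on \<open>I\<close>,
  so that cardinalities can be compared.\<close>

lemma findep_card_le:
  fixes v :: "'i \<Rightarrow> 'x \<Rightarrow> 'a::field"
  assumes I: "finite I" and S: "finite S" and v: "findep I v" "\<And>i. i \<in> I \<Longrightarrow> v i \<in> fspan S"
  shows "card I \<le> card S"
proof -
  interpret V: vector_space "\<lambda>(c::'a) (f::'x \<Rightarrow> 'a) x. c * f x"
    by standard (auto simp: fun_eq_iff algebra_simps)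
  have sf: "(\<Sum>i\<in>J. f i) x = (\<Sum>i\<in>J. f i x)" for f :: "'k \<Rightarrow> 'x \<Rightarrow> 'a" and J x
    by (induction J rule: infinite_finite_induct) auto
  have inj: "inj_on v I"
  proof (rule inj_onI, rule ccontr)
    fix i j assume ij: "i \<in> I" "j \<in> I" "v i = v j" "i \<noteq> j"
    let ?c = "\<lambda>k. if k = i then 1 else if k = j then -1 else 0 :: 'a"
    have "(\<Sum>k\<in>I. ?c k * v k x) = (\<Sum>k\<in>{i, j}. ?c k * v k x)" for x
      by (rule sum.mono_neutral_right) (use ij I in auto)
    then have "(\<Sum>k\<in>I. ?c k * v k x) = 0" for x using ij by simp
    then show False using v(1)[unfolded findep_def, rule_format, of ?c i] ij(1) by simp
  qed
  have "V.independent (v ` I)"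
  proof
    assume "V.dependent (v ` I)"
    then obtain u where u: "\<exists>w\<in>v ` I. u w \<noteq> 0" "(\<Sum>w\<in>v ` I. (\<lambda>x. u w * w x)) = 0"
      using I by (auto simp: V.dependent_finite)
    have "(\<Sum>i\<in>I. u (v i) * v i x) = 0" for x
    proof -
      have "(\<Sum>w\<in>v ` I. (\<lambda>x. u w * w x)) x = 0" using u(2) by simp
      then show ?thesis unfolding sf by (subst (asm) sum.reindex[OF inj]) simp
    qed
    then have "\<forall>i\<in>I. u (v i) = 0" using v(1)[unfolded findep_def, rule_format, of "\<lambda>i. u (v i)"] by simp
    then show False using u(1) by auto
  qed
  moreover have "v ` I \<subseteq> V.span S"
  proof -
    have "fspan S \<subseteq> V.span S"
    proof (rule fspan_minimal)
      show "subsp (V.span S)"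
        using V.span_zero V.span_add V.span_scale
        by (intro subspI) (force simp: plus_fun_def zero_fun_def)+
    qed (auto intro: V.span_base)
    then show ?thesis using v(2) by auto
  qed
  ultimately have "card (v ` I) \<le> card S" using V.independent_span_bound[OF S] by blast
  then show ?thesis using card_image[OF inj] by simp
qed

lemma findep_subset: "findep I v \<Longrightarrow> J \<subseteq> I \<Longrightarrow> finite I \<Longrightarrow> findep J v"
  unfolding findep_def
proof (intro allI impI ballI)
  fix c j assume a: "\<forall>c. (\<forall>x. (\<Sum>i\<in>I. c i * v i x) = 0) \<longrightarrow> (\<forall>i\<in>I. c i = 0)" "J \<subseteq> I" "finite I"
    "\<forall>x. (\<Sum>i\<in>J. c i * v i x) = 0" "j \<in> J"
  let ?c = "\<lambda>i. if i \<in> J then c i else 0"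
  have "(\<Sum>i\<in>I. ?c i * v i x) = (\<Sum>i\<in>J. c i * v i x)" for x
    by (rule sum.mono_neutral_cong_right) (use a in auto)
  then have "\<forall>i\<in>I. ?c i = 0" using a(1)[rule_format, of ?c] a(4) by auto
  then show "c j = 0" using a by (auto split: if_splits)
qed

text \<open>A vector outside the span could be added to the family under the index
  \<open>None\<close>, giving more independent vectors than the spanning set allows.\<close>

lemma findep_spans:
  fixes v :: "'i \<Rightarrow> 'x \<Rightarrow> 'a::field"
  assumes I: "finite I" and S: "finite S" and v: "findep I v" "\<And>i. i \<in> I \<Longrightarrow> v i \<in> fspan S"
    and card: "card S \<le> card I"
  shows "fspan S \<subseteq> fspan (v ` I)"
proof
  fix x assume x: "x \<in> fspan S"
  show "x \<in> fspan (v ` I)"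
  proof (rule ccontr)
    assume nx: "x \<notin> fspan (v ` I)"
    define v' where "v' i = (case i of None \<Rightarrow> x | Some j \<Rightarrow> v j)" for i
    let ?J = "insert None (Some ` I)"
    have "findep ?J v'"
      unfolding findep_def
    proof (intro allI impI)
      fix c assume c: "\<forall>y. (\<Sum>i\<in>?J. c i * v' i y) = 0"
      have s: "c None * x y + (\<Sum>i\<in>I. c (Some i) * v i y) = 0" for y
        using c[rule_format, of y] I by (simp add: sum.reindex v'_def)
      have "c None = 0"
      proof (rule ccontr)
        assume n: "c None \<noteq> 0"
        have "x = (\<lambda>y. \<Sum>i\<in>I. (- c (Some i) / c None) * v i y)"
        proof
          fix y
          have "x y = - (\<Sum>i\<in>I. c (Some i) * v i y) / c None"
            using s[of y] n by (simp add: field_simps eq_neg_iff_add_eq_0)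
          then show "x y = (\<Sum>i\<in>I. (- c (Some i) / c None) * v i y)"
            by (simp add: sum_divide_distrib sum_negf)
        qed
        then have "\<exists>c. x = (\<lambda>y. \<Sum>i\<in>I. c i * v i y)" by (rule exI[of _ "\<lambda>i. - c (Some i) / c None"])
        then show False using nx fspan_image_iff[OF I, of x v] by simp
      qed
      moreover have "\<forall>i\<in>I. c (Some i) = 0"
        using v(1)[unfolded findep_def, rule_format, of "\<lambda>i. c (Some i)"] s calculation by simp
      ultimately show "\<forall>i\<in>?J. c i = 0" by auto
    qed
    then have "card ?J \<le> card S"
      by (rule findep_card_le[rotated 2]) (use I S v(2) x in \<open>auto simp: v'_def\<close>)
    moreover have "card ?J = Suc (card I)" using I by (simp add: card_image)
    ultimately show False using card by simp
  qed
qed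

text \<open>Fraction-free Gaussian elimination: \<open>d\<close> collects the pivots and \<open>w\<close> is, up to \<open>d\<close>, a dual basis.\<close>
lemma fraction_free_basis:
  fixes v :: "'t \<Rightarrow> 'q \<Rightarrow> 'r::idom"
  assumes "finite T" "finite Q"
  shows "\<exists>T0 d p w. T0 \<subseteq> T \<and> d \<noteq> 0 \<and>
     (\<forall>t\<in>T. \<forall>q\<in>Q. d * v t q = (\<Sum>s\<in>T0. p t s * v s q)) \<and>
     (\<forall>s\<in>T0. \<forall>s'\<in>T0. (\<Sum>q\<in>Q. w s q * v s' q) = (if s = s' then d else 0))"
  using assms(1)
proof (induction T rule: finite_induct)
  case empty
  show ?case by (rule exI[of _ "{}"], rule exI[of _ 1]) auto
next
  case (insert t T)
  from insert.IH obtain T0 d p w where ih: "T0 \<subseteq> T \<and> d \<noteq> 0 \<and>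
     (\<forall>t\<in>T. \<forall>q\<in>Q. d * v t q = (\<Sum>s\<in>T0. p t s * v s q)) \<and>
     (\<forall>s\<in>T0. \<forall>s'\<in>T0. (\<Sum>q\<in>Q. w s q * v s' q) = (if s = s' then d else 0))"
    by (elim exE) (rule that)
  then have T0: "T0 \<subseteq> T" "d \<noteq> 0"
    and p: "\<And>t q. t \<in> T \<Longrightarrow> q \<in> Q \<Longrightarrow> d * v t q = (\<Sum>s\<in>T0. p t s * v s q)"
    and w: "\<And>s s'. s \<in> T0 \<Longrightarrow> s' \<in> T0 \<Longrightarrow> (\<Sum>q\<in>Q. w s q * v s' q) = (if s = s' then d else 0)"
    by simp_all
  have fin: "finite T0" using T0 insert(1) finite_subset by blast
  have t: "t \<notin> T0" using T0 insert by auto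
  \<comment> \<open>Over the fraction field \<open>a s / d\<close> would be the coordinates of the
    new vector; \<open>r\<close> is its residual, cleared of the denominator.\<close>
  define a where "a s = (\<Sum>q\<in>Q. w s q * v t q)" for s
  define r where "r q = d * v t q - (\<Sum>s\<in>T0. a s * v s q)" for q
  show ?case
  proof (cases "\<forall>q\<in>Q. r q = 0")
    case True
    show ?thesis
    proof (intro exI conjI ballI)
      show "T0 \<subseteq> insert t T" "d \<noteq> 0" using T0 by auto
      show "d * v t' q = (\<Sum>s\<in>T0. (if t' = t then a s else p t' s) * v s q)"
        if "t' \<in> insert t T" "q \<in> Q" for t' q
        using that p[of t' q] True insert.hyps(2) by (cases "t' = t") (auto simp: r_def)
      show "(\<Sum>q\<in>Q. w s q * v s' q) = (if s = s' then d else 0)" if "s \<in> T0" "s' \<in> T0" for s s'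
        using w that by blast
    qed
  next
    case False
    then obtain q0 where q0: "q0 \<in> Q" "r q0 \<noteq> 0" by auto
    \<comment> \<open>The functional "residual at the pivot \<open>q0\<close>": it kills every
      vector chosen so far and takes the value \<open>r q0\<close> on the new one.\<close>
    define x where "x q = (if q = q0 then d else 0) - (\<Sum>s\<in>T0. v s q0 * w s q)" for q
    have xv: "(\<Sum>q\<in>Q. x q * f q) = d * f q0 - (\<Sum>s\<in>T0. v s q0 * (\<Sum>q\<in>Q. w s q * f q))" for f
    proof -
      have "(\<Sum>q\<in>Q. x q * f q) = (\<Sum>q\<in>Q. (if q = q0 then d * f q else 0)) - (\<Sum>q\<in>Q. \<Sum>s\<in>T0. v s q0 * (w s q * f q))"
        unfolding x_def by (simp add: sum_subtractf[symmetric] left_diff_distrib sum_distrib_right mult.assoc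
            if_distrib[of "\<lambda>z. z * _"] cong: if_cong)
      also have "(\<Sum>q\<in>Q. \<Sum>s\<in>T0. v s q0 * (w s q * f q)) = (\<Sum>s\<in>T0. v s q0 * (\<Sum>q\<in>Q. w s q * f q))"
        by (subst sum.swap) (simp add: sum_distrib_left)
      finally show ?thesis using q0(1) assms(2) by simp
    qed
    have xs: "(\<Sum>q\<in>Q. x q * v s' q) = 0" if "s' \<in> T0" for s'
    proof -
      have "(\<Sum>s\<in>T0. v s q0 * (\<Sum>q\<in>Q. w s q * v s' q)) = (\<Sum>s\<in>T0. if s = s' then v s q0 * d else 0)"
        using w that by (intro sum.cong) auto
      then show ?thesis using xv that fin by simp
    qed
    have xt: "(\<Sum>q\<in>Q. x q * v t q) = r q0"
      unfolding xv r_def a_def[symmetric] by (simp add: mult.commute)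
    let ?\<rho> = "r q0"
    \<comment> \<open>Rescaling by the new pivot and subtracting a multiple of \<open>x\<close>
      restores duality, now up to the factor \<open>d * r q0\<close>.\<close>
    define w' where "w' s q = (if s = t then d * x q else ?\<rho> * w s q - a s * x q)" for s q
    show ?thesis
    proof (intro exI conjI ballI)
      show "insert t T0 \<subseteq> insert t T" "d * ?\<rho> \<noteq> 0" using T0 q0 by auto
      show "d * ?\<rho> * v t' q = (\<Sum>s\<in>insert t T0. (if t' = t then if s = t then d * ?\<rho> else 0
             else if s = t then 0 else ?\<rho> * p t' s) * v s q)"
        if "t' \<in> insert t T" "q \<in> Q" for t' q
      proof (cases "t' = t")
        case True
        have "(\<Sum>s\<in>T0. (if s = t then d * ?\<rho> else 0) * v s q) = 0"
          by (rule sum.neutral) (use t in auto)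
        then show ?thesis using True fin t by simp
      next
        case False
        have "d * ?\<rho> * v t' q = ?\<rho> * (\<Sum>s\<in>T0. p t' s * v s q)" using p[of t' q] that False by (simp add: mult_ac)
        also have "\<dots> = (\<Sum>s\<in>T0. (if s = t then 0 else ?\<rho> * p t' s) * v s q)"
          unfolding sum_distrib_left by (rule sum.cong) (use t in \<open>auto simp: mult_ac\<close>)
        finally show ?thesis using False fin t by simp
      qed
      show "(\<Sum>q\<in>Q. w' s q * v s' q) = (if s = s' then d * ?\<rho> else 0)"
        if "s \<in> insert t T0" "s' \<in> insert t T0" for s s'
      proof (cases "s = t")
        case True
        have "(\<Sum>q\<in>Q. w' s q * v s' q) = d * (\<Sum>q\<in>Q. x q * v s' q)"
          using True by (simp add: w'_def sum_distrib_left mult.assoc)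
        then show ?thesis using True xs[of s'] xt that t by (cases "s' = t") auto
      next
        case False
        have "(\<Sum>q\<in>Q. w' s q * v s' q) = ?\<rho> * (\<Sum>q\<in>Q. w s q * v s' q) - a s * (\<Sum>q\<in>Q. x q * v s' q)"
          using False by (simp add: w'_def left_diff_distrib sum_subtractf sum_distrib_left mult.assoc)
        then show ?thesis using False xs[of s'] xt that t w[of s s'] by (cases "s' = t") (auto simp: a_def)
      qed
    qed
  qed
qed

section \<open>Multilinear words and the collapse of their large letters\<close>

definition mlw :: "nat \<Rightarrow> nat list \<Rightarrow> bool" where
  "mlw m w \<longleftrightarrow> distinct w \<and> set w = {..<m}"

lemma mlw_length: "mlw m w \<Longrightarrow> length w = m"
  by (metis card_lessThan distinct_card mlw_def)

lemma mlw_mset: "mlw m w \<longleftrightarrow> mset w = mset_set {..<m}"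
  by (metis finite_lessThan finite_set_mset_mset_set mlw_def mset_eq_setD mset_set_set set_mset_mset
      mset_upt distinct_upt mset_eq_imp_distinct_iff atLeast0LessThan)

text \<open>The map \<open>min c\<close> identifies all letters from \<open>c\<close> on with
  \<open>c\<close>, which plays the part of the repeated letter y. The rearrangement that produces
  \<open>x\<close> from the collapsed standard word is applied to the standard word itself.\<close>

lemma lift_word:
  assumes "mset x = image_mset (min c) (mset_set {..<m})"
  shows "\<exists>w. mlw m w \<and> map (min c) w = x"
proof -
  have "mset x = mset (map (min c) [0..<m])" using assms by (simp add: atLeast0LessThan)
  then obtain p where p: "p permutes {..<length (map (min c) [0..<m])}" "permute_list p (map (min c) [0..<m]) = x"
    by (rule mset_eq_permutation)
  let ?w = "permute_list p [0..<m]"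
  have "mset ?w = mset [0..<m]" using p by simp
  then have "mlw m ?w" by (simp add: mlw_mset atLeast0LessThan)
  moreover have "map (min c) ?w = x" using p by (simp add: permute_list_map)
  ultimately show ?thesis by blast
qed

lemma image_min_mset:
  assumes "c \<le> m"
  shows "image_mset (min c) (mset_set {..<m}) = mset_set {..<c} + replicate_mset (m - c) (c::nat)"
proof -
  have "{..<m} = {..<c} \<union> {c..<m}" using assms by auto
  then have "mset_set {..<m} = mset_set {..<c} + mset_set {c..<m}"
    by (simp add: mset_set_Union ivl_disj_int)
  moreover have "image_mset (min c) (mset_set {..<c}) = mset_set {..<c}"
    by (rule trans[OF image_mset_cong[of _ _ "\<lambda>x. x"]]) auto
  moreover have "image_mset (min c) (mset_set {c..<m}) = replicate_mset (m - c) c"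
    by (rule trans[OF image_mset_cong[of _ _ "\<lambda>x. c"]]) (auto simp: image_mset_const_eq)
  ultimately show ?thesis by simp
qed

lemma filter_mset_neq_replicate: "filter_mset (\<lambda>x. x \<noteq> c) (replicate_mset s c) = {#}"
  by (induction s) auto

lemma filter_mset_neq_lessThan: "filter_mset (\<lambda>x. x \<noteq> c) (mset_set {..<c::nat}) = mset_set {..<c}"
  by (auto simp: filter_mset_eq_conv)

text \<open>At the patterns with surroundings in a finite set \<open>Q\<close> the values are
  polynomials in \<open>m\<close>, and by \<open>runp_determined\<close> they decide all linear
  relations. Elimination over the polynomial ring chooses \<open>T0\<close> once for all; it
  specializes to a basis at every large \<open>m\<close> that is not a root of
  \<open>d\<close>.\<close>

lemma stable_rank:
  fixes g :: "'t \<Rightarrow> nat list \<Rightarrow> 'a::field_char_0"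
  assumes T: "finite T" and g: "\<And>t. t \<in> T \<Longrightarrow> \<exists>D E. runp c D E (g t)"
    and V: "V = (\<lambda>m t w. if mlw m w then g t (map (min c) w) else 0)"
  shows "\<exists>T0 m0. T0 \<subseteq> T \<and> (\<forall>m\<ge>m0. findep T0 (V m) \<and> (\<forall>t\<in>T. V m t \<in> fspan (V m ` T0)))"
proof -
  obtain D' E' where DE: "\<And>t. t \<in> T \<Longrightarrow> runp c (D' t) (E' t) (g t)" using g by metis
  define D where "D = (\<Sum>t\<in>T. D' t)"
  define E where "E = (\<Sum>t\<in>T. E' t)"
  have run: "runp c D E (g t)" if "t \<in> T" for t
    using DE[OF that] by (rule runp_mono) (use that T in \<open>auto simp: D_def E_def intro: member_le_sum\<close>)
  define L where "L = E + 2 * D + 1"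
  define L0 where "L0 = 2 * (c + 1) * (L + 1)"
  \<comment> \<open>What surrounds the long run: each letter below \<open>c\<close> occurs exactly
    once in the two parts together, and all further letters are \<open>c\<close>. The bound
    \<open>L0\<close> is that of \<open>runp_determined\<close> with \<open>k = c\<close>.\<close>
  define Q where "Q = {(u, w). length u + length w \<le> L0 \<and> set u \<union> set w \<subseteq> {..c} \<and>
     filter_mset (\<lambda>x. x \<noteq> c) (mset (u @ w)) = mset_set {..<c}}"
  have "Q \<subseteq> {u. set u \<subseteq> {..c} \<and> length u \<le> L0} \<times> {u. set u \<subseteq> {..c} \<and> length u \<le> L0}"
    unfolding Q_def by auto
  then have Q: "finite Q" by (rule finite_subset) (intro finite_cartesian_product finite_lists_length_le, auto)
  have ex: "\<exists>p. \<forall>m\<ge>E + L0. g t (u @ replicate (m - (length u + length w)) c @ w) = poly p (of_nat m)"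
    if "t \<in> T" "(u, w) \<in> Q" for t u w
  proof -
    have "evpoly D E (\<lambda>s. g t (u @ replicate s c @ w))" using run[OF that(1)] by (simp add: runp_def)
    from evpoly_imp_poly[OF this] obtain p where p: "\<And>n. E \<le> n \<Longrightarrow> g t (u @ replicate n c @ w) = poly p (of_nat n)" by blast
    have "g t (u @ replicate (m - (length u + length w)) c @ w)
        = poly (p \<circ>\<^sub>p [:- of_nat (length u + length w), 1:]) (of_nat m)" if "m \<ge> E + L0" for m
      using p[of "m - (length u + length w)"] that \<open>(u, w) \<in> Q\<close>
      by (auto simp: Q_def poly_pcompose of_nat_diff algebra_simps)
    then show ?thesis by blast
  qed
  then have "\<forall>t q. \<exists>p. t \<in> T \<longrightarrow> q \<in> Q \<longrightarrow>
     (\<forall>m\<ge>E + L0. g t (fst q @ replicate (m - (length (fst q) + length (snd q))) c @ snd q) = poly p (of_nat m))"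
    by (metis prod.collapse)
  then obtain P where P: "\<And>t q m. t \<in> T \<Longrightarrow> q \<in> Q \<Longrightarrow> m \<ge> E + L0 \<Longrightarrow>
      g t (fst q @ replicate (m - (length (fst q) + length (snd q))) c @ snd q) = poly (P t q) (of_nat m)"
    by metis
  from fraction_free_basis[OF T Q, of P] obtain T0 d p w where ff: "T0 \<subseteq> T \<and> d \<noteq> 0 \<and>
     (\<forall>t\<in>T. \<forall>q\<in>Q. d * P t q = (\<Sum>s\<in>T0. p t s * P s q)) \<and>
     (\<forall>s\<in>T0. \<forall>s'\<in>T0. (\<Sum>q\<in>Q. w s q * P s' q) = (if s = s' then d else 0))"
    by (elim exE) (rule that)
  then have T0: "T0 \<subseteq> T" "d \<noteq> 0"
    and p: "\<And>t q. t \<in> T \<Longrightarrow> q \<in> Q \<Longrightarrow> d * P t q = (\<Sum>s\<in>T0. p t s * P s q)"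
    and w: "\<And>s s'. s \<in> T0 \<Longrightarrow> s' \<in> T0 \<Longrightarrow> (\<Sum>q\<in>Q. w s q * P s' q) = (if s = s' then d else 0)"
    by simp_all
  have fin: "finite T0" using T0 T finite_subset by blast
  have "finite {n::nat. poly d (of_nat n) = 0}"
  proof -
    have "finite ((of_nat :: nat \<Rightarrow> 'a) -` {x. poly d x = 0})"
      by (rule finite_vimageI) (use T0 poly_roots_finite in \<open>auto intro: inj_of_nat\<close>)
    then show ?thesis by (simp add: vimage_def)
  qed
  then obtain m1 where m1: "\<And>n. n \<ge> m1 \<Longrightarrow> poly d (of_nat n) \<noteq> 0"
    by (metis (mono_tags, lifting) finite_nat_set_iff_bounded linorder_not_le mem_Collect_eq)
  \<comment> \<open>Beyond the roots of \<open>d\<close>, and large enough for every test word to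
    fit and to keep a run of length at least \<open>E\<close>.\<close>
  define m0 where "m0 = m1 + E + L0 + c"
  have main: "findep T0 (V m) \<and> (\<forall>t\<in>T. V m t \<in> fspan (V m ` T0))" if m: "m \<ge> m0" for m
  proof -
    let ?d = "poly d (of_nat m)"
    have m': "m \<ge> E + L0" "m \<ge> c" "m \<ge> L0" "?d \<noteq> 0" using m m1 by (auto simp: m0_def)
    let ?X = "image_mset (min c) (mset_set {..<m})"
    have X: "?X = mset_set {..<c} + replicate_mset (m - c) c" using m'(2) by (rule image_min_mset)
    have Qw: "\<exists>x. mlw m x \<and> map (min c) x = fst q @ replicate (m - (length (fst q) + length (snd q))) c @ snd q"
      if "q \<in> Q" for q
    proof (rule lift_word)
      obtain u w where q: "q = (u, w)" by fastforce
      let ?M = "mset (fst q @ replicate (m - (length (fst q) + length (snd q))) c @ snd q)"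
      have s: "length u + length w \<le> m" "filter_mset (\<lambda>x. x \<noteq> c) (mset u) + filter_mset (\<lambda>x. x \<noteq> c) (mset w) = mset_set {..<c}"
        using that m' by (auto simp: Q_def q)
      have f: "filter_mset (\<lambda>x. x \<noteq> c) ?M = mset_set {..<c}"
        using s by (simp add: q filter_mset_neq_replicate)
      have "?M = filter_mset (\<lambda>x. x \<noteq> c) ?M + replicate_mset (count ?M c) c"
        by (intro multiset_eqI) (auto simp: count_filter_mset)
      then have M: "?M = mset_set {..<c} + replicate_mset (count ?M c) c" unfolding f .
      have "size ?M = m" using s by (simp add: q)
      moreover have "size ?M = c + count ?M c" by (subst M) simp
      ultimately have "count ?M c = m - c" by simp
      then show "?M = ?X" unfolding X using M by simp
    qed
    have VQ: "\<exists>x. \<forall>t\<in>T. V m t x = poly (P t q) (of_nat m)" if q: "q \<in> Q" for q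
    proof -
      from Qw[OF q] obtain x where "mlw m x" "map (min c) x = fst q @ replicate (m - (length (fst q) + length (snd q))) c @ snd q"
        by blast
      then show ?thesis using P[OF _ q m'(1)] unfolding V by (intro exI[of _ x]) simp
    qed
    have "findep T0 (V m)"
      unfolding findep_def
    proof (intro allI impI ballI)
      fix \<alpha> s assume z: "\<forall>x. (\<Sum>i\<in>T0. \<alpha> i * V m i x) = 0" and s: "s \<in> T0"
      have zq: "(\<Sum>i\<in>T0. \<alpha> i * poly (P i q) (of_nat m)) = 0" if q: "q \<in> Q" for q
      proof -
        obtain x where x: "\<forall>t\<in>T. V m t x = poly (P t q) (of_nat m)" using VQ[OF q] by blast
        have "(\<Sum>i\<in>T0. \<alpha> i * poly (P i q) (of_nat m)) = (\<Sum>i\<in>T0. \<alpha> i * V m i x)"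
          using x T0 by (intro sum.cong) auto
        then show ?thesis using z by simp
      qed
      have wq: "(\<Sum>q\<in>Q. poly (w s q) (of_nat m) * poly (P i q) (of_nat m)) = (if i = s then ?d else 0)"
        if "i \<in> T0" for i
        using arg_cong[OF w[OF s that], of "\<lambda>z. poly z (of_nat m)"] by (simp add: poly_sum split: if_splits)
      have "0 = (\<Sum>q\<in>Q. poly (w s q) (of_nat m) * (\<Sum>i\<in>T0. \<alpha> i * poly (P i q) (of_nat m)))"
        by (simp add: zq)
      also have "\<dots> = (\<Sum>i\<in>T0. \<alpha> i * (\<Sum>q\<in>Q. poly (w s q) (of_nat m) * poly (P i q) (of_nat m)))"
        unfolding sum_distrib_left by (subst sum.swap) (simp add: mult_ac)
      also have "\<dots> = (\<Sum>i\<in>T0. if i = s then \<alpha> i * ?d else 0)"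
        by (intro sum.cong) (auto simp: wq)
      also have "\<dots> = \<alpha> s * ?d" using s fin by simp
      finally show "\<alpha> s = 0" using m' by simp
    qed
    moreover have "V m t \<in> fspan (V m ` T0)" if t: "t \<in> T" for t
    proof -
      \<comment> \<open>The relation found over the polynomials, specialized at \<open>m\<close>. It
        vanishes at the test patterns, hence at every pattern of the right content.\<close>
      define f where "f x = ?d * g t x + (\<Sum>s\<in>T0. - poly (p t s) (of_nat m) * g s x)" for x
      have rf: "runp c D E f"
      proof -
        have a: "runp c D E (\<lambda>x. ?d * g t x)" by (intro runp_mult run t)
        have b: "runp c D E (\<lambda>x. \<Sum>s\<in>T0. - poly (p t s) (of_nat m) * g s x)"
          by (intro runp_sum runp_mult run) (use T0 in auto)
        show ?thesis using a b unfolding f_def runp_def by (auto intro: evpoly_add)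
      qed
      have f0: "f x = 0" if x: "mset x = ?X" for x
      proof (rule runp_determined[OF rf L_def L0_def])
        have sx: "size (mset x) = m" using x by simp
        have "length (filter (\<lambda>x. x \<noteq> c) x) = size (filter_mset (\<lambda>x. x \<noteq> c) (mset x))"
          by (metis mset_filter size_mset)
        also have "filter_mset (\<lambda>x. x \<noteq> c) (mset x) = mset_set {..<c}"
          unfolding x X by (auto simp: filter_mset_neq_replicate filter_mset_neq_lessThan)
        finally show "length (filter (\<lambda>x. x \<noteq> c) x) \<le> c" by simp
        have "(c + 1) * (L + 1) \<le> L0" unfolding L0_def by simp
        then show "(c + 1) * (L + 1) \<le> length x" using sx m' by simp
        fix u s w assume uw: "mset (u @ replicate s c @ w) = mset x" "length u + length w \<le> L0"
        have ff: "filter_mset (\<lambda>x. x \<noteq> c) (mset (u @ w)) = mset_set {..<c}"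
          using arg_cong[OF uw(1)[unfolded x X], of "filter_mset (\<lambda>x. x \<noteq> c)"]
          by (auto simp: filter_mset_neq_replicate filter_mset_neq_lessThan)
        have "set_mset (mset (u @ replicate s c @ w)) \<subseteq> {..c}" unfolding uw(1) x by auto
        then have q: "(u, w) \<in> Q" using uw(2) ff by (auto simp: Q_def)
        have "size (mset (u @ replicate s c @ w)) = m" unfolding uw(1) using sx .
        then have s: "s = m - (length u + length w)" by simp
        have gs: "g i (u @ replicate s c @ w) = poly (P i (u, w)) (of_nat m)" if "i \<in> T" for i
          using P[OF that q m'(1)] s by simp
        have "f (u @ replicate s c @ w) = ?d * poly (P t (u, w)) (of_nat m) +
            (\<Sum>s\<in>T0. - poly (p t s) (of_nat m) * poly (P s (u, w)) (of_nat m))"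
          unfolding f_def using T0 t by (auto simp: gs subset_eq)
        also have "\<dots> = poly (d * P t (u, w) - (\<Sum>s\<in>T0. p t s * P s (u, w))) (of_nat m)"
          by (simp add: poly_sum sum_negf)
        also have "\<dots> = 0" using p[OF t q] by simp
        finally show "f (u @ replicate s c @ w) = 0" .
      qed
      have "V m t = (\<lambda>x. \<Sum>s\<in>T0. (poly (p t s) (of_nat m) / ?d) * V m s x)"
      proof
        fix x
        show "V m t x = (\<Sum>s\<in>T0. (poly (p t s) (of_nat m) / ?d) * V m s x)"
        proof (cases "mlw m x")
          case True
          then have "mset (map (min c) x) = ?X" by (simp add: mlw_mset)
          from f0[OF this] have "?d * g t (map (min c) x) = (\<Sum>s\<in>T0. poly (p t s) (of_nat m) * g s (map (min c) x))"
            by (simp add: f_def sum_negf)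
          then have "g t (map (min c) x) = (\<Sum>s\<in>T0. poly (p t s) (of_nat m) * g s (map (min c) x)) / ?d"
            using m' by (simp add: field_simps)
          then show ?thesis using True by (simp add: V sum_divide_distrib)
        qed (simp add: V)
      qed
      then have "\<exists>\<alpha>. V m t = (\<lambda>x. \<Sum>s\<in>T0. \<alpha> s * V m s x)"
        by (rule exI[of _ "\<lambda>s. poly (p t s) (of_nat m) / ?d"])
      then show ?thesis using fspan_image_iff[OF fin, of "V m t" "V m"] by simp
    qed
    ultimately show ?thesis by blast
  qed
  show ?thesis using T0 main by blast
qed

section \<open>Multilinear generators of the T-ideal\<close>

lemma fmul_lcomb_left: "fmul (\<lambda>w. \<Sum>i\<in>I. c i * f i w) g = (\<lambda>w. \<Sum>i\<in>I. c i * fmul (f i) g w)"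
proof
  fix w
  have "fmul (\<lambda>w. \<Sum>i\<in>I. c i * f i w) g w = (\<Sum>k\<le>length w. \<Sum>i\<in>I. c i * (f i (take k w) * g (drop k w)))"
    by (simp add: fmul_def sum_distrib_right mult.assoc)
  also have "\<dots> = (\<Sum>i\<in>I. c i * fmul (f i) g w)"
    by (subst sum.swap) (simp add: fmul_def sum_distrib_left)
  finally show "fmul (\<lambda>w. \<Sum>i\<in>I. c i * f i w) g w = (\<Sum>i\<in>I. c i * fmul (f i) g w)" .
qed

lemma fmul_lcomb_right: "fmul g (\<lambda>w. \<Sum>i\<in>I. c i * f i w) = (\<lambda>w. \<Sum>i\<in>I. c i * fmul g (f i) w)"
proof
  fix w
  have "fmul g (\<lambda>w. \<Sum>i\<in>I. c i * f i w) w = (\<Sum>k\<le>length w. \<Sum>i\<in>I. c i * (g (take k w) * f i (drop k w)))"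
    by (simp add: fmul_def sum_distrib_left mult_ac)
  also have "\<dots> = (\<Sum>i\<in>I. c i * fmul g (f i) w)"
    by (subst sum.swap) (simp add: fmul_def sum_distrib_left)
  finally show "fmul g (\<lambda>w. \<Sum>i\<in>I. c i * f i w) w = (\<Sum>i\<in>I. c i * fmul g (f i) w)" .
qed

lemma fmul_sum_left: "fmul (\<lambda>w. \<Sum>i\<in>I. f i w) g = (\<lambda>w. \<Sum>i\<in>I. fmul (f i) g w)"
  using fmul_lcomb_left[of "\<lambda>_. 1" f I g] by simp
lemma fmul_sum_right: "fmul g (\<lambda>w. \<Sum>i\<in>I. f i w) = (\<lambda>w. \<Sum>i\<in>I. fmul g (f i) w)"
  using fmul_lcomb_right[of g "\<lambda>_. 1" f I] by simp
lemma fmul_add_left: "fmul (\<lambda>w. f w + f' w) g = (\<lambda>w. fmul f g w + fmul f' g w)"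
  by (simp add: fmul_def distrib_right sum.distrib)
lemma fmul_add_right: "fmul g (\<lambda>w. f w + f' w) = (\<lambda>w. fmul g f w + fmul g f' w)"
  by (simp add: fmul_def distrib_left sum.distrib)
lemma fmul_scale_left: "fmul (\<lambda>w. c * f w) g = (\<lambda>w. c * fmul f g w)"
  by (simp add: fmul_def sum_distrib_left mult.assoc)
lemma fmul_scale_right: "fmul g (\<lambda>w. c * f w) = (\<lambda>w. c * fmul g f w)"
  by (simp add: fmul_def sum_distrib_left mult_ac)
lemma fmul_zero_left: "fmul (\<lambda>w. 0) g = (\<lambda>w. 0)" by (simp add: fmul_def)
lemma fmul_zero_right: "fmul g (\<lambda>w. 0) = (\<lambda>w. 0)" by (simp add: fmul_def)

lemma fmul_mono_left:
  "fmul (wmono u) f w = (if take (length u) w = u then f (drop (length u) w) else 0)"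
proof (cases "length u \<le> length w")
  case True
  have "fmul (wmono u) f w = (\<Sum>k\<le>length w. if k = length u then wmono u (take k w) * f (drop k w) else 0)"
    unfolding fmul_def by (rule sum.cong) (use True in \<open>auto simp: wmono_def\<close>)
  then show ?thesis using True by (simp add: wmono_def)
next
  case False
  have "fmul (wmono u) f w = 0" unfolding fmul_def
    by (rule sum.neutral) (use False in \<open>auto simp: wmono_def\<close>)
  then show ?thesis using False by auto
qed

lemma fmul_one_left: "fmul (wmono []) f = f"
  by (simp add: fun_eq_iff fmul_mono_left)

lemma fmul_one_right: "fmul f (wmono []) = f"
proof
  fix w
  have "fmul f (wmono []) w = (\<Sum>k\<le>length w. if k = length w then f (take k w) else 0)"
    unfolding fmul_def by (rule sum.cong) (auto simp: wmono_def)
  then show "fmul f (wmono []) w = f w" by simp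
qed

lemma fmul_mono_mono: "fmul (wmono u) (wmono v) = wmono (u @ v)"
proof
  fix w
  have "w = u @ v \<longleftrightarrow> take (length u) w = u \<and> drop (length u) w = v"
    using append_eq_conv_conj[of u v w] by auto
  then show "fmul (wmono u) (wmono v) w = wmono (u @ v) w"
    unfolding fmul_mono_left by (simp add: wmono_def)
qed

lemma fmul_assoc: "fmul (fmul p q) r = fmul p (fmul q r)"
proof
  fix w
  have "fmul (fmul p q) r w = (\<Sum>k\<le>length w. \<Sum>j\<le>k. p (take j w) * q (take (k - j) (drop j w)) * r (drop k w))"
    unfolding fmul_def sum_distrib_right
    by (intro sum.cong) (auto simp: min_def drop_take)
  also have "\<dots> = (\<Sum>(k, j)\<in>Sigma {..length w} (\<lambda>k. {..k}). p (take j w) * q (take (k - j) (drop j w)) * r (drop k w))"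
    by (subst sum.Sigma) auto
  also have "\<dots> = (\<Sum>(j, i)\<in>Sigma {..length w} (\<lambda>j. {..length w - j}). p (take j w) * (q (take i (drop j w)) * r (drop i (drop j w))))"
    by (rule sum.reindex_bij_witness[of _ "\<lambda>(j, i). (j + i, j)" "\<lambda>(k, j). (j, k - j)"]) (auto simp: mult.assoc)
  also have "\<dots> = fmul p (fmul q r) w"
    unfolding fmul_def sum_distrib_left by (subst sum.Sigma) auto
  finally show "fmul (fmul p q) r w = fmul p (fmul q r) w" .
qed

text \<open>The unital algebra around \<open>FA\<close>: a coefficient at the empty word is allowed,
  so that absent outer factors can be treated as the monomial \<open>wmono []\<close>.\<close>

definition FS :: "(nat list \<Rightarrow> 'a::field) set" where
  "FS = {p. finite {w. p w \<noteq> 0}}"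

lemma subsp_FS: "subsp FS"
proof (rule subspI)
  show "(\<lambda>x. p x + q x) \<in> FS" if "p \<in> FS" "q \<in> FS" for p q :: "nat list \<Rightarrow> 'a"
    unfolding FS_def using that
    by (auto simp: FS_def intro!: finite_subset[of _ "{w. p w \<noteq> 0} \<union> {w. q w \<noteq> 0}"])
  show "(\<lambda>x. c * p x) \<in> FS" if "p \<in> FS" for c and p :: "nat list \<Rightarrow> 'a"
    unfolding FS_def using that
    by (auto simp: FS_def intro!: finite_subset[of _ "{w. p w \<noteq> 0}"])
qed (auto simp: FS_def)

lemma FA_FS: "FA = {p \<in> FS. p [] = 0}"
  by (auto simp: FA_def FS_def)

lemma subsp_FA: "subsp FA"
  using subsp_FS unfolding FA_FS by (auto simp: subsp_def)

lemma FS_expand: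
  assumes "finite S" "{w. p w \<noteq> 0} \<subseteq> S"
  shows "p = (\<lambda>w. \<Sum>u\<in>S. p u * wmono u w)"
proof
  fix w
  have "(\<Sum>u\<in>S. p u * wmono u w) = (\<Sum>u\<in>S. if u = w then p u else 0)"
    by (rule sum.cong) (auto simp: wmono_def)
  then show "p w = (\<Sum>u\<in>S. p u * wmono u w)" using assms by auto
qed

lemma mono_FS: "wmono u \<in> FS" by (simp add: FS_def wmono_def)

text \<open>Linear induction: a linear condition on finitely supported functions has to be checked
  on monomials only.\<close>

lemma FS_subset:
  assumes "subsp X" "\<And>u. wmono u \<in> X"
  shows "FS \<subseteq> X"
proof
  fix p :: "nat list \<Rightarrow> 'a" assume "p \<in> FS"
  then have "p = (\<lambda>w. \<Sum>u\<in>{w. p w \<noteq> 0}. p u * wmono u w)" by (intro FS_expand) (auto simp: FS_def)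
  then show "p \<in> X" using subsp_lcomb[OF assms(1), of "{w. p w \<noteq> 0}" wmono p] assms(2) by simp
qed

lemma FS_fmul: "p \<in> FS \<Longrightarrow> q \<in> FS \<Longrightarrow> fmul p q \<in> FS"
proof -
  assume p: "p \<in> FS" and q: "q \<in> FS"
  have "subsp {p. fmul p (wmono v) \<in> FS}" for v :: "nat list"
    using subsp_FS unfolding subsp_def by (auto simp: fmul_add_left fmul_scale_left fmul_zero_left)
  then have "FS \<subseteq> {p. fmul p (wmono v) \<in> FS}" for v
    by (rule FS_subset) (simp add: fmul_mono_mono mono_FS)
  then have a: "fmul p (wmono v) \<in> FS" for v using p by blast
  have "subsp {q. fmul p q \<in> FS}"
    using subsp_FS unfolding subsp_def by (auto simp: fmul_add_right fmul_scale_right fmul_zero_right)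
  then have "FS \<subseteq> {q. fmul p q \<in> FS}" by (rule FS_subset) (simp add: a)
  then show "fmul p q \<in> FS" using q by blast
qed

lemma fmul_Nil: "fmul p q [] = p [] * q []" by (simp add: fmul_def)

primrec fpow :: "(nat list \<Rightarrow> 'a::field) \<Rightarrow> nat \<Rightarrow> nat list \<Rightarrow> 'a" where
  "fpow q 0 = wmono []"
| "fpow q (Suc n) = fmul q (fpow q n)"

lemma fpow_add: "fpow q (a + b) = fmul (fpow q a) (fpow q b)"
  by (induction a) (simp_all add: fmul_one_left fmul_assoc)

lemma fpow_FS: "q \<in> FS \<Longrightarrow> fpow q n \<in> FS"
  by (induction n) (auto simp: mono_FS FS_fmul)

lemma fpow_FA: "q \<in> FA \<Longrightarrow> 0 < n \<Longrightarrow> fpow q n \<in> FA"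
  using fpow_FS[of q n] by (cases n) (auto simp: FA_FS fmul_Nil)

lemma xpow_mono: "xpow n = wmono (replicate n 0)"
  by (simp add: xpow_def wmono_def)

lemma fpow_mono: "fpow (wmono u) n = wmono (concat (replicate n u))"
  by (induction n) (simp_all add: fmul_mono_mono)

lemma fpow_expand:
  assumes "finite S" "q = (\<lambda>w. \<Sum>u\<in>S. c u * wmono u w)"
  shows "fpow q n = (\<lambda>w. \<Sum>ws\<in>{ws. set ws \<subseteq> S \<and> length ws = n}. prod_list (map c ws) * wmono (concat ws) w)"
proof (induction n)
  case 0
  have "{ws. set ws \<subseteq> S \<and> length ws = 0} = {[]}" by auto
  then show ?case by simp
next
  case (Suc n)
  let ?L = "\<lambda>n. {ws. set ws \<subseteq> S \<and> length ws = n}"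
  have L: "?L (Suc n) = (\<lambda>(u, ws). u # ws) ` (S \<times> ?L n)"
    by (auto simp: length_Suc_conv image_iff)
  show ?case
  proof
    fix w
    have "fpow q (Suc n) w = (\<Sum>u\<in>S. c u * (\<Sum>ws\<in>?L n. prod_list (map c ws) * wmono (u @ concat ws) w))"
      unfolding fpow.simps Suc by (simp add: assms(2) fmul_lcomb_left fmul_lcomb_right fmul_mono_mono)
    also have "\<dots> = (\<Sum>(u, ws)\<in>S \<times> ?L n. prod_list (map c (u # ws)) * wmono (concat (u # ws)) w)"
      by (simp add: sum_distrib_left sum.cartesian_product mult.assoc)
    also have "\<dots> = (\<Sum>ws\<in>?L (Suc n). prod_list (map c ws) * wmono (concat ws) w)"
      unfolding L by (subst sum.reindex) (auto simp: inj_on_def case_prod_unfold)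
    finally show "fpow q (Suc n) w = (\<Sum>ws\<in>?L (Suc n). prod_list (map c ws) * wmono (concat ws) w)" .
  qed
qed

text \<open>The endomorphism sending every variable to \<open>q\<close>. Applied to the generator
  x^n it yields the power of \<open>q\<close>.\<close>

definition subst_all :: "(nat list \<Rightarrow> 'a::field) \<Rightarrow> (nat list \<Rightarrow> 'a) \<Rightarrow> nat list \<Rightarrow> 'a" where
  "subst_all q p = (\<lambda>w. \<Sum>x\<in>{x. p x \<noteq> 0}. p x * fpow q (length x) w)"

lemma subst_all_superset:
  assumes "finite S" "{x. p x \<noteq> 0} \<subseteq> S"
  shows "subst_all q p w = (\<Sum>x\<in>S. p x * fpow q (length x) w)"
  unfolding subst_all_def by (rule sum.mono_neutral_left) (use assms in auto)

lemma subst_all_mono: "subst_all q (wmono u) = fpow q (length u)"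
  by (rule ext, subst subst_all_superset[of "{u}"]) (auto simp: wmono_def)

lemma subst_all_add:
  assumes "p \<in> FS" "r \<in> FS"
  shows "subst_all q (\<lambda>w. p w + r w) = (\<lambda>w. subst_all q p w + subst_all q r w)"
proof
  fix w
  let ?S = "{x. p x \<noteq> 0} \<union> {x. r x \<noteq> 0}"
  have fin: "finite ?S" using assms by (auto simp: FS_def)
  have "subst_all q (\<lambda>w. p w + r w) w = (\<Sum>x\<in>?S. (p x + r x) * fpow q (length x) w)"
    by (rule subst_all_superset[OF fin]) auto
  moreover have "subst_all q p w = (\<Sum>x\<in>?S. p x * fpow q (length x) w)" "subst_all q r w = (\<Sum>x\<in>?S. r x * fpow q (length x) w)"
    by (rule subst_all_superset[OF fin]; auto)+
  ultimately show "subst_all q (\<lambda>w. p w + r w) w = subst_all q p w + subst_all q r w"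
    by (simp add: sum.distrib distrib_right)
qed

lemma subst_all_scale:
  assumes "p \<in> FS"
  shows "subst_all q (\<lambda>w. c * p w) = (\<lambda>w. c * subst_all q p w)"
proof
  fix w
  have "subst_all q (\<lambda>w. c * p w) w = (\<Sum>x\<in>{x. p x \<noteq> 0}. (c * p x) * fpow q (length x) w)"
    by (rule subst_all_superset) (use assms in \<open>auto simp: FS_def\<close>)
  then show "subst_all q (\<lambda>w. c * p w) w = c * subst_all q p w"
    by (simp add: subst_all_def sum_distrib_left mult.assoc)
qed

lemma subst_all_zero: "subst_all q (\<lambda>w. 0) = (\<lambda>w. 0)" by (simp add: subst_all_def)

lemma subst_all_fmul:
  assumes "p \<in> FS" "r \<in> FS"
  shows "subst_all q (fmul p r) = fmul (subst_all q p) (subst_all q r)"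
proof -
  let ?X = "\<lambda>r. {p \<in> FS. subst_all q (fmul p r) = fmul (subst_all q p) (subst_all q r)}"
  let ?Y = "\<lambda>p. {r \<in> FS. subst_all q (fmul p r) = fmul (subst_all q p) (subst_all q r)}"
  have X: "subsp (?X r)" if "r \<in> FS" for r
    using subsp_FS that unfolding subsp_def
    by (auto simp: fmul_add_left fmul_scale_left fmul_zero_left subst_all_add subst_all_scale subst_all_zero FS_fmul)
  have "FS \<subseteq> ?X (wmono v)" for v
    by (rule FS_subset[OF X[OF mono_FS]]) (simp add: mono_FS fmul_mono_mono subst_all_mono fpow_add)
  then have p: "subst_all q (fmul p (wmono v)) = fmul (subst_all q p) (subst_all q (wmono v))" for v
    using assms(1) by blast
  have Y: "subsp (?Y p)"
    using subsp_FS assms(1) unfolding subsp_def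
    by (auto simp: fmul_add_right fmul_scale_right fmul_zero_right subst_all_add subst_all_scale subst_all_zero FS_fmul)
  have "FS \<subseteq> ?Y p" by (rule FS_subset[OF Y]) (simp add: mono_FS p)
  then show ?thesis using assms(2) by blast
qed

lemma is_endo_subst_all:
  assumes "q \<in> FA"
  shows "is_endo (subst_all q)"
proof -
  have "subst_all q p \<in> FA" if "p \<in> FA" for p
    unfolding subst_all_def
    by (rule subsp_lcomb[OF subsp_FA], rule fpow_FA[OF assms]) (use that in \<open>auto simp: FA_def\<close>)
  then show ?thesis unfolding is_endo_def
    by (auto simp: FA_FS subst_all_add subst_all_scale subst_all_fmul)
qed

section \<open>Symmetrized products of words lie in the T-ideal\<close>

text \<open>The factors form a set: in a multilinear product nonempty words have disjoint letters
  and are therefore distinct, so no multiplicities occur.\<close>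

definition gen :: "nat list \<Rightarrow> nat list set \<Rightarrow> nat list \<Rightarrow> nat list \<Rightarrow> 'a::field" where
  "gen u A v = (\<lambda>w. \<Sum>ws\<in>permutations_of_set A. wmono (u @ concat ws @ v) w)"

definition gidx :: "nat \<Rightarrow> nat \<Rightarrow> (nat list \<times> nat list set \<times> nat list) set" where
  "gidx n m = {(u, A, v). finite A \<and> card A = n \<and> [] \<notin> A \<and>
     (\<forall>ws\<in>permutations_of_set A. mlw m (u @ concat ws @ v))}"

definition gens :: "nat \<Rightarrow> nat \<Rightarrow> (nat list \<Rightarrow> 'a::field) set" where
  "gens n m = {gen u A v | u A v. (u, A, v) \<in> gidx n m}"

lemma fmul_xpow_Tideal:
  assumes I: "is_Tideal I" "xpow n \<in> I" and q: "q \<in> FA"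
  shows "fpow q n \<in> I"
proof -
  have "subst_all q (xpow n) \<in> I" using I is_endo_subst_all[OF q] unfolding is_Tideal_def by blast
  then show ?thesis by (simp add: xpow_mono subst_all_mono)
qed

text \<open>Inclusion-exclusion: the power attached to \<open>B\<close> sums over all lists of
  \<open>n\<close> words from \<open>B\<close>; the signs keep only the lists using every element of
  \<open>A\<close>, and since \<open>card A = n\<close> these are the orderings of
  \<open>A\<close>.\<close>

lemma polarization:
  assumes A: "finite A" "card A = n"
  shows "(\<lambda>w. \<Sum>ws\<in>permutations_of_set A. wmono (concat ws) w) =
    (\<lambda>w. \<Sum>B\<in>Pow A. (-1) ^ card (A - B) * fpow (\<lambda>w. \<Sum>u\<in>B. wmono u w) n w :: 'a::field)"
proof
  fix w
  let ?L = "\<lambda>B. {ws. set ws \<subseteq> B \<and> length ws = n}"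
  have finL: "finite (?L B)" if "B \<subseteq> A" for B
    by (rule finite_lists_length_eq[OF finite_subset[OF that A(1)]])
  have e: "fpow (\<lambda>w. \<Sum>u\<in>B. wmono u w :: 'a) n w = (\<Sum>ws\<in>?L A. if set ws \<subseteq> B then wmono (concat ws) w else 0)"
    if "B \<subseteq> A" for B
  proof -
    have "fpow (\<lambda>w. \<Sum>u\<in>B. wmono u w :: 'a) n w = (\<Sum>ws\<in>?L B. prod_list (map (\<lambda>_. 1) ws) * wmono (concat ws) w)"
      by (subst fpow_expand[of B _ "\<lambda>_. 1"]) (use A that finite_subset in auto)
    also have "\<dots> = (\<Sum>ws\<in>?L B. wmono (concat ws) w)" by (simp add: map_replicate_const)
    also have "\<dots> = (\<Sum>ws\<in>?L A. if set ws \<subseteq> B then wmono (concat ws) w else 0)"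
      by (rule sum.mono_neutral_cong_left) (use finL[of A] that in auto)
    finally show ?thesis .
  qed
  \<comment> \<open>Expand the product over \<open>A\<close> of 1 + (0 or -1), with 0 on
    \<open>X\<close>: in the term of \<open>B\<close> the complement of \<open>B\<close> must avoid
    \<open>X\<close>, and the product itself is zero unless \<open>X = A\<close>.\<close>
  have alt: "(\<Sum>B\<in>Pow A. if X \<subseteq> B then (-1) ^ card (A - B) else 0 :: 'a) = (if X = A then 1 else 0)"
    if XA: "X \<subseteq> A" for X
  proof -
    have "(\<Prod>a\<in>A. 1 + (if a \<in> X then 0 else - 1 :: 'a)) = (\<Sum>B\<in>Pow A. (\<Prod>a\<in>B. 1) * (\<Prod>a\<in>A - B. if a \<in> X then 0 else -1))"
      by (rule prod_add[OF A(1)])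
    also have "\<dots> = (\<Sum>B\<in>Pow A. if X \<subseteq> B then (-1) ^ card (A - B) else 0 :: 'a)"
    proof (rule sum.cong[OF refl])
      fix B assume B: "B \<in> Pow A"
      show "(\<Prod>a\<in>B. 1) * (\<Prod>a\<in>A - B. if a \<in> X then 0 else -1) = (if X \<subseteq> B then (-1) ^ card (A - B) else 0 :: 'a)"
      proof (cases "X \<subseteq> B")
        case True
        then have "(\<Prod>a\<in>A - B. if a \<in> X then 0 else -1) = (\<Prod>a\<in>A - B. -1 :: 'a)"
          by (intro prod.cong) auto
        then show ?thesis using True by simp
      next
        case False
        then obtain x where "x \<in> A - B" "x \<in> X" using XA by blast
        then have "(\<Prod>a\<in>A - B. if a \<in> X then 0 else -1 :: 'a) = 0"
          using A by (intro prod_zero) auto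
        then show ?thesis using False by simp
      qed
    qed
    finally have "(\<Sum>B\<in>Pow A. if X \<subseteq> B then (-1) ^ card (A - B) else 0 :: 'a) = (\<Prod>a\<in>A. 1 + (if a \<in> X then 0 else - 1))"
      by simp
    also have "\<dots> = (if X = A then 1 else 0)"
    proof (cases "X = A")
      case False
      then obtain x where "x \<in> A" "x \<notin> X" using XA by auto
      then show ?thesis using False A by (auto intro!: prod_zero bexI[of _ x])
    qed auto
    finally show ?thesis .
  qed
  have "(\<Sum>B\<in>Pow A. (-1) ^ card (A - B) * fpow (\<lambda>w. \<Sum>u\<in>B. wmono u w) n w :: 'a) =
     (\<Sum>B\<in>Pow A. \<Sum>ws\<in>?L A. wmono (concat ws) w * (if set ws \<subseteq> B then (-1) ^ card (A - B) else 0))"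
    by (rule sum.cong[OF refl], subst e) (auto simp: sum_distrib_left intro!: sum.cong)
  also have "\<dots> = (\<Sum>ws\<in>?L A. wmono (concat ws) w * (\<Sum>B\<in>Pow A. if set ws \<subseteq> B then (-1) ^ card (A - B) else 0))"
    by (subst sum.swap) (simp add: sum_distrib_left)
  also have "\<dots> = (\<Sum>ws\<in>?L A. if set ws = A then wmono (concat ws) w else 0)"
    by (rule sum.cong[OF refl]) (auto simp: alt)
  also have "\<dots> = (\<Sum>ws\<in>permutations_of_set A. wmono (concat ws) w)"
  proof -
    have "permutations_of_set A = {ws \<in> ?L A. set ws = A}"
    proof (intro set_eqI iffI)
      fix ws assume "ws \<in> permutations_of_set A"
      then show "ws \<in> {ws \<in> ?L A. set ws = A}" using A distinct_card[of ws] by (auto simp: permutations_of_set_def)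
    next
      fix ws assume "ws \<in> {ws \<in> ?L A. set ws = A}"
      then show "ws \<in> permutations_of_set A" using A card_distinct[of ws] by (auto simp: permutations_of_set_def)
    qed
    then show ?thesis using sum.inter_filter[OF finL[OF order.refl], of "\<lambda>ws. wmono (concat ws) w :: 'a" "\<lambda>ws. set ws = A"] by simp
  qed
  finally show "(\<Sum>ws\<in>permutations_of_set A. wmono (concat ws) w) =
     (\<Sum>B\<in>Pow A. (-1) ^ card (A - B) * fpow (\<lambda>w. \<Sum>u\<in>B. wmono u w) n w :: 'a)" by simp
qed

lemma gen_fmul: "gen u A v = fmul (wmono u) (fmul (\<lambda>w. \<Sum>ws\<in>permutations_of_set A. wmono (concat ws) w) (wmono v))"
  by (simp add: gen_def fmul_sum_left fmul_sum_right fmul_mono_mono)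

text \<open>Polarization writes the symmetrized product through n-th powers, which lie in
  \<open>I\<close> by substitution. The outer words are multiplied in only when nonempty, because
  the unit is not in \<open>FA\<close>.\<close>

lemma gen_in_Tideal:
  assumes I: "is_Tideal I" "xpow n \<in> I" and A: "finite A" "card A = n" "[] \<notin> A"
  shows "gen u A v \<in> I"
proof -
  have sub: "subsp I" using I by (auto simp: is_Tideal_def subsp_def)
  have mul: "fmul p q \<in> I" "fmul q p \<in> I" if "p \<in> I" "q \<in> FA" for p q using I that by (auto simp: is_Tideal_def)
  have "(\<lambda>w. \<Sum>u\<in>B. wmono u w) \<in> FA" if "B \<subseteq> A" for B
    by (rule subsp_sum[OF subsp_FA]) (use A that mono_FS in \<open>auto simp: FA_FS, auto simp: wmono_def\<close>)
  then have "(\<lambda>w. \<Sum>B\<in>Pow A. (-1) ^ card (A - B) * fpow (\<lambda>w. \<Sum>u\<in>B. wmono u w) n w) \<in> I"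
    by (intro subsp_lcomb[OF sub] fmul_xpow_Tideal[OF I]) auto
  then have S: "(\<lambda>w. \<Sum>ws\<in>permutations_of_set A. wmono (concat ws) w) \<in> I"
    unfolding polarization[OF A(1,2)] .
  have m: "wmono x \<in> FA" if "x \<noteq> []" for x using mono_FS that by (auto simp: FA_FS wmono_def)
  have "fmul (\<lambda>w. \<Sum>ws\<in>permutations_of_set A. wmono (concat ws) w) (wmono v) \<in> I"
    using mul(1)[OF S m] S by (cases "v = []") (auto simp: fmul_one_right)
  then show ?thesis unfolding gen_fmul using mul(2)[OF _ m] by (cases "u = []") (auto simp: fmul_one_left)
qed

lemma gens_subset_Wnm:
  assumes "0 < n"
  shows "gens n m \<subseteq> Wnm n m"
proof
  fix p :: "nat list \<Rightarrow> 'a" assume "p \<in> gens n m"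
  then obtain u A v where p: "p = gen u A v" "finite A" "card A = n" "[] \<notin> A"
    "\<forall>ws\<in>permutations_of_set A. mlw m (u @ concat ws @ v)"
    by (auto simp: gens_def gidx_def)
  have nz: "\<exists>ws\<in>permutations_of_set A. w = u @ concat ws @ v" if "p w \<noteq> 0" for w
  proof (rule ccontr)
    assume "\<not> ?thesis"
    then have "p w = 0" unfolding p gen_def by (intro sum.neutral) (auto simp: wmono_def)
    then show False using that by simp
  qed
  have "p \<in> FS" unfolding p gen_def by (rule subsp_sum[OF subsp_FS]) (rule mono_FS)
  moreover have "p [] = 0"
  proof (rule ccontr)
    assume "p [] \<noteq> 0"
    from nz[OF this] obtain ws where ws: "ws \<in> permutations_of_set A" "concat ws = []" by fastforce
    then show False using p assms by (cases ws) (auto simp: permutations_of_set_def)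
  qed
  ultimately have "p \<in> FA" by (simp add: FA_FS)
  then have "p \<in> Vm m" using nz p unfolding Vm_def mlw_def by blast
  moreover have "p \<in> Tgen (xpow n)" unfolding Tgen_def p(1) using gen_in_Tideal p by blast
  ultimately show "p \<in> Wnm n m" by (simp add: Wnm_def)
qed

section \<open>The T-ideal of a power and its multilinear part\<close>

lemma mono_Nil_notin_FA: "wmono [] \<notin> FA"
  by (simp add: FA_def wmono_def)

text \<open>Two-sided multiples of all n-th powers; the adjoined unit stands for a missing outer
  factor. Their span is already stable under endomorphisms, since these take n-th powers to n-th
  powers.\<close>

definition Jgens :: "nat \<Rightarrow> (nat list \<Rightarrow> 'a::field) set" where
  "Jgens n = {fmul p (fmul (fpow q n) r) | p q r. p \<in> insert (wmono []) FA \<and> q \<in> FA \<and> r \<in> insert (wmono []) FA}"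

lemma FA_fmul_left: "p \<in> FA \<Longrightarrow> q \<in> insert (wmono []) FA \<Longrightarrow> fmul p q \<in> FA"
  by (auto simp: FA_FS FS_fmul mono_FS fmul_Nil)
lemma FA_fmul_right: "p \<in> FA \<Longrightarrow> q \<in> insert (wmono []) FA \<Longrightarrow> fmul q p \<in> FA"
  by (auto simp: FA_FS FS_fmul mono_FS fmul_Nil)

lemma is_Tideal_Jgens:
  assumes n: "0 < n"
  shows "is_Tideal (fspan (Jgens n))"
proof -
  let ?J = "fspan (Jgens n) :: (nat list \<Rightarrow> 'a) set"
  have J: "subsp ?J" by (rule subsp_fspan)
  have "Jgens n \<subseteq> (FA :: (nat list \<Rightarrow> 'a) set)"
    unfolding Jgens_def using fpow_FA[OF _ n] FA_fmul_left FA_fmul_right by blast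
  then have FA: "?J \<subseteq> FA" by (rule fspan_minimal[OF subsp_FA])
  have R: "fmul x y \<in> ?J" if "x \<in> ?J" "y \<in> FA" for x y
  proof -
    have "subsp {x. fmul x y \<in> ?J}" using J unfolding subsp_def
      by (auto simp: fmul_add_left fmul_scale_left fmul_zero_left)
    moreover have "Jgens n \<subseteq> {x. fmul x y \<in> ?J}"
    proof
      fix x :: "nat list \<Rightarrow> 'a" assume "x \<in> Jgens n"
      then obtain p q r where x: "x = fmul p (fmul (fpow q n) r)" "p \<in> insert (wmono []) FA" "q \<in> FA" "r \<in> insert (wmono []) FA"
        unfolding Jgens_def by blast
      have "fmul x y = fmul p (fmul (fpow q n) (fmul r y))" by (simp add: x fmul_assoc)
      then have "fmul x y \<in> Jgens n" unfolding Jgens_def using x FA_fmul_right[OF that(2)] by blast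
      then show "x \<in> {x. fmul x y \<in> ?J}" by (auto intro: fspan_base)
    qed
    ultimately show ?thesis using fspan_minimal that(1) by blast
  qed
  have L: "fmul y x \<in> ?J" if "x \<in> ?J" "y \<in> FA" for x y
  proof -
    have "subsp {x. fmul y x \<in> ?J}" using J unfolding subsp_def
      by (auto simp: fmul_add_right fmul_scale_right fmul_zero_right)
    moreover have "Jgens n \<subseteq> {x. fmul y x \<in> ?J}"
    proof
      fix x :: "nat list \<Rightarrow> 'a" assume "x \<in> Jgens n"
      then obtain p q r where x: "x = fmul p (fmul (fpow q n) r)" "p \<in> insert (wmono []) FA" "q \<in> FA" "r \<in> insert (wmono []) FA"
        unfolding Jgens_def by blast
      have "fmul y x = fmul (fmul y p) (fmul (fpow q n) r)" by (simp add: x fmul_assoc)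
      then have "fmul y x \<in> Jgens n" unfolding Jgens_def using x FA_fmul_left[OF that(2)] by blast
      then show "x \<in> {x. fmul y x \<in> ?J}" by (auto intro: fspan_base)
    qed
    ultimately show ?thesis using fspan_minimal that(1) by blast
  qed
  have E: "\<phi> x \<in> ?J" if \<phi>: "is_endo \<phi>" and x: "x \<in> ?J" for \<phi> x
  proof -
    have ad: "\<phi> (\<lambda>w. p w + q w) = (\<lambda>w. \<phi> p w + \<phi> q w)" "\<phi> (\<lambda>w. c * p w) = (\<lambda>w. c * \<phi> p w)"
      "\<phi> (fmul p q) = fmul (\<phi> p) (\<phi> q)" "\<phi> p \<in> FA" if "p \<in> FA" "q \<in> FA" for p q c
      using \<phi> that by (auto simp: is_endo_def)
    have z: "\<phi> (\<lambda>w. 0) = (\<lambda>w. 0)" using ad(2)[of "\<lambda>w. 0" "\<lambda>w. 0" 0] subsp_FA by (auto simp: subsp_def)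
    have pw: "\<phi> (fpow q (Suc k)) = fpow (\<phi> q) (Suc k)" if q: "q \<in> FA" for q k
    proof (induction k)
      case 0 show ?case by (simp add: fmul_one_right)
    next
      case (Suc k)
      have "\<phi> (fmul q (fpow q (Suc k))) = fmul (\<phi> q) (\<phi> (fpow q (Suc k)))"
        by (rule ad(3)[OF q fpow_FA[OF q]]) simp
      then show ?case using Suc by simp
    qed
    have "subsp {x \<in> FA. \<phi> x \<in> ?J}" using J subsp_FA unfolding subsp_def
      by (auto simp: ad z)
    moreover have "Jgens n \<subseteq> {x \<in> FA. \<phi> x \<in> ?J}"
    proof
      fix x :: "nat list \<Rightarrow> 'a" assume xJ: "x \<in> Jgens n"
      then obtain p q r where x: "x = fmul p (fmul (fpow q n) r)" "p \<in> insert (wmono []) FA" "q \<in> FA" "r \<in> insert (wmono []) FA"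
        unfolding Jgens_def by blast
      \<comment> \<open>The axioms of \<open>is_endo\<close> speak of arguments in \<open>FA\<close>
        only, so a missing outer factor is kept as the unit by hand.\<close>
      define p' where "p' = (if p \<in> FA then \<phi> p else wmono [])"
      define r' where "r' = (if r \<in> FA then \<phi> r else wmono [])"
      have Q: "fpow q n \<in> FA" by (rule fpow_FA[OF x(3) n])
      have 1: "\<phi> (fmul (fpow q n) r) = fmul (fpow (\<phi> q) n) r'"
      proof -
        have "\<phi> (fpow q n) = fpow (\<phi> q) n" using pw[OF x(3), of "n - 1"] n by simp
        then show ?thesis using x(4) ad(3)[OF Q, of r] mono_Nil_notin_FA
          by (auto simp: r'_def fmul_one_right)
      qed
      have "\<phi> x = fmul p' (fmul (fpow (\<phi> q) n) r')"
        using x(2) ad(3)[of p "fmul (fpow q n) r"] FA_fmul_left[OF Q x(4)] mono_Nil_notin_FA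
        unfolding x(1) 1[symmetric] by (auto simp: p'_def fmul_one_left)
      moreover have "p' \<in> insert (wmono []) FA" "r' \<in> insert (wmono []) FA" "\<phi> q \<in> FA"
        using ad(4)[OF _ x(3)] x(3) by (auto simp: p'_def r'_def)
      ultimately have "\<phi> x \<in> Jgens n" unfolding Jgens_def by blast
      then show "x \<in> {x \<in> FA. \<phi> x \<in> ?J}" using FA xJ fspan_base by blast
    qed
    ultimately show ?thesis using fspan_minimal x by blast
  qed
  show ?thesis unfolding is_Tideal_def
    using FA J R L E by (auto simp: subsp_def)
qed

lemma Tgen_subset_Jgens:
  assumes "0 < n"
  shows "Tgen (xpow n) \<subseteq> fspan (Jgens n)"
proof -
  have m: "wmono [0] \<in> FA" by (simp add: FA_FS mono_FS) (simp add: wmono_def)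
  have "concat (replicate n [0]) = replicate n (0::nat)" by (induction n) auto
  then have "xpow n = fmul (wmono []) (fmul (fpow (wmono [0]) n) (wmono []))"
    by (simp add: fmul_one_left fmul_one_right fpow_mono xpow_mono)
  then have "xpow n \<in> Jgens n" unfolding Jgens_def using m by blast
  then show ?thesis unfolding Tgen_def using is_Tideal_Jgens[OF assms] fspan_base by blast
qed

lemma mset_concat_perm:
  assumes "ws \<in> permutations_of_set A" "ws' \<in> permutations_of_set A"
  shows "mset (concat ws) = mset (concat ws')"
proof -
  have "mset ws = mset ws'" using assms
    by (metis permutations_of_setD set_eq_iff_mset_eq_distinct)
  then have "mset (map mset ws) = mset (map mset ws')" by simp
  then show ?thesis unfolding mset_concat by (metis sum_mset_sum_list)
qed

text \<open>A linear projection that is the identity on \<open>Vm m\<close>; hence only the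
  multilinear parts of the spanning elements \<open>Jgens\<close> have to be known.\<close>

definition mlproj :: "nat \<Rightarrow> (nat list \<Rightarrow> 'a::zero) \<Rightarrow> nat list \<Rightarrow> 'a" where
  "mlproj m f = (\<lambda>w. if mlw m w then f w else 0)"

lemma mlproj_add: "mlproj m (\<lambda>w. f w + g w :: 'a::field) = (\<lambda>w. mlproj m f w + mlproj m g w)"
  by (auto simp: mlproj_def)
lemma mlproj_scale: "mlproj m (\<lambda>w. c * f w :: 'a::field) = (\<lambda>w. c * mlproj m f w)"
  by (auto simp: mlproj_def)
lemma mlproj_zero: "mlproj m (\<lambda>w. 0) = (\<lambda>w. 0)"
  by (auto simp: mlproj_def)

text \<open>All words of \<open>gen u A v\<close> have the same letters with the same
  multiplicities, so either all of them are multilinear or none is.\<close>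

lemma mlproj_gen:
  assumes "finite A" "card A = n" "[] \<notin> A"
  shows "mlproj m (gen u A v) \<in> fspan (gens n m)"
proof (cases "(u, A, v) \<in> gidx n m")
  case True
  have "mlproj m (gen u A v) = (gen u A v :: _ \<Rightarrow> 'a)"
  proof
    fix w
    have "gen u A v w = (0 :: 'a)" if "\<not> mlw m w"
      using True that unfolding gen_def gidx_def by (intro sum.neutral) (auto simp: wmono_def)
    then show "mlproj m (gen u A v) w = (gen u A v w :: 'a)" by (simp add: mlproj_def)
  qed
  moreover have "(gen u A v :: _ \<Rightarrow> 'a) \<in> gens n m" using True by (auto simp: gens_def)
  ultimately show ?thesis by (simp add: fspan_base)
next
  case False
  then obtain ws where ws: "ws \<in> permutations_of_set A" "\<not> mlw m (u @ concat ws @ v)"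
    using assms by (auto simp: gidx_def)
  have nm: "\<not> mlw m (u @ concat ws' @ v)" if "ws' \<in> permutations_of_set A" for ws'
    using ws(2) mset_concat_perm[OF ws(1) that] by (simp add: mlw_mset)
  have "mlproj m (gen u A v) w = (0 :: 'a)" for w
    unfolding mlproj_def gen_def using nm by (auto simp: wmono_def intro!: sum.neutral)
  then have "mlproj m (gen u A v) = (\<lambda>w. 0 :: 'a)" by auto
  then show ?thesis using subsp_fspan[of "gens n m :: (nat list \<Rightarrow> 'a) set"] by (simp add: subsp_def)
qed

lemma concat_distinct_imp:
  assumes "distinct (concat ws)" "[] \<notin> set ws"
  shows "distinct ws"
  using assms
proof (induction ws)
  case (Cons a ws)
  then obtain x where "x \<in> set a" by (cases a) auto
  then show ?case using Cons by auto
qed simp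

text \<open>In the expansion of the power, a list with a repeated word contributes nothing
  multilinear. The other lists are grouped by their set \<open>A\<close> of entries, on which the
  coefficient, the product of \<open>q\<close> over \<open>A\<close>, does not depend on the
  order.\<close>

lemma mlproj_fpow:
  assumes "q \<in> FA"
  shows "mlproj m (fmul (wmono u) (fmul (fpow q n) (wmono v))) \<in> fspan (gens n m)"
proof -
  let ?S = "{w. q w \<noteq> 0}"
  have fS: "finite ?S" "[] \<notin> ?S" using assms by (auto simp: FA_def)
  let ?L = "{ws. set ws \<subseteq> ?S \<and> length ws = n}"
  let ?L' = "{ws \<in> ?L. distinct ws}"
  let ?T = "{A. A \<subseteq> ?S \<and> card A = n}"
  have finL: "finite ?L" using finite_lists_length_eq[OF fS(1)] by simp
  have finT: "finite ?T" using fS by (auto intro: finite_subset[of _ "Pow ?S"])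
  have fp: "fpow q n = (\<lambda>w. \<Sum>ws\<in>?L. prod_list (map q ws) * wmono (concat ws) w)"
    by (rule fpow_expand[OF fS(1)]) (rule FS_expand[OF fS(1)], simp)
  have e: "fmul (wmono u) (fmul (fpow q n) (wmono v)) w = (\<Sum>ws\<in>?L. prod_list (map q ws) * wmono (u @ concat ws @ v) w)" for w
    unfolding fp by (simp add: fmul_lcomb_left fmul_lcomb_right fmul_mono_mono)
  have "mlproj m (fmul (wmono u) (fmul (fpow q n) (wmono v))) = (\<lambda>w. \<Sum>A\<in>?T. (\<Prod>x\<in>A. q x) * mlproj m (gen u A v) w)"
  proof
    fix w
    show "mlproj m (fmul (wmono u) (fmul (fpow q n) (wmono v))) w = (\<Sum>A\<in>?T. (\<Prod>x\<in>A. q x) * mlproj m (gen u A v) w)"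
    proof (cases "mlw m w")
      case True
      have "(\<Sum>ws\<in>?L. prod_list (map q ws) * wmono (u @ concat ws @ v) w) = (\<Sum>ws\<in>?L'. prod_list (map q ws) * wmono (u @ concat ws @ v) w)"
      proof (rule sum.mono_neutral_right)
        show "\<forall>ws\<in>?L - ?L'. prod_list (map q ws) * wmono (u @ concat ws @ v) w = 0"
        proof
          fix ws assume ws: "ws \<in> ?L - ?L'"
          then have "[] \<notin> set ws" "\<not> distinct ws" using fS(2) by auto
          then have "\<not> distinct (concat ws)" using concat_distinct_imp[of ws] by blast
          moreover have "distinct w" using True by (simp add: mlw_def)
          ultimately have "w \<noteq> u @ concat ws @ v" by (metis distinct_append)
          then show "prod_list (map q ws) * wmono (u @ concat ws @ v) w = 0" by (simp add: wmono_def)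
        qed
      qed (use finL in auto)
      also have "\<dots> = (\<Sum>A\<in>?T. \<Sum>ws\<in>{ws \<in> ?L'. set ws = A}. prod_list (map q ws) * wmono (u @ concat ws @ v) w)"
      proof (rule sum.group[symmetric])
        show "finite ?L'" by (rule finite_subset[OF _ finL]) blast
        show "set ` ?L' \<subseteq> ?T" using distinct_card by blast
      qed (rule finT)
      also have "\<dots> = (\<Sum>A\<in>?T. (\<Prod>x\<in>A. q x) * gen u A v w)"
      proof (rule sum.cong[OF refl])
        fix A assume A: "A \<in> ?T"
        have "{ws \<in> ?L'. set ws = A} = permutations_of_set A"
          using A by (auto simp: permutations_of_set_def distinct_card)
        then show "(\<Sum>ws\<in>{ws \<in> ?L'. set ws = A}. prod_list (map q ws) * wmono (u @ concat ws @ v) w) = (\<Prod>x\<in>A. q x) * gen u A v w"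
          unfolding gen_def sum_distrib_left
          by (intro sum.cong) (auto simp: permutations_of_set_def prod.distinct_set_conv_list)
      qed
      finally show ?thesis using True by (simp add: mlproj_def e)
    qed (simp add: mlproj_def)
  qed
  also have "\<dots> \<in> fspan (gens n m)"
    by (rule subsp_lcomb[OF subsp_fspan], rule mlproj_gen) (use fS in \<open>auto intro: finite_subset\<close>)
  finally show ?thesis .
qed

lemma mlproj_Jgens: "Jgens n \<subseteq> {x. mlproj m x \<in> fspan (gens n m)}"
proof
  let ?S = "fspan (gens n m) :: (nat list \<Rightarrow> 'a) set"
  fix x :: "nat list \<Rightarrow> 'a" assume "x \<in> Jgens n"
  then obtain p q r where x: "x = fmul p (fmul (fpow q n) r)" "p \<in> FS" "q \<in> FA" "r \<in> FS"
    unfolding Jgens_def by (auto simp: FA_FS mono_FS)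
  note pj = mlproj_add mlproj_scale mlproj_zero
  have "subsp {r. mlproj m (fmul (wmono u) (fmul (fpow q n) r)) \<in> ?S}" for u
    using subsp_fspan[of "gens n m"] unfolding subsp_def
    by (auto simp: pj fmul_add_right fmul_scale_right fmul_zero_right)
  then have "FS \<subseteq> {r. mlproj m (fmul (wmono u) (fmul (fpow q n) r)) \<in> ?S}" for u
    by (rule FS_subset) (simp add: mlproj_fpow x)
  then have a: "mlproj m (fmul (wmono u) (fmul (fpow q n) r)) \<in> ?S" for u using x by blast
  have "subsp {p. mlproj m (fmul p (fmul (fpow q n) r)) \<in> ?S}"
    using subsp_fspan[of "gens n m"] unfolding subsp_def
    by (auto simp: pj fmul_add_left fmul_scale_left fmul_zero_left)
  then have "FS \<subseteq> {p. mlproj m (fmul p (fmul (fpow q n) r)) \<in> ?S}"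
    by (rule FS_subset) (simp add: a)
  then show "x \<in> {x. mlproj m x \<in> ?S}" using x by blast
qed

lemma subsp_Int: "subsp X \<Longrightarrow> subsp Y \<Longrightarrow> subsp (X \<inter> Y)"
  by (auto simp: subsp_def)

lemma Wnm_eq_fspan:
  assumes n: "0 < n"
  shows "Wnm n m = (fspan (gens n m) :: (nat list \<Rightarrow> 'a::field) set)"
proof
  let ?S = "fspan (gens n m) :: (nat list \<Rightarrow> 'a) set"
  have "subsp {x :: nat list \<Rightarrow> 'a. mlproj m x \<in> ?S}"
    using subsp_fspan[of "gens n m :: (nat list \<Rightarrow> 'a) set"] unfolding subsp_def
    by (auto simp: mlproj_add mlproj_scale mlproj_zero)
  then have *: "fspan (Jgens n) \<subseteq> {x :: nat list \<Rightarrow> 'a. mlproj m x \<in> ?S}"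
    using mlproj_Jgens by (rule fspan_minimal)
  show "Wnm n m \<subseteq> ?S"
  proof
    fix p :: "nat list \<Rightarrow> 'a" assume p: "p \<in> Wnm n m"
    then have "mlproj m p \<in> ?S" using * Tgen_subset_Jgens[OF n] by (auto simp: Wnm_def)
    moreover have "mlproj m p = p" using p by (auto simp: Wnm_def Vm_def mlproj_def mlw_def fun_eq_iff)
    ultimately show "p \<in> ?S" by simp
  qed
  have "subsp (Vm m :: (nat list \<Rightarrow> 'a) set)"
  proof (rule subspI)
    fix p q :: "nat list \<Rightarrow> 'a" assume pq: "p \<in> Vm m" "q \<in> Vm m"
    then have "(\<lambda>x. p x + q x) \<in> FA" using subsp_FA[where 'a = 'a] by (simp add: Vm_def subsp_def)
    moreover have "p w \<noteq> 0 \<or> q w \<noteq> 0" if "p w + q w \<noteq> 0" for w using that by auto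
    ultimately show "(\<lambda>x. p x + q x) \<in> Vm m" using pq unfolding Vm_def by blast
  next
    fix c and p :: "nat list \<Rightarrow> 'a" assume p: "p \<in> Vm m"
    then have "(\<lambda>x. c * p x) \<in> FA" using subsp_FA[where 'a = 'a] by (simp add: Vm_def subsp_def)
    then show "(\<lambda>x. c * p x) \<in> Vm m" using p by (simp add: Vm_def)
  qed (use subsp_FA[where 'a = 'a] in \<open>simp add: Vm_def subsp_def\<close>)
  moreover have "subsp (Tgen (xpow n) :: (nat list \<Rightarrow> 'a) set)"
    unfolding Tgen_def by (rule subspI) (auto simp: is_Tideal_def)
  ultimately have "subsp (Wnm n m :: (nat list \<Rightarrow> 'a) set)" unfolding Wnm_def by (rule subsp_Int)
  then show "?S \<subseteq> Wnm n m" by (rule fspan_minimal[OF _ gens_subset_Wnm[OF n]])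
qed

section \<open>Stability of dimensions of symmetrized parts\<close>

text \<open>An element of the group algebra, written as a finite combination. The action is a
  parameter, so that the same element can be transported along an equivariant map from words to
  tabloid functions or direct sums.\<close>

definition gact :: "'i set \<Rightarrow> ('i \<Rightarrow> 'a::field) \<Rightarrow> ('i \<Rightarrow> nat \<Rightarrow> nat) \<Rightarrow>
    ((nat \<Rightarrow> nat) \<Rightarrow> ('x \<Rightarrow> 'a) \<Rightarrow> 'x \<Rightarrow> 'a) \<Rightarrow> ('x \<Rightarrow> 'a) \<Rightarrow> 'x \<Rightarrow> 'a" where
  "gact I c \<tau> act f = (\<lambda>x. \<Sum>i\<in>I. c i * act (\<tau> i) f x)"

definition psym :: "nat set \<Rightarrow> ((nat \<Rightarrow> nat) \<Rightarrow> ('x \<Rightarrow> 'a::field) \<Rightarrow> 'x \<Rightarrow> 'a) \<Rightarrow> ('x \<Rightarrow> 'a) \<Rightarrow> 'x \<Rightarrow> 'a" where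
  "psym B act = gact {\<pi>. \<pi> permutes B} (\<lambda>_. 1) (\<lambda>\<pi>. \<pi>) act"

definition hasdim :: "('x \<Rightarrow> 'a::field) set \<Rightarrow> nat \<Rightarrow> bool" where
  "hasdim X r \<longleftrightarrow> (\<exists>v. (\<forall>i<r. v i \<in> X) \<and> findep {..<r} v \<and> X \<subseteq> fspan (v ` {..<r}))"

section \<open>Symmetrized generators depend on patterns only\<close>

lemma exists_perm_of_mlw:
  assumes w: "mlw m w" and x: "mlw m x"
  shows "\<exists>\<pi>. \<pi> permutes {..<m} \<and> map \<pi> x = w"
proof -
  define \<pi> where "\<pi> k = (if k < m then the (map_of (zip x w) k) else k)" for k
  have len: "length x = length w" using mlw_length[OF w] mlw_length[OF x] by simp
  have nth: "\<pi> (x ! i) = w ! i" if "i < length x" for i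
  proof -
    have "x ! i < m" using that x nth_mem[OF that] unfolding mlw_def by auto
    moreover have "map_of (zip x w) (x ! i) = Some (w ! i)"
      by (rule map_of_zip_nth) (use that len x in \<open>auto simp: mlw_def\<close>)
    ultimately show ?thesis by (simp add: \<pi>_def)
  qed
  have mp: "map \<pi> x = w" by (rule nth_equalityI) (use len nth in auto)
  have im: "\<pi> ` {..<m} = {..<m}" using arg_cong[OF mp, of set] w x by (simp add: mlw_def)
  then have "bij_betw \<pi> {..<m} {..<m}" unfolding bij_betw_def
    by (simp add: eq_card_imp_inj_on)
  then have "\<pi> permutes {..<m}" by (rule bij_imp_permutes) (simp add: \<pi>_def)
  then show ?thesis using mp by blast
qed

lemma permutes_mlw: "\<pi> permutes {..<m} \<Longrightarrow> mlw m (map \<pi> w) \<longleftrightarrow> mlw m w"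
proof -
  have *: "mlw m (map \<pi> w)" if "\<pi> permutes {..<m}" "mlw m w" for \<pi> w
    using that permutes_inj_on[OF that(1), of "set w"] permutes_image[OF that(1)]
    by (auto simp: mlw_def distinct_map)
  assume p: "\<pi> permutes {..<m}"
  have "map (inv \<pi>) (map \<pi> w) = w" using permutes_inverses[OF p] by (simp add: comp_def)
  then show ?thesis using *[OF p] *[OF permutes_inv[OF p], of "map \<pi> w"] by auto
qed

text \<open>Exactly one permutation carries one multilinear word to another, and it fixes all
  letters below \<open>b\<close> precisely when the two words have the same collapse. So at most one
  summand is nonzero.\<close>

lemma sum_perm_wmono:
  assumes x: "mlw m x" and b: "b \<le> m"
  shows "(\<Sum>\<pi>\<in>{\<pi>. \<pi> permutes {b..<m}}. wmono x (map (inv \<pi>) w)) =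
     (if mlw m w \<and> map (min b) w = map (min b) x then 1 else 0 :: 'a::field)"
proof (cases "mlw m w \<and> map (min b) w = map (min b) x")
  case True
  then obtain \<rho> where \<rho>: "\<rho> permutes {..<m}" "map \<rho> x = w" using exists_perm_of_mlw x by blast
  have fixed: "\<rho> k = k" if "k < b" for k
  proof -
    have "k \<in> set x" using x that b by (auto simp: mlw_def)
    moreover have "map (\<lambda>k. min b (\<rho> k)) x = map (min b) x" using True \<rho> by (auto simp: comp_def)
    ultimately have "min b (\<rho> k) = min b k" by (auto simp: map_eq_conv)
    then show ?thesis using that by auto
  qed
  have \<rho>B: "\<rho> permutes {b..<m}" by (rule permutes_superset[OF \<rho>(1)]) (auto intro: fixed)
  have eq: "wmono x (map (inv \<pi>) w) = (if \<pi> = \<rho> then 1 else 0 :: 'a)" if "\<pi> permutes {b..<m}" for \<pi>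
  proof (cases "map (inv \<pi>) w = x")
    case t: True
    have "map \<pi> x = w" unfolding t[symmetric] using permutes_inverses[OF that] by (simp add: comp_def)
    then have "map \<pi> x = map \<rho> x" using \<rho> by simp
    then have "\<pi> k = \<rho> k" if "k < m" for k using that x by (auto simp: mlw_def map_eq_conv)
    moreover have "\<pi> k = \<rho> k" if "\<not> k < m" for k
      using that permutes_not_in[OF \<open>\<pi> permutes {b..<m}\<close>, of k] permutes_not_in[OF \<rho>B, of k] by simp
    ultimately have "\<pi> = \<rho>" by blast
    then show ?thesis using t by (simp add: wmono_def)
  next
    case False
    then have "\<pi> \<noteq> \<rho>" using \<rho> permutes_inverses[OF that] by (auto simp: comp_def)
    then show ?thesis using False by (simp add: wmono_def)
  qed
  have "(\<Sum>\<pi>\<in>{\<pi>. \<pi> permutes {b..<m}}. wmono x (map (inv \<pi>) w)) = (\<Sum>\<pi>\<in>{\<pi>. \<pi> permutes {b..<m}}. if \<pi> = \<rho> then 1 else 0 :: 'a)"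
    by (rule sum.cong) (auto simp: eq)
  also have "\<dots> = 1" using \<rho>B finite_permutations[of "{b..<m}"] by simp
  finally show ?thesis using True by simp
next
  case False
  have "wmono x (map (inv \<pi>) w) = (0 :: 'a)" if p: "\<pi> permutes {b..<m}" for \<pi>
  proof -
    have "map (inv \<pi>) w \<noteq> x"
    proof
      assume t: "map (inv \<pi>) w = x"
      have p': "\<pi> permutes {..<m}" using p by (rule permutes_subset) auto
      have w: "map \<pi> x = w" unfolding t[symmetric] using permutes_inverses[OF p] by (simp add: comp_def)
      have "min b (\<pi> k) = min b k" for k
        using permutes_in_image[OF p, of k] permutes_not_in[OF p, of k] by (cases "k \<in> {b..<m}") auto
      then have "map (min b) w = map (min b) x" unfolding w[symmetric] by (simp add: comp_def)
      moreover have "mlw m w" using permutes_mlw[OF p'] x w by blast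
      ultimately show False using False by blast
    qed
    then show ?thesis by (simp add: wmono_def)
  qed
  then show ?thesis using False by (simp add: sum.neutral)
qed

abbreviation bar :: "nat \<Rightarrow> nat list \<Rightarrow> nat list" where "bar b \<equiv> map (min b)"

text \<open>The orderings are those of the index set \<open>A\<close>, because distinct words may
  become equal under the collapse \<open>u\<close>.\<close>

definition Phi :: "'i set \<Rightarrow> ('i \<Rightarrow> nat list) \<Rightarrow> nat list \<Rightarrow> 'a::field" where
  "Phi A u = (\<lambda>w. \<Sum>ws\<in>permutations_of_set A. wmono (concat (map u ws)) w)"

lemma psym_gen:
  assumes g: "(u, A, v) \<in> gidx n m" and b: "b \<le> m"
  shows "psym {b..<m} wact (gen u A v) w = (if mlw m w then
     fmul (wmono (bar b u)) (fmul (Phi A (bar b)) (wmono (bar b v))) (bar b w) else 0 :: 'a::field)"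
proof -
  let ?P = "{\<pi>. \<pi> permutes {b..<m}}"
  have "psym {b..<m} wact (gen u A v) w = (\<Sum>\<pi>\<in>?P. \<Sum>ws\<in>permutations_of_set A. wmono (u @ concat ws @ v) (map (inv \<pi>) w) :: 'a)"
    by (simp add: psym_def gact_def wact_def gen_def)
  also have "\<dots> = (\<Sum>ws\<in>permutations_of_set A. \<Sum>\<pi>\<in>?P. wmono (u @ concat ws @ v) (map (inv \<pi>) w))"
    by (rule sum.swap)
  also have "\<dots> = (\<Sum>ws\<in>permutations_of_set A. if mlw m w then wmono (bar b (u @ concat ws @ v)) (bar b w) else 0)"
  proof (rule sum.cong[OF refl])
    fix ws assume "ws \<in> permutations_of_set A"
    then have "mlw m (u @ concat ws @ v)" using g by (simp add: gidx_def)
    from sum_perm_wmono[OF this b, of w]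
    show "(\<Sum>\<pi>\<in>?P. wmono (u @ concat ws @ v) (map (inv \<pi>) w)) = (if mlw m w then wmono (bar b (u @ concat ws @ v)) (bar b w) else 0 :: 'a)"
      by (auto simp: wmono_def)
  qed
  also have "\<dots> = (if mlw m w then fmul (wmono (bar b u)) (fmul (Phi A (bar b)) (wmono (bar b v))) (bar b w) else 0)"
    by (simp add: Phi_def fmul_sum_left fmul_sum_right fmul_mono_mono map_concat)
  finally show ?thesis .
qed

section \<open>Geometric series in the repeated letter\<close>

text \<open>The series 1 + y + y^2 + ... as a coefficient function; its support is infinite.\<close>

definition allY :: "nat \<Rightarrow> nat list \<Rightarrow> 'a::field" where
  "allY y = (\<lambda>w. if set w \<subseteq> {y} then 1 else 0)"

text \<open>Any power of \<open>y\<close> may stand before, between and after the given words. At a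
  word of known length the number of letters supplied by the series is forced, which is how n
  disappears from the formula.\<close>

primrec chain :: "nat \<Rightarrow> nat list list \<Rightarrow> nat list \<Rightarrow> 'a::field" where
  "chain y [] = allY y"
| "chain y (v # vs) = fmul (allY y) (fmul (wmono v) (chain y vs))"

definition Qf :: "nat \<Rightarrow> 'i set \<Rightarrow> ('i \<Rightarrow> nat list) \<Rightarrow> nat list \<Rightarrow> 'a::field" where
  "Qf y A u = (\<lambda>w. \<Sum>ws\<in>permutations_of_set A. chain y (map u ws) w)"

lemma allY_rec: "allY y = (\<lambda>w. wmono [] w + fmul (wmono [y]) (allY y) w)"
proof
  fix w show "allY y w = wmono [] w + fmul (wmono [y]) (allY y) w"
    unfolding fmul_mono_left by (cases w) (auto simp: allY_def wmono_def)
qed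

text \<open>The first series contributes either nothing or a first letter \<open>y\<close> that can
  be split off.\<close>

lemma chain_rec: "chain y (v # vs) = (\<lambda>w. fmul (wmono v) (chain y vs) w + fmul (wmono [y]) (chain y (v # vs)) w)"
proof -
  have "chain y (v # vs) = fmul (\<lambda>w. wmono [] w + fmul (wmono [y]) (allY y) w) (fmul (wmono v) (chain y vs))"
    unfolding chain.simps by (rule arg_cong[OF allY_rec])
  then show ?thesis by (simp add: fmul_add_left fmul_one_left fmul_assoc)
qed

lemma sum_permutations_of_set:
  assumes "finite A" "A \<noteq> {}"
  shows "(\<Sum>ws\<in>permutations_of_set A. f ws) = (\<Sum>i\<in>A. \<Sum>ws\<in>permutations_of_set (A - {i}). f (i # ws))"
proof -
  have "(\<Sum>ws\<in>permutations_of_set A. f ws) = (\<Sum>ws\<in>(\<Union>i\<in>A. (#) i ` permutations_of_set (A - {i})). f ws)"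
    by (subst permutations_of_set_nonempty[OF assms(2)]) simp
  also have "\<dots> = (\<Sum>i\<in>A. \<Sum>ws\<in>(#) i ` permutations_of_set (A - {i}). f ws)"
    by (rule sum.UNION_disjoint) (use assms in auto)
  also have "\<dots> = (\<Sum>i\<in>A. \<Sum>ws\<in>permutations_of_set (A - {i}). f (i # ws))"
    by (simp add: sum.reindex)
  finally show ?thesis .
qed

lemma Qf_empty: "Qf y {} u = allY y"
  by (simp add: Qf_def)

lemma Qf_rec:
  assumes "finite A" "A \<noteq> {}"
  shows "Qf y A u w = (\<Sum>i\<in>A. fmul (wmono (u i)) (Qf y (A - {i}) u) w) + fmul (wmono [y]) (Qf y A u) w"
proof -
  have "Qf y A u w = (\<Sum>i\<in>A. \<Sum>ws\<in>permutations_of_set (A - {i}). chain y (u i # map u ws) w)"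
    unfolding Qf_def by (subst sum_permutations_of_set[OF assms]) simp
  also have "\<dots> = (\<Sum>i\<in>A. \<Sum>ws\<in>permutations_of_set (A - {i}). fmul (wmono (u i)) (chain y (map u ws)) w)
     + (\<Sum>i\<in>A. \<Sum>ws\<in>permutations_of_set (A - {i}). fmul (wmono [y]) (chain y (u i # map u ws)) w)"
    by (subst chain_rec) (simp add: sum.distrib)
  also have "(\<Sum>i\<in>A. \<Sum>ws\<in>permutations_of_set (A - {i}). fmul (wmono (u i)) (chain y (map u ws)) w)
     = (\<Sum>i\<in>A. fmul (wmono (u i)) (Qf y (A - {i}) u) w)"
    by (simp add: Qf_def fmul_sum_right)
  also have "(\<Sum>i\<in>A. \<Sum>ws\<in>permutations_of_set (A - {i}). fmul (wmono [y]) (chain y (u i # map u ws)) w)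
     = fmul (wmono [y]) (Qf y A u) w"
    unfolding Qf_def fmul_sum_right by (subst sum_permutations_of_set[OF assms]) simp
  finally show ?thesis .
qed

lemma Phi_rec:
  assumes "finite A" "A \<noteq> {}"
  shows "Phi A u w = (\<Sum>i\<in>A. fmul (wmono (u i)) (Phi (A - {i}) u) w)"
  unfolding Phi_def fmul_sum_right
  by (subst sum_permutations_of_set[OF assms]) (simp add: fmul_mono_mono)

lemma chain_short: "length w < length (concat vs) \<Longrightarrow> chain y vs w = 0"
proof (induction vs arbitrary: w)
  case (Cons v vs)
  have "fmul (wmono v) (chain y vs) (drop k w) = (0 :: 'a)" for k
  proof (cases "take (length v) (drop k w) = v")
    case True
    then have "length v \<le> length (drop k w)" by (metis length_take min.cobounded1 min.commute)
    then have "chain y vs (drop (length v) (drop k w)) = (0 :: 'a)" using Cons.prems by (intro Cons.IH) auto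
    then show ?thesis by (simp add: fmul_mono_left)
  qed (simp add: fmul_mono_left)
  then show ?case by (simp add: fmul_def[of "allY y"])
qed simp

lemma length_concat_perm:
  assumes "ws \<in> permutations_of_set A"
  shows "length (concat (map u ws)) = (\<Sum>i\<in>A. length (u i))"
proof -
  have "length (concat (map u ws)) = sum_list (map (\<lambda>i. length (u i)) ws)" by (simp add: length_concat comp_def)
  also have "\<dots> = (\<Sum>i\<in>A. length (u i))"
    using assms by (auto simp: permutations_of_set_def sum.distinct_set_conv_list)
  finally show ?thesis .
qed

lemma Qf_short: "length w < (\<Sum>i\<in>A. length (u i)) \<Longrightarrow> Qf y A u w = 0"
  unfolding Qf_def by (intro sum.neutral ballI chain_short) (simp add: length_concat_perm)

text \<open>The k words equal to \<open>[y]\<close> are interchangeable: an ordering of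
  \<open>A\<close> is an ordering of the other words, a distribution of the y over the gaps, and one
  of k! labellings. The length hypothesis makes the series supply exactly k letters. The induction
  compares first factors through \<open>Phi_rec\<close> and \<open>Qf_rec\<close>.\<close>

lemma Phi_eq_Qf:
  assumes "finite A" "length w = (\<Sum>i\<in>A. length (u i))"
  shows "Phi A u w = fact (card {i\<in>A. u i = [y]}) * (Qf y {i\<in>A. u i \<noteq> [y]} u w :: 'a::field_char_0)"
  using assms
proof (induction "card A" arbitrary: A w rule: less_induct)
  case less
  show ?case
  proof (cases "A = {}")
    case True
    then show ?thesis using less.prems by (simp add: Phi_def Qf_def allY_def wmono_def)
  next
    case False
    let ?Y = "\<lambda>A. {i\<in>A. u i = [y]}" and ?N = "\<lambda>A. {i\<in>A. u i \<noteq> [y]}"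
    have fin: "finite (?Y A)" "finite (?N A)" using less.prems by auto
    have ih: "fmul (wmono (u i)) (Phi (A - {i}) u) w = (fmul (wmono (u i)) (\<lambda>w. fact (card (?Y (A - {i}))) * Qf y (?N (A - {i})) u w) w :: 'a)"
      if i: "i \<in> A" for i
    proof -
      have c: "card (A - {i}) < card A" using less.prems(1) i by (rule card_Diff1_less)
      have l: "length (drop (length (u i)) w) = (\<Sum>j\<in>A - {i}. length (u j))"
        using less.prems i sum.remove[of A i "\<lambda>i. length (u i)"] by simp
      show ?thesis using less.hyps[OF c _ l] less.prems(1) by (simp add: fmul_mono_left)
    qed
    have y: "fmul (wmono (u i)) (Phi (A - {i}) u) w = (fact (card (?Y A) - 1) * fmul (wmono [y]) (Qf y (?N A) u) w :: 'a)"
      if "i \<in> ?Y A" for i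
    proof -
      have "?Y (A - {i}) = ?Y A - {i}" "?N (A - {i}) = ?N A" using that by auto
      then show ?thesis using ih[of i] that fin by (simp add: fmul_scale_right)
    qed
    have n: "fmul (wmono (u i)) (Phi (A - {i}) u) w = (fact (card (?Y A)) * fmul (wmono (u i)) (Qf y (?N A - {i}) u) w :: 'a)"
      if "i \<in> ?N A" for i
    proof -
      have "?Y (A - {i}) = ?Y A" "?N (A - {i}) = ?N A - {i}" using that by auto
      then show ?thesis using ih[of i] that fin by (simp add: fmul_scale_right)
    qed
    have A: "A = ?Y A \<union> ?N A" by auto
    have "(Phi A u w :: 'a) = (\<Sum>i\<in>?Y A. fmul (wmono (u i)) (Phi (A - {i}) u) w) + (\<Sum>i\<in>?N A. fmul (wmono (u i)) (Phi (A - {i}) u) w)"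
      unfolding Phi_rec[OF less.prems(1) False]
      by (subst (1) A, rule sum.union_disjoint) (use fin in auto)
    also have "(\<Sum>i\<in>?Y A. fmul (wmono (u i)) (Phi (A - {i}) u) w :: 'a) = of_nat (card (?Y A)) * (fact (card (?Y A) - 1) * fmul (wmono [y]) (Qf y (?N A) u) w)"
    proof -
      have "(\<Sum>i\<in>?Y A. fmul (wmono (u i)) (Phi (A - {i}) u) w) = (\<Sum>i\<in>?Y A. fact (card (?Y A) - 1) * fmul (wmono [y]) (Qf y (?N A) u) w :: 'a)"
        by (rule sum.cong[OF refl], rule y)
      then show ?thesis by simp
    qed
    also have "\<dots> = fact (card (?Y A)) * fmul (wmono [y]) (Qf y (?N A) u) w"
    \<comment> \<open>Here the truncated \<open>card - 1\<close> would be wrong, but the term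
      vanishes: after removing one letter the word is too short for the words still to be
      placed.\<close>
    proof (cases "card (?Y A) = 0")
      case True
      then have "?Y A = {}" using fin by simp
      then have "?N A = A" by auto
      then have "fmul (wmono [y]) (Qf y (?N A) u) w = (0 :: 'a)"
        using less.prems(2) by (cases w) (auto simp: fmul_mono_left Qf_short)
      then show ?thesis by simp
    next
      case False
      then have "(fact (card (?Y A)) :: 'a) = of_nat (card (?Y A)) * fact (card (?Y A) - 1)" by (simp add: fact_reduce)
      then show ?thesis by (simp add: mult.assoc)
    qed
    also have "(\<Sum>i\<in>?N A. fmul (wmono (u i)) (Phi (A - {i}) u) w :: 'a) = fact (card (?Y A)) * (\<Sum>i\<in>?N A. fmul (wmono (u i)) (Qf y (?N A - {i}) u) w)"
      unfolding sum_distrib_left by (rule sum.cong[OF refl], rule n)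
    finally have e: "(Phi A u w :: 'a) = fact (card (?Y A)) * ((\<Sum>i\<in>?N A. fmul (wmono (u i)) (Qf y (?N A - {i}) u) w) + fmul (wmono [y]) (Qf y (?N A) u) w)"
      by (simp add: distrib_left add.commute)
    show ?thesis
    proof (cases "?N A = {}")
      case True
      then have "(\<Sum>i\<in>A. length (u i)) = (\<Sum>i\<in>A. 1)" by (intro sum.cong) auto
      then have "w \<noteq> []" using less.prems False by auto
      then have "allY y w = (fmul (wmono [y]) (allY y) w :: 'a)" by (subst allY_rec) (simp add: wmono_def)
      then show ?thesis using e unfolding True by (simp add: Qf_empty)
    next
      case False
      show ?thesis unfolding e by (simp only: Qf_rec[OF fin(2) False, symmetric])
    qed
  qed
qed

text \<open>Indexing by positions in a list leaves only the collapsed words in the data and removes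
  the set \<open>A\<close>, whose elements depend on n.\<close>

lemma Qf_reindex:
  assumes "distinct as"
  shows "Qf y (set as) u = Qf y {..<length as} ((!) (map u as))"
proof -
  have inj: "inj_on ((!) as) {..<length as}" using assms by (auto simp: inj_on_def nth_eq_iff_index_eq)
  have s: "set as = (!) as ` {..<length as}" by (auto simp: set_conv_nth)
  have ij: "inj_on (map ((!) as)) (permutations_of_set {..<length as})"
    by (rule inj_onI) (metis inj inj_on_map_eq_map permutations_of_setD(1) Un_absorb)
  have "Qf y (set as) u w = Qf y {..<length as} ((!) (map u as)) w" for w
  proof -
    have "Qf y (set as) u w = (\<Sum>ws\<in>map ((!) as) ` permutations_of_set {..<length as}. chain y (map u ws) w)"
      unfolding Qf_def by (subst s, subst permutations_of_set_image_inj[OF inj]) simp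
    also have "\<dots> = (\<Sum>ws\<in>permutations_of_set {..<length as}. chain y (map u (map ((!) as) ws)) w)"
      by (subst sum.reindex[OF ij]) simp
    also have "\<dots> = Qf y {..<length as} ((!) (map u as)) w"
      unfolding Qf_def
    proof (rule sum.cong[OF refl])
      fix ws assume "ws \<in> permutations_of_set {..<length as}"
      then have "map u (map ((!) as) ws) = map ((!) (map u as)) ws"
        by (auto simp: permutations_of_set_def)
      then show "chain y (map u (map ((!) as) ws)) w = chain y (map ((!) (map u as)) ws) w" by (simp only:)
    qed
    finally show ?thesis .
  qed
  then show ?thesis by auto
qed

lemma ex_runp_sum:
  assumes "finite I" "\<And>i. i \<in> I \<Longrightarrow> \<exists>D E. runp y D E (f i)"
  shows "\<exists>D E. runp y D E (\<lambda>x. \<Sum>i\<in>I. f i x)"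
proof -
  obtain D E where DE: "\<And>i. i \<in> I \<Longrightarrow> runp y (D i) (E i) (f i)" using assms(2) by metis
  have "runp y (sum D I) (sum E I) (f i)" if "i \<in> I" for i
    using DE[OF that] by (rule runp_mono) (use that assms(1) in \<open>auto intro: member_le_sum\<close>)
  then show ?thesis using runp_sum by blast
qed

lemma ex_runp_fmul: "\<exists>D E. runp y D E f \<Longrightarrow> \<exists>D E. runp y D E g \<Longrightarrow> \<exists>D E. runp y D E (fmul f g)"
  using runp_fmul by blast

lemma ex_runp_allY: "\<exists>D E. runp y D E (allY y)"
  using runp_all unfolding allY_def by blast

lemma ex_runp_chain: "\<exists>D E. runp y D E (chain y vs)"
  by (induction vs) (auto intro!: ex_runp_fmul ex_runp_allY intro: runp_mono_word)

lemma ex_runp_Qf: "\<exists>D E. runp y D E (Qf y A u)"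
  unfolding Qf_def by (rule ex_runp_sum[OF _ ex_runp_chain]) simp

section \<open>Types of generators: finitely many, eventually the same for all n\<close>

text \<open>What survives of a generator after the collapse: the outer factors and, in between, the
  words other than the single repeated letter. The number of words left out enters only through a
  scalar factorial.\<close>

type_synonym gtype = "nat list \<times> nat list list \<times> nat list"

definition Ft :: "nat \<Rightarrow> gtype \<Rightarrow> nat list \<Rightarrow> 'a::field" where
  "Ft b t = (case t of (x, vs, z) \<Rightarrow> fmul (wmono x) (fmul (Qf b {..<length vs} ((!) vs)) (wmono z)))"

lemma ex_runp_Ft: "\<exists>D E. runp b D E (Ft b t)"
  unfolding Ft_def by (cases t) (auto intro!: ex_runp_fmul ex_runp_Qf intro: runp_mono_word)

text \<open>A relation rather than a function, because the order in which the remaining words are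
  listed is arbitrary.\<close>

definition has_type :: "nat \<Rightarrow> nat list \<times> nat list set \<times> nat list \<Rightarrow> gtype \<Rightarrow> bool" where
  "has_type b G t \<longleftrightarrow> (case G of (u, A, v) \<Rightarrow> \<exists>as. distinct as \<and> set as = {x\<in>A. bar b x \<noteq> [b]} \<and>
     t = (bar b u, map (bar b) as, bar b v))"

lemma has_type_ex: "finite A \<Longrightarrow> \<exists>t. has_type b (u, A, v) t"
  unfolding has_type_def using finite_distinct_list[of "{x\<in>A. bar b x \<noteq> [b]}"] by auto

lemma gidx_length:
  assumes "(u, A, v) \<in> gidx n m"
  shows "length u + (\<Sum>x\<in>A. length x) + length v = m"
proof -
  have "finite A" using assms by (simp add: gidx_def)
  then obtain ws where ws: "ws \<in> permutations_of_set A"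
    using permutations_of_set_empty_iff[of A] by blast
  then have "mlw m (u @ concat ws @ v)" using assms by (simp add: gidx_def)
  from mlw_length[OF this] show ?thesis using length_concat_perm[OF ws, of "\<lambda>x. x"] by simp
qed

lemma psym_gen_type:
  assumes g: "(u, A, v) \<in> gidx n m" and b: "b \<le> m" and t: "has_type b (u, A, v) t"
  shows "\<exists>k. psym {b..<m} wact (gen u A v) = (\<lambda>w. fact k * (if mlw m w then Ft b t (bar b w) else 0 :: 'a::field_char_0))"
proof -
  obtain as where as: "distinct as" "set as = {x\<in>A. bar b x \<noteq> [b]}" "t = (bar b u, map (bar b) as, bar b v)"
    using t by (auto simp: has_type_def)
  define k where "k = card {x\<in>A. bar b x = [b]}"
  have fin: "finite A" using g by (simp add: gidx_def)
  have Q: "Qf b {x\<in>A. bar b x \<noteq> [b]} (bar b) = Qf b {..<length (map (bar b) as)} ((!) (map (bar b) as))"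
    using Qf_reindex[OF as(1), of b "bar b"] as(2) by simp
  have "fmul (wmono (bar b u)) (fmul (Phi A (bar b)) (wmono (bar b v))) x = fact k * (Ft b t x :: 'a)" if x: "length x = m" for x
  proof -
    have *: "fmul (Phi A (bar b)) (wmono (bar b v)) y = fact k * (fmul (Qf b {x\<in>A. bar b x \<noteq> [b]} (bar b)) (wmono (bar b v)) y :: 'a)"
      if "length y = (\<Sum>x\<in>A. length x) + length v" for y
    proof -
      have e: "Phi A (bar b) (take j y) * wmono (bar b v) (drop j y) =
         fact k * (Qf b {x\<in>A. bar b x \<noteq> [b]} (bar b) (take j y) * wmono (bar b v) (drop j y) :: 'a)" if "j \<le> length y" for j
      proof (cases "drop j y = bar b v")
        case True
        then have "length (drop j y) = length v" by simp
        then have "length (take j y) = (\<Sum>x\<in>A. length (bar b x))" using \<open>length y = _\<close> that by simp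
        from Phi_eq_Qf[where 'a = 'a, OF fin this, of b] show ?thesis by (simp add: k_def mult.assoc)
      qed (simp add: wmono_def)
      show ?thesis unfolding fmul_def sum_distrib_left by (rule sum.cong[OF refl], rule e) simp
    qed
    have l: "length (drop (length u) x) = (\<Sum>x\<in>A. length x) + length v"
      using gidx_length[OF g] x by simp
    show ?thesis using *[OF l] by (simp add: fmul_mono_left Ft_def as(3) Q)
  qed
  then have "psym {b..<m} wact (gen u A v) = (\<lambda>w. fact k * (if mlw m w then Ft b t (bar b w) else 0 :: 'a))"
    unfolding psym_gen[OF g b] fun_eq_iff using mlw_length by auto
  then show ?thesis by blast
qed

definition types :: "nat \<Rightarrow> nat \<Rightarrow> nat \<Rightarrow> gtype set" where
  "types b K n = {t. \<exists>G\<in>gidx n (n + K). has_type b G t}"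

text \<open>The \<open>n\<close> nonempty words use one letter each; the \<open>K\<close> letters
  beyond that are distributed over longer words and outer factors. This bounds everything
  exceptional independently of \<open>n\<close>.\<close>

lemma gidx_excess:
  assumes "(u, A, v) \<in> gidx n (n + K)"
  shows "length u + (\<Sum>x\<in>A. length x - 1) + length v = K"
proof -
  have A: "finite A" "card A = n" "\<And>x. x \<in> A \<Longrightarrow> x \<noteq> []" using assms by (auto simp: gidx_def)
  have "(\<Sum>x\<in>A. length x) = (\<Sum>x\<in>A. (length x - 1) + 1)"
    by (rule sum.cong) (use A(3) in \<open>auto simp: Suc_le_eq\<close>)
  also have "\<dots> = (\<Sum>x\<in>A. length x - 1) + (\<Sum>x\<in>A. 1)" by (rule sum.distrib)
  also have "(\<Sum>x\<in>A. 1) = n" using A by simp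
  finally show ?thesis using gidx_length[OF assms] by simp
qed

lemma card_long_words:
  assumes "(u, A, v) \<in> gidx n (n + K)"
  shows "card {x\<in>A. length x \<noteq> 1} \<le> K"
proof -
  have A: "finite A" "\<And>x. x \<in> A \<Longrightarrow> x \<noteq> []" using assms by (auto simp: gidx_def)
  have "card {x\<in>A. length x \<noteq> 1} = (\<Sum>x\<in>{x\<in>A. length x \<noteq> 1}. 1)" by simp
  also have "\<dots> \<le> (\<Sum>x\<in>{x\<in>A. length x \<noteq> 1}. length x - 1)"
  proof (rule sum_mono)
    fix x assume x: "x \<in> {x\<in>A. length x \<noteq> 1}"
    then have "length x \<noteq> 0" "length x \<noteq> 1" using A by auto
    then show "1 \<le> length x - 1" by linarith
  qed
  also have "\<dots> \<le> (\<Sum>x\<in>A. length x - 1)" by (rule sum_mono2) (use A in auto)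
  finally show ?thesis using gidx_excess[OF assms] by simp
qed

text \<open>The bound \<open>K + b\<close> counts at most \<open>K\<close> words with several
  letters and at most \<open>b\<close> one-letter words whose letter lies below \<open>b\<close>.
  The enclosing set does not involve \<open>n\<close>.\<close>

lemma types_bounded:
  "types b K n \<subseteq> {x. set x \<subseteq> {..b} \<and> length x \<le> K} \<times>
     {vs. set vs \<subseteq> {x. set x \<subseteq> {..b} \<and> length x \<le> K + 1} \<and> length vs \<le> K + b} \<times> {x. set x \<subseteq> {..b} \<and> length x \<le> K}"
proof
  fix t assume "t \<in> types b K n"
  then obtain u A v as where g: "(u, A, v) \<in> gidx n (n + K)" and as: "distinct as" "set as = {x\<in>A. bar b x \<noteq> [b]}"
      and t: "t = (bar b u, map (bar b) as, bar b v)"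
    by (auto simp: types_def has_type_def)
  have fin: "finite A" using g by (simp add: gidx_def)
  have xs: "length x \<le> K + 1" if "x \<in> A" for x
    using gidx_excess[OF g] member_le_sum[of x A "\<lambda>x. length x - 1"] that fin by simp
  have "length as = card {x\<in>A. bar b x \<noteq> [b]}" using as distinct_card by metis
  also have "\<dots> \<le> card ({x\<in>A. length x \<noteq> 1} \<union> (\<lambda>z. [z]) ` {..<b})"
  proof (rule card_mono)
    show "{x \<in> A. bar b x \<noteq> [b]} \<subseteq> {x \<in> A. length x \<noteq> 1} \<union> (\<lambda>z. [z]) ` {..<b}"
    proof
      fix x assume x: "x \<in> {x \<in> A. bar b x \<noteq> [b]}"
      show "x \<in> {x \<in> A. length x \<noteq> 1} \<union> (\<lambda>z. [z]) ` {..<b}"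
      proof (cases "length x = 1")
        case True
        then obtain z where "x = [z]" by (auto simp: length_Suc_conv)
        then show ?thesis using x by (auto simp: min_def split: if_splits)
      qed (use x in auto)
    qed
  qed (use fin in auto)
  also have "\<dots> \<le> card {x\<in>A. length x \<noteq> 1} + card ((\<lambda>z. [z]) ` {..<b})" by (rule card_Un_le)
  also have "\<dots> \<le> K + b" using card_long_words[OF g] card_image_le[of "{..<b}" "\<lambda>z. [z]"] by simp
  finally have "length as \<le> K + b" .
  moreover have "set (bar b x) \<subseteq> {..b}" for x by auto
  ultimately show "t \<in> {x. set x \<subseteq> {..b} \<and> length x \<le> K} \<times>
     {vs. set vs \<subseteq> {x. set x \<subseteq> {..b} \<and> length x \<le> K + 1} \<and> length vs \<le> K + b} \<times> {x. set x \<subseteq> {..b} \<and> length x \<le> K}"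
    using gidx_excess[OF g] as xs unfolding t by auto
qed

text \<open>The fresh letter \<open>n + K\<close> is added as a one-letter word; as
  \<open>b \<le> n + K\<close>, it collapses to \<open>b\<close> and leaves the type
  unchanged.\<close>

lemma types_Suc:
  assumes "b \<le> n + K"
  shows "types b K n \<subseteq> types b K (Suc n)"
proof
  let ?m = "n + K"
  fix t assume "t \<in> types b K n"
  then obtain u A v as where g: "(u, A, v) \<in> gidx n ?m" and as: "distinct as" "set as = {x\<in>A. bar b x \<noteq> [b]}"
      and t: "t = (bar b u, map (bar b) as, bar b v)"
    by (auto simp: types_def has_type_def)
  have fin: "finite A" using g by (simp add: gidx_def)
  obtain ws0 where ws0: "ws0 \<in> permutations_of_set A" using permutations_of_set_empty_iff[of A] fin by blast
  then have ml: "mlw ?m (u @ concat ws0 @ v)" using g by (simp add: gidx_def)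
  have new: "[?m] \<notin> A"
  proof
    assume "[?m] \<in> A"
    then have "?m \<in> set (concat ws0)" using ws0 by (force simp: permutations_of_set_def)
    then show False using ml by (auto simp: mlw_def)
  qed
  have "mlw (Suc ?m) (u @ concat ws @ v)" if ws: "ws \<in> permutations_of_set (insert [?m] A)" for ws
  proof -
    have "[?m] # ws0 \<in> permutations_of_set (insert [?m] A)" using ws0 new by (auto simp: permutations_of_set_def)
    from mset_concat_perm[OF ws this] have "mset (concat ws) = add_mset ?m (mset (concat ws0))" by simp
    then show ?thesis using ml by (simp add: mlw_mset lessThan_Suc)
  qed
  then have "(u, insert [?m] A, v) \<in> gidx (Suc n) (Suc n + K)"
    using g fin new by (auto simp: gidx_def)
  moreover have "has_type b (u, insert [?m] A, v) t"
  proof -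
    have "{x\<in>insert [?m] A. bar b x \<noteq> [b]} = {x\<in>A. bar b x \<noteq> [b]}" using assms by auto
    then show ?thesis unfolding has_type_def t using as by auto
  qed
  ultimately show "t \<in> types b K (Suc n)" unfolding types_def by blast
qed

text \<open>The sets of types increase with n inside a fixed finite set.\<close>

lemma types_stable: "\<exists>T n0. finite T \<and> (\<forall>n\<ge>n0. types b K n = T)"
proof -
  let ?T = "\<Union>n\<in>{b..}. types b K n"
  have "?T \<subseteq> {x. set x \<subseteq> {..b} \<and> length x \<le> K} \<times>
     {vs. set vs \<subseteq> {x. set x \<subseteq> {..b} \<and> length x \<le> K + 1} \<and> length vs \<le> K + b} \<times> {x. set x \<subseteq> {..b} \<and> length x \<le> K}"
    using types_bounded by blast
  then have fin: "finite ?T"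
    by (rule finite_subset) (intro finite_cartesian_product finite_lists_length_le finite_atMost)
  have mono: "types b K n \<subseteq> types b K n'" if "b \<le> n" "n \<le> n'" for n n'
    using that(2)
  proof (induction n' rule: dec_induct)
    case (step k)
    then show ?case using types_Suc[of b k K] that(1) by auto
  qed simp
  have "\<forall>t\<in>?T. \<exists>n\<ge>b. t \<in> types b K n" by auto
  then obtain N where N: "\<And>t. t \<in> ?T \<Longrightarrow> b \<le> N t \<and> t \<in> types b K (N t)" by metis
  define n0 where "n0 = b + sum N ?T"
  have "types b K n = ?T" if "n0 \<le> n" for n
  proof
    have "b \<le> n" using that by (simp add: n0_def)
    then show "types b K n \<subseteq> ?T" by blast
    show "?T \<subseteq> types b K n"
    proof
      fix t assume t: "t \<in> ?T"
      have "N t \<le> n" using member_le_sum[OF t, of N] fin that by (simp add: n0_def)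
      then show "t \<in> types b K n" using mono N[OF t] by blast
    qed
  qed
  then show ?thesis using fin by blast
qed

lemma hasdim_of_findep:
  assumes "finite T" "\<And>t. t \<in> T \<Longrightarrow> v t \<in> X" "findep T v" "X \<subseteq> fspan (v ` T)"
  shows "hasdim X (card T)"
proof -
  obtain h where h: "bij_betw h {..<card T} T" using ex_bij_betw_nat_finite[OF assms(1)] by (auto simp: atLeast0LessThan)
  then have im: "h ` {..<card T} = T" and inj: "inj_on h {..<card T}" by (auto simp: bij_betw_def)
  have "findep {..<card T} (\<lambda>i. v (h i))"
    unfolding findep_def
  proof (intro allI impI ballI)
    fix c i assume z: "\<forall>x. (\<Sum>i<card T. c i * v (h i) x) = 0" and i: "i \<in> {..<card T}"
    let ?c = "\<lambda>t. c (inv_into {..<card T} h t)"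
    have "(\<Sum>t\<in>T. ?c t * v t x) = (\<Sum>i<card T. c i * v (h i) x)" for x
      using sum.reindex[OF inj, of "\<lambda>t. ?c t * v t x"] inj unfolding im by simp
    then have "\<forall>t\<in>T. ?c t = 0" using assms(3)[unfolded findep_def, rule_format, of ?c] z by simp
    then have "?c (h i) = 0" using i im by blast
    then show "c i = 0" using inj i by simp
  qed
  moreover have "(\<lambda>i. v (h i)) ` {..<card T} = v ` T" using im by (simp add: image_image[symmetric])
  moreover have "v (h i) \<in> X" if "i < card T" for i using assms(2) im that by blast
  ultimately show ?thesis unfolding hasdim_def using assms(4)
    by (intro exI[of _ "\<lambda>i. v (h i)"]) simp
qed

lemma gact_wact_add: "gact I c \<tau> wact (\<lambda>w. f w + g w) = (\<lambda>w. gact I c \<tau> wact f w + gact I c \<tau> wact g w)"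
  by (simp add: gact_def wact_def distrib_left sum.distrib)
lemma gact_wact_scale: "gact I c \<tau> wact (\<lambda>w. k * f w) = (\<lambda>w. k * gact I c \<tau> wact f w)"
  by (simp add: gact_def wact_def sum_distrib_left mult_ac)
lemma gact_wact_zero: "gact I c \<tau> wact (\<lambda>w. 0) = (\<lambda>w. 0)"
  by (simp add: gact_def wact_def)

lemma psym_wact_add: "psym B wact (\<lambda>w. f w + g w) = (\<lambda>w. psym B wact f w + psym B wact g w)"
  unfolding psym_def by (rule gact_wact_add)
lemma psym_wact_scale: "psym B wact (\<lambda>w. k * f w) = (\<lambda>w. k * psym B wact f w)"
  unfolding psym_def by (rule gact_wact_scale)
lemma psym_wact_zero: "psym B wact (\<lambda>w. 0) = (\<lambda>w. 0)"
  unfolding psym_def by (rule gact_wact_zero)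

text \<open>Each generator of type \<open>t\<close> is mapped to a factorial times one vector
  \<open>V m t\<close>, so the image is the span covered by \<open>stable_rank\<close>. The group
  algebra element moves letters up to \<open>c\<close>, hence coefficients depend on the finer
  pattern \<open>bar c w\<close>, although the symmetrization starts at \<open>b\<close>.\<close>

lemma stable_dim:
  fixes cf :: "'i \<Rightarrow> 'a::field_char_0"
  assumes bc: "b \<le> c" and I: "finite I" "\<And>i. i \<in> I \<Longrightarrow> \<tau> i permutes {..<c}"
  shows "\<exists>r n0. \<forall>n\<ge>n0. hasdim ((\<lambda>f. gact I cf \<tau> wact (psym {b..<n + K} wact f)) ` Wnm n (n + K)) r"
proof -
  define g where "g t x = (\<Sum>i\<in>I. cf i * Ft b t (bar b (map (inv (\<tau> i)) x)))" for t x
  define V where "V = (\<lambda>m t w. if mlw m w then g t (bar c w) else 0)"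
  obtain T n1 where T: "finite T" "\<And>n. n \<ge> n1 \<Longrightarrow> types b K n = T" using types_stable by metis
  have "\<exists>D E. runp c D E (g t)" for t
    unfolding g_def
  proof (rule ex_runp_sum[OF I(1)])
    fix i assume i: "i \<in> I"
    obtain D E where DE: "runp b D E (Ft b t :: nat list \<Rightarrow> 'a)" using ex_runp_Ft by blast
    \<comment> \<open>The letter \<open>c\<close> is not moved and collapses to \<open>b\<close>, so
      a run of \<open>c\<close> becomes a run of \<open>b\<close> of the same length.\<close>
    have "inv (\<tau> i) c = c" using permutes_not_in[OF permutes_inv[OF I(2)[OF i]], of c] by simp
    then have "bar b (map (inv (\<tau> i)) (u @ replicate s c @ w)) =
       bar b (map (inv (\<tau> i)) u) @ replicate s b @ bar b (map (inv (\<tau> i)) w)" for u s w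
      using bc by simp
    then have "runp c D E (\<lambda>x. Ft b t (bar b (map (inv (\<tau> i)) x)) :: 'a)"
      using DE unfolding runp_def by (simp only:) blast
    then show "\<exists>D E. runp c D E (\<lambda>x. cf i * Ft b t (bar b (map (inv (\<tau> i)) x)))"
      using runp_mult by blast
  qed
  then obtain T0 m0 where T0: "T0 \<subseteq> T" "\<And>m. m \<ge> m0 \<Longrightarrow> findep T0 (V m)"
     "\<And>m t. m \<ge> m0 \<Longrightarrow> t \<in> T \<Longrightarrow> V m t \<in> fspan (V m ` T0)"
    using stable_rank[OF T(1) _ V_def] by metis
  have main: "hasdim ((\<lambda>f. gact I cf \<tau> wact (psym {b..<n + K} wact f)) ` Wnm n (n + K)) (card T0)"
    if n: "n \<ge> n1 + m0 + c + 1" for n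
  proof -
    let ?m = "n + K"
    define L where "L f = gact I cf \<tau> wact (psym {b..<?m} wact f)" for f :: "nat list \<Rightarrow> 'a"
    have W: "Wnm n ?m = (fspan (gens n ?m) :: (nat list \<Rightarrow> 'a) set)" by (rule Wnm_eq_fspan) (use n in simp)
    have Llin: "L (\<lambda>w. f w + g w) = (\<lambda>w. L f w + L g w)" "L (\<lambda>w. k * f w) = (\<lambda>w. k * L f w)" "L (\<lambda>w. 0) = (\<lambda>w. 0)" for f g k
      by (simp_all add: L_def psym_wact_add psym_wact_scale psym_wact_zero gact_wact_add gact_wact_scale gact_wact_zero)
    have Lg: "\<exists>k. L (gen u A v) = (\<lambda>w. fact k * V ?m t w)" if G: "(u, A, v) \<in> gidx n ?m" "has_type b (u, A, v) t" for u A v t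
    proof -
      have "b \<le> ?m" using n bc by simp
      from psym_gen_type[OF G(1) this G(2)] obtain k where
        k: "psym {b..<?m} wact (gen u A v) = (\<lambda>w. fact k * (if mlw ?m w then Ft b t (bar b w) else 0 :: 'a))" by blast
      have "L (gen u A v) w = fact k * V ?m t w" for w
      proof -
        have t1: "mlw ?m (map (inv (\<tau> i)) w) \<longleftrightarrow> mlw ?m w" if "i \<in> I" for i
          by (rule permutes_mlw, rule permutes_inv, rule permutes_subset[OF I(2)[OF that]]) (use n in auto)
        have t2: "bar b (map (inv (\<tau> i)) (bar c w)) = bar b (map (inv (\<tau> i)) w)" if i: "i \<in> I" for i
        proof -
          have "inv (\<tau> i) x = x" if "c \<le> x" for x using permutes_not_in[OF permutes_inv[OF I(2)[OF i]], of x] that by simp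
          then have "min b (inv (\<tau> i) (min c x)) = min b (inv (\<tau> i) x)" for x
            using bc by (cases "c \<le> x") (auto simp: min_def)
          then show ?thesis by simp
        qed
        have "L (gen u A v) w = (\<Sum>i\<in>I. cf i * (fact k * (if mlw ?m w then Ft b t (bar b (map (inv (\<tau> i)) (bar c w))) else 0)))"
          unfolding L_def k gact_def wact_def by (rule sum.cong) (simp_all only: t1 t2)
        then show ?thesis by (simp add: V_def g_def sum_distrib_left mult_ac)
      qed
      then show ?thesis by blast
    qed
    have X: "L ` Wnm n ?m \<subseteq> fspan (V ?m ` T0)"
    proof -
      have "subsp {f. L f \<in> fspan (V ?m ` T0)}"
        using subsp_fspan[of "V ?m ` T0"] unfolding subsp_def by (auto simp: Llin)
      moreover have "gens n ?m \<subseteq> {f. L f \<in> fspan (V ?m ` T0)}"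
      proof
        fix f :: "nat list \<Rightarrow> 'a" assume "f \<in> gens n ?m"
        then obtain u A v where f: "f = gen u A v" "(u, A, v) \<in> gidx n ?m" by (auto simp: gens_def)
        then have "finite A" by (simp add: gidx_def)
        then obtain t where t: "has_type b (u, A, v) t" using has_type_ex by blast
        then have "t \<in> types b K n" unfolding types_def using f by blast
        then have "t \<in> T" using T(2) n by simp
        then have "V ?m t \<in> fspan (V ?m ` T0)" using T0(3) n by simp
        moreover obtain k where "L f = (\<lambda>w. fact k * V ?m t w)" using Lg[OF f(2) t] f by blast
        ultimately show "f \<in> {f. L f \<in> fspan (V ?m ` T0)}"
          using subsp_fspan[of "V ?m ` T0"] by (simp add: subsp_def)
      qed
      ultimately show ?thesis unfolding W using fspan_minimal by blast
    qed
    have Y: "V ?m t \<in> L ` Wnm n ?m" if t: "t \<in> T0" for t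
    proof -
      have "t \<in> types b K n" using T0(1) t T(2)[of n] n by auto
      then obtain u A v where G: "(u, A, v) \<in> gidx n ?m" "has_type b (u, A, v) t" unfolding types_def by auto
      obtain k where k: "L (gen u A v) = (\<lambda>w. fact k * V ?m t w)" using Lg[OF G] by blast
      have "gen u A v \<in> fspan (gens n ?m :: (nat list \<Rightarrow> 'a) set)" using G by (auto simp: gens_def intro!: fspan_base)
      then have "(\<lambda>w. (1 / fact k) * gen u A v w) \<in> (Wnm n ?m :: (nat list \<Rightarrow> 'a) set)"
        unfolding W using subsp_fspan[of "gens n ?m :: (nat list \<Rightarrow> 'a) set"] unfolding subsp_def by blast
      moreover have "L (\<lambda>w. (1 / fact k) * gen u A v w) = V ?m t" unfolding Llin k by simp
      ultimately show ?thesis by (metis imageI)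
    qed
    have "findep T0 (V ?m)" using T0(2) n by simp
    then have "hasdim (L ` Wnm n ?m) (card T0)"
      using hasdim_of_findep[of T0 "V ?m" "L ` Wnm n ?m"] X Y T0(1) T(1) finite_subset by blast
    then show ?thesis unfolding L_def .
  qed
  show ?thesis using main by blast
qed

section \<open>Tableaux and column antisymmetrizers\<close>

abbreviation PS :: "nat \<Rightarrow> (nat \<Rightarrow> nat) set" where "PS m \<equiv> {\<sigma>. \<sigma> permutes {..<m}}"

lemma finite_PS: "finite (PS m)" by (rule finite_permutations) simp

lemma inv_comp_permutes: "\<sigma> permutes S \<Longrightarrow> \<tau> permutes S \<Longrightarrow> inv (\<sigma> \<circ> \<tau>) = inv \<tau> \<circ> inv \<sigma>"
  by (simp add: o_inv_distrib permutes_bij)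

lemma permutes_cancel:
  assumes "\<sigma> permutes S"
  shows "\<sigma> \<circ> (inv \<sigma> \<circ> f) = f" "inv \<sigma> \<circ> (\<sigma> \<circ> f) = f" "(f \<circ> \<sigma>) \<circ> inv \<sigma> = f" "(f \<circ> inv \<sigma>) \<circ> \<sigma> = f"
  using permutes_inverses[OF assms] by (auto simp: fun_eq_iff)

lemma length_tact [simp]: "length (tact \<sigma> r) = length r" by (simp add: tact_def)

lemma tact_nth: "k < length r \<Longrightarrow> tact \<sigma> r ! k = r ! inv \<sigma> k" by (simp add: tact_def)

lemma tact_id [simp]: "tact id r = r" "tact (\<lambda>x. x) r = r"
  by (auto intro!: nth_equalityI simp: tact_nth inv_id[unfolded id_def])

lemma tact_comp:
  assumes "\<sigma> permutes {..<m}" "\<tau> permutes {..<m}" "length r = m"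
  shows "tact \<sigma> (tact \<tau> r) = tact (\<sigma> \<circ> \<tau>) r"
proof (rule nth_equalityI)
  fix k assume "k < length (tact \<sigma> (tact \<tau> r))"
  then have k: "k < length r" "inv \<sigma> k < length r"
    using permutes_in_image[OF permutes_inv[OF assms(1)], of k] assms(3) by auto
  then show "tact \<sigma> (tact \<tau> r) ! k = tact (\<sigma> \<circ> \<tau>) r ! k"
    by (simp add: tact_nth inv_comp_permutes[OF assms(1,2)])
qed simp

lemma tact_inverse:
  assumes "\<sigma> permutes {..<m}" "length r = m"
  shows "tact (inv \<sigma>) (tact \<sigma> r) = r" "tact \<sigma> (tact (inv \<sigma>) r) = r"
  using tact_comp[OF permutes_inv[OF assms(1)] assms] tact_comp[OF assms(1) permutes_inv[OF assms(1)] assms(2)]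
    permutes_inv_o[OF assms(1)] by auto

lemma tact_eq_iff:
  assumes "\<sigma> permutes {..<m}" "length r = m" "length s = m"
  shows "tact \<sigma> r = s \<longleftrightarrow> r = tact (inv \<sigma>) s"
  using tact_inverse[OF assms(1)] assms by metis

section \<open>Functions on tabloids\<close>

definition ract :: "(nat \<Rightarrow> nat) \<Rightarrow> (nat list \<Rightarrow> 'a) \<Rightarrow> nat list \<Rightarrow> 'a" where
  "ract \<sigma> f = (\<lambda>r. f (tact (inv \<sigma>) r))"

definition shape :: "nat \<Rightarrow> nat list \<Rightarrow> nat list \<Rightarrow> bool" where
  "shape m lam r \<longleftrightarrow> length r = m \<and> (\<forall>i. card {k. k < m \<and> r ! k = i} = (if i < length lam then lam ! i else 0))"

text \<open>The permutation module on tabloids, usually written M with superscript lambda.\<close>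

definition Mmod :: "nat \<Rightarrow> nat list \<Rightarrow> (nat list \<Rightarrow> 'a::field) set" where
  "Mmod m lam = {f. \<forall>r. f r \<noteq> 0 \<longrightarrow> shape m lam r}"

lemma subsp_Mmod: "subsp (Mmod m lam)"
  by (auto simp: subsp_def Mmod_def) (metis add.right_neutral)

lemma shape_tact:
  assumes "\<sigma> permutes {..<m}" "shape m lam r"
  shows "shape m lam (tact \<sigma> r)"
proof -
  have l: "length r = m" using assms by (simp add: shape_def)
  have "card {k. k < m \<and> tact \<sigma> r ! k = i} = card {k. k < m \<and> r ! k = i}" for i
  proof -
    have "{k. k < m \<and> tact \<sigma> r ! k = i} = \<sigma> ` {k. k < m \<and> r ! k = i}"
    proof (intro set_eqI iffI)
      fix k assume "k \<in> {k. k < m \<and> tact \<sigma> r ! k = i}"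
      then have "inv \<sigma> k \<in> {k. k < m \<and> r ! k = i}" "k = \<sigma> (inv \<sigma> k)"
        using l permutes_in_image[OF permutes_inv[OF assms(1)], of k] permutes_inverses(1)[OF assms(1)] by (auto simp: tact_nth)
      then show "k \<in> \<sigma> ` {k. k < m \<and> r ! k = i}" by blast
    next
      fix k assume "k \<in> \<sigma> ` {k. k < m \<and> r ! k = i}"
      then obtain l where "k = \<sigma> l" "l < m" "r ! l = i" by auto
      then show "k \<in> {k. k < m \<and> tact \<sigma> r ! k = i}"
        using \<open>length r = m\<close> permutes_in_image[OF assms(1), of l] permutes_inverses(2)[OF assms(1)] by (auto simp: tact_nth)
    qed
    then show ?thesis by (simp add: card_image permutes_inj_on[OF assms(1)])
  qed
  then show ?thesis using assms(2) by (simp add: shape_def)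
qed

lemma ract_Mmod: "\<sigma> permutes {..<m} \<Longrightarrow> f \<in> Mmod m lam \<Longrightarrow> ract \<sigma> f \<in> Mmod m lam"
  unfolding Mmod_def ract_def
proof (intro CollectI allI impI)
  fix r assume \<sigma>: "\<sigma> permutes {..<m}" and f: "f \<in> {f. \<forall>r. f r \<noteq> 0 \<longrightarrow> shape m lam r}" and "f (tact (inv \<sigma>) r) \<noteq> 0"
  then have s: "shape m lam (tact (inv \<sigma>) r)" by blast
  then have "length r = m" by (simp add: shape_def)
  then show "shape m lam r" using shape_tact[OF \<sigma> s] tact_inverse(2)[OF \<sigma>] by simp
qed

lemma Mmod_length: "f \<in> Mmod m lam \<Longrightarrow> length r \<noteq> m \<Longrightarrow> f r = 0"
  by (auto simp: Mmod_def shape_def)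

lemma ract_comp:
  assumes "\<sigma> permutes {..<m}" "\<tau> permutes {..<m}" "f \<in> Mmod m lam"
  shows "ract \<sigma> (ract \<tau> f) = ract (\<sigma> \<circ> \<tau>) f"
proof
  fix r
  show "ract \<sigma> (ract \<tau> f) r = ract (\<sigma> \<circ> \<tau>) f r"
    using tact_comp[OF permutes_inv[OF assms(2)] permutes_inv[OF assms(1)], of r] Mmod_length[OF assms(3)]
    by (cases "length r = m") (auto simp: ract_def inv_comp_permutes[OF assms(1,2)])
qed

lemma shape_prefix_card:
  assumes "shape m mu r"
  shows "card {k. k < m \<and> r ! k < i} = sum_list (take i mu)"
proof -
  have "card {k. k < m \<and> r ! k < i} = (\<Sum>j<i. card {k. k < m \<and> r ! k = j})"
  proof -
    have "{k. k < m \<and> r ! k < i} = (\<Union>j\<in>{..<i}. {k. k < m \<and> r ! k = j})" by auto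
    then show ?thesis by (simp only:) (rule card_UN_disjoint, auto)
  qed
  also have "\<dots> = (\<Sum>j<i. if j < length mu then mu ! j else 0)" using assms by (simp add: shape_def)
  also have "\<dots> = (\<Sum>j<length (take i mu). take i mu ! j)"
    by (rule sum.mono_neutral_cong_right) auto
  also have "\<dots> = sum_list (take i mu)" by (simp add: sum_list_sum_nth atLeast0LessThan)
  finally show ?thesis .
qed

locale tableau =
  fixes lam :: "nat list" and m :: nat and T :: "nat \<times> nat \<Rightarrow> nat"
  assumes part: "is_partition m lam" and bij: "bij_betw T (cells lam) {..<m}"
begin

definition pos where "pos k = inv_into (cells lam) T k"
definition row where "row k = fst (pos k)"
definition col where "col k = snd (pos k)"
definition t where "t = tabloid_of lam T"
definition C where "C = col_stab lam T"

lemma sum_lam: "sum_list lam = m" using part by (simp add: is_partition_def)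

lemma lam_mono: "i \<le> j \<Longrightarrow> j < length lam \<Longrightarrow> lam ! j \<le> lam ! i"
  using part sorted_wrt_nth_less[of "(\<ge>)" lam i j] by (cases "i = j") (auto simp: is_partition_def)

lemma pos_cells: "k < m \<Longrightarrow> pos k \<in> cells lam"
  using bij unfolding pos_def by (auto simp: bij_betw_def intro!: inv_into_into)

lemma T_pos: "k < m \<Longrightarrow> T (pos k) = k"
  using bij unfolding pos_def by (auto simp: bij_betw_def intro!: f_inv_into_f)

lemma pos_T: "c \<in> cells lam \<Longrightarrow> pos (T c) = c"
  using bij unfolding pos_def by (auto simp: bij_betw_def)

lemma T_less: "c \<in> cells lam \<Longrightarrow> T c < m"
  using bij by (auto simp: bij_betw_def)

lemma length_t [simp]: "length t = m" by (simp add: t_def tabloid_of_def sum_lam)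

lemma t_nth: "k < m \<Longrightarrow> t ! k = row k"
  by (simp add: t_def tabloid_of_def sum_lam row_def pos_def)

lemma row_col_eq: "k < m \<Longrightarrow> l < m \<Longrightarrow> row k = row l \<Longrightarrow> col k = col l \<Longrightarrow> k = l"
  unfolding row_def col_def by (metis T_pos prod_eqI)

lemma C_iff: "\<pi> \<in> C \<longleftrightarrow> \<pi> permutes {..<m} \<and> (\<forall>k<m. col (\<pi> k) = col k)"
  by (simp add: C_def col_stab_def sum_lam col_def pos_def)

lemma C_PS: "\<pi> \<in> C \<Longrightarrow> \<pi> permutes {..<m}" by (simp add: C_iff)

lemma C_id: "id \<in> C" by (simp add: C_iff permutes_id)

lemma C_comp: "\<pi> \<in> C \<Longrightarrow> \<rho> \<in> C \<Longrightarrow> \<pi> \<circ> \<rho> \<in> C"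
  unfolding C_iff using permutes_in_image[of \<rho> "{..<m}"] by (auto intro: permutes_compose)

lemma C_inv: assumes "\<pi> \<in> C" shows "inv \<pi> \<in> C"
proof -
  have p: "\<pi> permutes {..<m}" using assms by (rule C_PS)
  have "col (inv \<pi> k) = col k" if "k < m" for k
  proof -
    have "inv \<pi> k < m" using permutes_in_image[OF permutes_inv[OF p], of k] that by simp
    then have "col (\<pi> (inv \<pi> k)) = col (inv \<pi> k)" using assms by (simp add: C_iff)
    then show ?thesis using permutes_inverses(1)[OF p] by simp
  qed
  then show ?thesis using permutes_inv[OF p] by (simp add: C_iff)
qed

lemma finite_C: "finite C" by (rule finite_subset[OF _ finite_PS[of m]]) (auto simp: C_iff)

lemma t_shape: "shape m lam t"
  unfolding shape_def
proof (intro conjI allI)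
  fix i
  have "{k. k < m \<and> t ! k = i} = T ` {c \<in> cells lam. fst c = i}"
  proof (intro set_eqI iffI)
    fix k assume "k \<in> {k. k < m \<and> t ! k = i}"
    then have "pos k \<in> {c \<in> cells lam. fst c = i}" "k = T (pos k)" by (auto simp: t_nth row_def pos_cells T_pos)
    then show "k \<in> T ` {c \<in> cells lam. fst c = i}" by blast
  next
    fix k assume "k \<in> T ` {c \<in> cells lam. fst c = i}"
    then show "k \<in> {k. k < m \<and> t ! k = i}" by (auto simp: T_less t_nth row_def pos_T)
  qed
  moreover have "inj_on T {c \<in> cells lam. fst c = i}" using bij by (auto simp: bij_betw_def inj_on_def)
  ultimately have "card {k. k < m \<and> t ! k = i} = card {c \<in> cells lam. fst c = i}" by (simp add: card_image)
  also have "{c \<in> cells lam. fst c = i} = (if i < length lam then Pair i ` {..<lam ! i} else {})"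
    by (auto simp: cells_def)
  finally show "card {k. k < m \<and> t ! k = i} = (if i < length lam then lam ! i else 0)"
    by (simp add: card_image inj_on_def)
qed simp

abbreviation sgn' :: "(nat \<Rightarrow> nat) \<Rightarrow> 'a::field" where "sgn' \<pi> \<equiv> of_int (sign \<pi>)"

text \<open>The column antisymmetrizer of the tableau.\<close>

definition kap :: "(nat list \<Rightarrow> 'a::field) \<Rightarrow> nat list \<Rightarrow> 'a" where
  "kap f = (\<lambda>r. \<Sum>\<pi>\<in>C. sgn' \<pi> * f (tact (inv \<pi>) r))"

definition e :: "nat list \<Rightarrow> 'a::field" where "e = polytabloid lam T"

lemma sgn_comp: "\<pi> permutes {..<m} \<Longrightarrow> \<rho> permutes {..<m} \<Longrightarrow> (sgn' (\<pi> \<circ> \<rho>) :: 'a::field) = sgn' \<pi> * sgn' \<rho>"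
  by (simp add: sign_compose permutes_imp_permutation[of "{..<m}"])

lemma sgn_sq: "(sgn' \<pi> :: 'a::field) * sgn' \<pi> = 1"
  by (auto simp: sign_def)

lemma sgn_inv: "\<pi> permutes {..<m} \<Longrightarrow> (sgn' (inv \<pi>) :: 'a::field) = sgn' \<pi>"
  by (simp add: sign_inverse permutes_imp_permutation[of "{..<m}"])

lemma kap_tact:
  assumes \<pi>: "\<pi> \<in> C" and r: "length r = m"
  shows "kap f (tact \<pi> r) = sgn' \<pi> * (kap f r :: 'a::field)"
proof -
  have "kap f (tact \<pi> r) = (\<Sum>\<rho>\<in>C. sgn' \<rho> * f (tact (inv \<rho>) (tact \<pi> r)) :: 'a)" by (simp add: kap_def)
  also have "\<dots> = (\<Sum>\<rho>\<in>C. sgn' (\<pi> \<circ> \<rho>) * f (tact (inv \<rho>) r))"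
  proof (rule sum.reindex_bij_witness[of _ "\<lambda>\<rho>. \<pi> \<circ> \<rho>" "\<lambda>\<rho>. inv \<pi> \<circ> \<rho>"])
    fix \<rho> assume \<rho>: "\<rho> \<in> C"
    note p = C_PS[OF \<pi>] C_PS[OF \<rho>]
    show "\<pi> \<circ> (inv \<pi> \<circ> \<rho>) = \<rho>" "inv \<pi> \<circ> (\<pi> \<circ> \<rho>) = \<rho>" using permutes_cancel[OF p(1)] by auto
    show "inv \<pi> \<circ> \<rho> \<in> C" "\<pi> \<circ> \<rho> \<in> C" using C_comp C_inv \<pi> \<rho> by auto
    have "tact (inv (inv \<pi> \<circ> \<rho>)) r = tact (inv \<rho>) (tact \<pi> r)"
      using tact_comp[OF permutes_inv[OF p(2)] p(1) r]
      by (simp add: inv_comp_permutes[OF permutes_inv[OF p(1)] p(2)] permutes_inv_inv[OF p(1)])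
    moreover have "\<pi> \<circ> (inv \<pi> \<circ> \<rho>) = \<rho>" using permutes_cancel[OF p(1)] by auto
    ultimately show "(sgn' (\<pi> \<circ> (inv \<pi> \<circ> \<rho>)) * f (tact (inv (inv \<pi> \<circ> \<rho>)) r) :: 'a) = sgn' \<rho> * f (tact (inv \<rho>) (tact \<pi> r))"
      by simp
  qed
  also have "\<dots> = sgn' \<pi> * kap f r"
    unfolding kap_def sum_distrib_left
    by (rule sum.cong[OF refl]) (simp only: sgn_comp[OF C_PS[OF \<pi>] C_PS] mult.assoc)
  finally show ?thesis .
qed

definition colinj :: "nat list \<Rightarrow> bool" where
  "colinj r \<longleftrightarrow> (\<forall>k<m. \<forall>l<m. col k = col l \<longrightarrow> r ! k = r ! l \<longrightarrow> k = l)"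

lemma transpose_C: "k < m \<Longrightarrow> l < m \<Longrightarrow> col k = col l \<Longrightarrow> transpose k l \<in> C"
  by (auto simp: C_iff permutes_swap_id transpose_def)

text \<open>The transposition of two entries that share a column and a row of \<open>r\<close> fixes
  \<open>r\<close> and negates the value; 2 is invertible.\<close>

lemma kap_not_colinj:
  assumes r: "length r = m" and n: "\<not> colinj r"
  shows "kap f r = (0 :: 'a::field_char_0)"
proof -
  obtain k l where kl: "k < m" "l < m" "col k = col l" "r ! k = r ! l" "k \<noteq> l" using n by (auto simp: colinj_def)
  let ?p = "transpose k l"
  have p: "?p \<in> C" using transpose_C kl by auto
  have "tact ?p r = r"
    by (rule nth_equalityI) (use kl r in \<open>auto simp: tact_nth transpose_def\<close>)
  then have "kap f r = sgn' ?p * (kap f r :: 'a)" using kap_tact[OF p r, of f] by simp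
  also have "sgn' ?p = (-1 :: 'a)" using kl by (simp add: sign_swap_id)
  finally have "kap f r + kap f r = 0" by (simp add: eq_neg_iff_add_eq_0)
  then show ?thesis by (simp add: mult_2[symmetric])
qed

lemma row_less: "k < m \<Longrightarrow> row k < length lam" "k < m \<Longrightarrow> col k < lam ! row k"
  using pos_cells[of k] by (auto simp: row_def col_def cells_def case_prod_unfold)

definition colset where "colset c = {k. k < m \<and> col k = c}"
definition ht where "ht c = card {i. i < length lam \<and> c < lam ! i}"

text \<open>Row lengths decrease weakly, so the rows meeting column \<open>c\<close> form an initial
  segment.\<close>

lemma ht_iff: "i < ht c \<longleftrightarrow> i < length lam \<and> c < lam ! i"
proof -
  let ?S = "{i. i < length lam \<and> c < lam ! i}"
  have down: "j \<in> ?S" if "i \<in> ?S" "j \<le> i" for i j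
    using that lam_mono[of j i] by auto
  have fin: "finite ?S" by simp
  have S: "?S = {..<ht c}"
  proof (cases "?S = {}")
    case True
    then have "ht c = 0" unfolding ht_def by (metis card.empty)
    then show ?thesis using True by simp
  next
    case False
    define M where "M = Max ?S"
    have M: "M \<in> ?S" unfolding M_def by (rule Max_in[OF fin False])
    have le: "j \<le> M" if "j \<in> ?S" for j unfolding M_def by (rule Max_ge[OF fin that])
    have SM: "?S = {..<Suc M}"
    proof (intro set_eqI iffI)
      fix j assume "j \<in> ?S" then have "j \<le> M" by (rule le) then show "j \<in> {..<Suc M}" by simp
    next
      fix j assume "j \<in> {..<Suc M}" then have "j \<le> M" by simp
      then show "j \<in> ?S" by (rule down[OF M])
    qed
    then have "ht c = Suc M" unfolding ht_def by (simp only: card_lessThan)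
    then show ?thesis using SM by (simp only:)
  qed
  have "i < ht c \<longleftrightarrow> i \<in> ?S" using S by blast
  then show ?thesis by simp
qed

lemma bij_row: "bij_betw row (colset c) {..<ht c}"
proof (rule bij_betwI[of _ _ _ "\<lambda>i. T (i, c)"])
  show "row \<in> colset c \<rightarrow> {..<ht c}" by (auto simp: colset_def ht_iff row_less)
  show "(\<lambda>i. T (i, c)) \<in> {..<ht c} \<rightarrow> colset c"
    by (auto simp: colset_def ht_iff cells_def T_less pos_T col_def)
  show "T (row k, c) = k" if "k \<in> colset c" for k
    using that T_pos[of k] by (auto simp: colset_def row_def col_def)
  show "row (T (i, c)) = i" if "i \<in> {..<ht c}" for i
    using that pos_T[of "(i, c)"] by (auto simp: ht_iff cells_def row_def)
qed

lemma colset_card: "card (colset c) = ht c" using bij_betw_same_card[OF bij_row] by simp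
lemma finite_colset: "finite (colset c)" by (simp add: colset_def)

lemma colset_row_prefix: "card {k \<in> colset c. row k < i} = min i (ht c)"
proof -
  have "bij_betw row {k \<in> colset c. row k < i} {..<min i (ht c)}"
  proof (rule bij_betw_subset[OF bij_row])
    have "{..<ht c} = row ` colset c" using bij_row[of c] by (simp add: bij_betw_def)
    then have "row ` {k \<in> colset c. row k < i} = {..<ht c} \<inter> {..<i}" by (simp only:) auto
    then show "row ` {k \<in> colset c. row k < i} = {..<min i (ht c)}" by auto
  qed blast
  from bij_betw_same_card[OF this] show ?thesis by simp
qed

lemma colinj_prefix_le:
  assumes "colinj r"
  shows "card {k \<in> colset c. r ! k < i} \<le> min i (ht c)"
proof -
  have "card {k \<in> colset c. r ! k < i} = card ((!) r ` {k \<in> colset c. r ! k < i})"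
    by (rule card_image[symmetric]) (use assms in \<open>auto simp: colinj_def colset_def inj_on_def\<close>)
  also have "\<dots> \<le> card {..<i}" by (rule card_mono) auto
  finally have 1: "card {k \<in> colset c. r ! k < i} \<le> i" by simp
  have "card {k \<in> colset c. r ! k < i} \<le> card (colset c)" by (rule card_mono) (auto simp: finite_colset)
  then show ?thesis using 1 by (simp add: colset_card)
qed

lemma card_by_col: "card {k. k < m \<and> P k} = (\<Sum>c\<in>col ` {..<m}. card {k \<in> colset c. P k})"
proof -
  have "{k. k < m \<and> P k} = (\<Union>c\<in>col ` {..<m}. {k \<in> colset c. P k})" by (auto simp: colset_def)
  moreover have "card (\<Union>c\<in>col ` {..<m}. {k \<in> colset c. P k}) = (\<Sum>c\<in>col ` {..<m}. card {k \<in> colset c. P k})"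
  proof (rule card_UN_disjoint)
    show "\<forall>c\<in>col ` {..<m}. finite {k \<in> colset c. P k}" by (simp add: finite_colset)
    show "\<forall>c\<in>col ` {..<m}. \<forall>d\<in>col ` {..<m}. c \<noteq> d \<longrightarrow> {k \<in> colset c. P k} \<inter> {k \<in> colset d. P k} = {}"
      unfolding colset_def by blast
  qed simp
  ultimately show ?thesis by (rule trans[OF arg_cong])
qed

lemma row_prefix_card: "card {k. k < m \<and> row k < i} = sum_list (take i lam)"
proof -
  have "{k. k < m \<and> row k < i} = {k. k < m \<and> t ! k < i}" by (auto simp: t_nth)
  then show ?thesis using shape_prefix_card[OF t_shape] by simp
qed

text \<open>The dominance lemma. In column \<open>c\<close> at most \<open>min i (ht c)\<close>
  entries can lie in the first \<open>i\<close> rows of \<open>r\<close>, and the tabloid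
  \<open>t\<close> attains this bound in every column.\<close>

lemma colinj_dominated:
  assumes "colinj r" "shape m mu r"
  shows "sum_list (take i mu) \<le> sum_list (take i lam)"
proof -
  have "sum_list (take i mu) = (\<Sum>c\<in>col ` {..<m}. card {k \<in> colset c. r ! k < i})"
    using shape_prefix_card[OF assms(2)] card_by_col by metis
  also have "\<dots> \<le> (\<Sum>c\<in>col ` {..<m}. min i (ht c))" by (rule sum_mono) (rule colinj_prefix_le[OF assms(1)])
  also have "\<dots> = (\<Sum>c\<in>col ` {..<m}. card {k \<in> colset c. row k < i})" by (simp add: colset_row_prefix)
  also have "\<dots> = sum_list (take i lam)" using row_prefix_card card_by_col by metis
  finally show ?thesis .
qed

text \<open>For equal shapes all inequalities of the dominance argument are equalities, so
  \<open>r\<close> maps each column bijectively onto the rows \<open>0, ..., ht c - 1\<close>, as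
  \<open>row\<close> does; matching the two inside each column gives the permutation.\<close>

lemma colinj_orbit:
  assumes ci: "colinj r" and sh: "shape m lam r"
  shows "\<exists>\<pi>\<in>C. tact \<pi> t = r"
proof -
  have rl: "length r = m" using sh by (simp add: shape_def)
  have eq: "card {k \<in> colset c. r ! k < i} = min i (ht c)" if c: "c \<in> col ` {..<m}" for c i
  proof (rule ccontr)
    assume "card {k \<in> colset c. r ! k < i} \<noteq> min i (ht c)"
    then have less: "card {k \<in> colset c. r ! k < i} < min i (ht c)" using colinj_prefix_le[OF ci, of c i] by linarith
    have "(\<Sum>c\<in>col ` {..<m}. card {k \<in> colset c. r ! k < i}) < (\<Sum>c\<in>col ` {..<m}. min i (ht c))"
      by (rule sum_strict_mono_ex1) (use c less colinj_prefix_le[OF ci] in auto)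
    also have "\<dots> = (\<Sum>c\<in>col ` {..<m}. card {k \<in> colset c. row k < i})" by (simp add: colset_row_prefix)
    also have "\<dots> = sum_list (take i lam)" using row_prefix_card card_by_col by metis
    finally show False using shape_prefix_card[OF sh, of i] card_by_col[of "\<lambda>k. r ! k < i"] by simp
  qed
  have bijr: "bij_betw ((!) r) (colset c) {..<ht c}" if c: "c \<in> col ` {..<m}" for c
  proof -
    have inj: "inj_on ((!) r) (colset c)" using ci by (auto simp: colinj_def colset_def inj_on_def)
    have "{k \<in> colset c. r ! k < ht c} = colset c"
      by (rule card_subset_eq[OF finite_colset]) (use eq[OF c, of "ht c"] colset_card in auto)
    then have "(!) r ` colset c \<subseteq> {..<ht c}" by blast
    then have "(!) r ` colset c = {..<ht c}"
      by (rule card_subset_eq[rotated]) (use card_image[OF inj] colset_card in auto)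
    then show ?thesis using inj by (simp add: bij_betw_def)
  qed
  have ex: "\<exists>l. l \<in> colset (col k) \<and> r ! l = row k" if "k < m" for k
  proof -
    have c: "col k \<in> col ` {..<m}" using that by auto
    have "row k \<in> {..<ht (col k)}" using that by (auto simp: ht_iff row_less)
    then show ?thesis using bijr[OF c] unfolding bij_betw_def by (metis imageE)
  qed
  define \<pi> where "\<pi> k = (if k < m then SOME l. l \<in> colset (col k) \<and> r ! l = row k else k)" for k
  have \<pi>: "\<pi> k < m" "col (\<pi> k) = col k" "r ! \<pi> k = row k" if "k < m" for k
    using someI_ex[OF ex[OF that]] that by (auto simp: \<pi>_def colset_def)
  have "inj_on \<pi> {..<m}"
    by (rule inj_onI) (metis \<pi>(2,3) lessThan_iff row_col_eq)
  moreover have "\<pi> ` {..<m} = {..<m}"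
    by (rule endo_inj_surj) (use calculation \<pi> in auto)
  ultimately have p: "\<pi> permutes {..<m}"
    by (intro bij_imp_permutes) (auto simp: bij_betw_def \<pi>_def)
  have "tact \<pi> t = r"
  proof (rule nth_equalityI)
    fix k assume "k < length (tact \<pi> t)"
    then have k: "k < m" by simp
    have i: "inv \<pi> k < m" using permutes_in_image[OF permutes_inv[OF p], of k] k by simp
    show "tact \<pi> t ! k = r ! k" using \<pi>(3)[OF i] permutes_inverses(1)[OF p] k i by (simp add: tact_nth t_nth)
  qed (simp add: rl)
  moreover have "\<pi> \<in> C" using p \<pi> by (simp add: C_iff)
  ultimately show ?thesis by blast
qed

lemma stab_C: "\<pi> \<in> C \<Longrightarrow> tact \<pi> t = t \<Longrightarrow> \<pi> = id"
proof -
  assume \<pi>: "\<pi> \<in> C" "tact \<pi> t = t"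
  note p = C_PS[OF \<pi>(1)]
  have "\<pi> k = k" for k
  proof (cases "k < m")
    case True
    then have pk: "\<pi> k < m" using permutes_in_image[OF p, of k] by simp
    have "t ! \<pi> k = tact \<pi> t ! \<pi> k" using \<pi> by simp
    also have "\<dots> = t ! k" using pk permutes_inverses(2)[OF p] by (simp add: tact_nth)
    finally have "row (\<pi> k) = row k" using pk True by (simp add: t_nth)
    moreover have "col (\<pi> k) = col k" using \<pi> True by (simp add: C_iff)
    ultimately show ?thesis using row_col_eq pk True by blast
  next
    case False then show ?thesis using permutes_not_in[OF p] by simp
  qed
  then show ?thesis by auto
qed

lemma e_eval: "e r = (\<Sum>\<pi>\<in>C. if tact \<pi> t = r then sgn' \<pi> else (0::'a::field))"
  by (simp add: e_def polytabloid_def C_def t_def)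

lemma e_tact:
  assumes "\<pi> \<in> C"
  shows "e (tact \<pi> t) = (sgn' \<pi> :: 'a::field)"
proof -
  have "tact \<rho> t = tact \<pi> t \<longleftrightarrow> \<rho> = \<pi>" if "\<rho> \<in> C" for \<rho>
  proof
    assume "tact \<rho> t = tact \<pi> t"
    then have "tact (inv \<pi>) (tact \<rho> t) = t" using tact_inverse[OF C_PS[OF assms]] by simp
    then have "tact (inv \<pi> \<circ> \<rho>) t = t"
      using tact_comp[OF permutes_inv[OF C_PS[OF assms]] C_PS[OF that]] by simp
    then have "inv \<pi> \<circ> \<rho> = id" using stab_C C_comp C_inv assms that by blast
    then show "\<rho> = \<pi>" using permutes_cancel(1)[OF C_PS[OF assms], of \<rho>] by simp
  qed simp
  then have "e (tact \<pi> t) = (\<Sum>\<rho>\<in>C. if \<rho> = \<pi> then sgn' \<rho> else (0::'a))" unfolding e_eval by (intro sum.cong) auto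
  then show ?thesis using assms finite_C by simp
qed

lemma e_t: "e t = 1" using e_tact[OF C_id] by simp

lemma e_nz: "e r \<noteq> (0::'a::field) \<Longrightarrow> \<exists>\<pi>\<in>C. tact \<pi> t = r"
  unfolding e_eval by (rule ccontr) (auto intro: sum.neutral)

lemma e_Mmod: "e \<in> Mmod m lam"
  unfolding Mmod_def using e_nz shape_tact[OF C_PS t_shape] by fastforce

text \<open>Along the orbit of \<open>t\<close> under the column group both sides transform by the
  sign. Elsewhere both vanish: a tabloid of this shape outside the orbit has two entries of one
  column in one row.\<close>

lemma kap_eq:
  assumes f: "f \<in> Mmod m lam"
  shows "kap f = (\<lambda>r. kap f t * e r :: 'a::field_char_0)"
proof
  fix r
  show "kap f r = kap f t * (e r :: 'a)"
  proof (cases "\<exists>\<pi>\<in>C. tact \<pi> t = r")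
    case True
    then obtain \<pi> where \<pi>: "\<pi> \<in> C" "r = tact \<pi> t" by auto
    then show ?thesis using kap_tact[OF \<pi>(1) length_t, of f] e_tact[OF \<pi>(1), where 'a = 'a] by (simp add: mult.commute)
  next
    case False
    then have e0: "e r = (0::'a)" using e_nz by blast
    have "kap f r = 0"
    proof (cases "shape m lam r")
      case True
      then have "\<not> colinj r" using False colinj_orbit by blast
      then show ?thesis using True by (intro kap_not_colinj) (auto simp: shape_def)
    next
      case ns: False
      have "f (tact (inv \<pi>) r) = 0" if "\<pi> \<in> C" for \<pi>
      proof (rule ccontr)
        assume "f (tact (inv \<pi>) r) \<noteq> 0"
        then have s: "shape m lam (tact (inv \<pi>) r)" using f by (auto simp: Mmod_def)
        then have "length r = m" by (simp add: shape_def)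
        then have "shape m lam r" using shape_tact[OF C_PS[OF that] s] tact_inverse(2)[OF C_PS[OF that]] by simp
        then show False using ns by simp
      qed
      then show ?thesis by (simp add: kap_def)
    qed
    then show ?thesis using e0 by simp
  qed
qed

lemma kap_dominated:
  assumes f: "f \<in> Mmod m mu" and nz: "kap f r \<noteq> (0 :: 'a::field_char_0)"
  shows "sum_list (take i mu) \<le> sum_list (take i lam)"
proof -
  obtain \<pi> where \<pi>: "\<pi> \<in> C" "f (tact (inv \<pi>) r) \<noteq> 0"
  proof -
    have "kap f r = 0" if "\<forall>\<pi>\<in>C. f (tact (inv \<pi>) r) = 0" using that by (simp add: kap_def)
    then show ?thesis using nz that by blast
  qed
  then have s: "shape m mu (tact (inv \<pi>) r)" using f by (auto simp: Mmod_def)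
  then have l: "length r = m" by (simp add: shape_def)
  then have "shape m mu r" using shape_tact[OF C_PS[OF \<pi>(1)] s] tact_inverse(2)[OF C_PS[OF \<pi>(1)]] by simp
  moreover have "colinj r" using kap_not_colinj[OF l, of f] nz by blast
  ultimately show ?thesis using colinj_dominated by blast
qed

end

lemma ract_add: "ract \<sigma> (\<lambda>r. f r + g r) = (\<lambda>r. ract \<sigma> f r + ract \<sigma> g r)" by (simp add: ract_def)
lemma ract_scale: "ract \<sigma> (\<lambda>r. k * f r) = (\<lambda>r. k * ract \<sigma> f r)" by (simp add: ract_def)
lemma ract_lcomb: "ract \<sigma> (\<lambda>r. \<Sum>i\<in>I. c i * f i r) = (\<lambda>r. \<Sum>i\<in>I. c i * ract \<sigma> (f i) r)" by (simp add: ract_def)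
lemma ract_sum: "ract \<sigma> (\<lambda>r. \<Sum>i\<in>I. f i r) = (\<lambda>r. \<Sum>i\<in>I. ract \<sigma> (f i) r)" by (simp add: ract_def)
lemma ract_id: "ract id f = f" "ract (\<lambda>x. x) f = f" by (auto simp: ract_def inv_id[unfolded id_def])

context tableau
begin

text \<open>Relabelling the entries by \<open>\<sigma>\<close> conjugates the column group by
  \<open>\<sigma>\<close>, which preserves signs.\<close>

lemma transport:
  assumes \<sigma>: "\<sigma> permutes {..<m}" and T': "\<And>c. c \<in> cells lam \<Longrightarrow> T' c = \<sigma> (T c)"
  shows "polytabloid lam T' = (ract \<sigma> e :: nat list \<Rightarrow> 'a::field)"
proof -
  have bij': "bij_betw T' (cells lam) {..<m}"
  proof -
    have "bij_betw (\<sigma> \<circ> T) (cells lam) {..<m}" using bij permutes_imp_bij[OF \<sigma>] by (rule bij_betw_trans)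
    then show ?thesis by (rule bij_betw_cong[THEN iffD1, rotated]) (simp add: T')
  qed
  interpret T': tableau lam m T' by unfold_locales (rule part, rule bij')
  have isg: "inv \<sigma> k < m" if "k < m" for k using permutes_in_image[OF permutes_inv[OF \<sigma>], of k] that by simp
  have pos': "T'.pos k = pos (inv \<sigma> k)" if "k < m" for k
  proof -
    have c: "pos (inv \<sigma> k) \<in> cells lam" using pos_cells isg[OF that] by blast
    have "T' (pos (inv \<sigma> k)) = k" using T'[OF c] T_pos[OF isg[OF that]] permutes_inverses(1)[OF \<sigma>] by simp
    then show ?thesis using T'.pos_T[OF c] by simp
  qed
  have t': "T'.t = tact \<sigma> t"
    by (rule nth_equalityI) (auto simp: T'.t_nth tact_nth T'.row_def row_def pos' t_nth isg)
  have C': "\<pi> \<in> T'.C \<longleftrightarrow> \<pi> permutes {..<m} \<and> (\<forall>k<m. col (inv \<sigma> (\<pi> k)) = col (inv \<sigma> k))" for \<pi>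
    unfolding T'.C_iff T'.col_def col_def
  proof (rule conj_cong[OF refl])
    assume \<pi>: "\<pi> permutes {..<m}"
    have "\<pi> k < m" if "k < m" for k using permutes_in_image[OF \<pi>, of k] that by simp
    then show "(\<forall>k<m. snd (T'.pos (\<pi> k)) = snd (T'.pos k)) = (\<forall>k<m. snd (pos (inv \<sigma> (\<pi> k))) = snd (pos (inv \<sigma> k)))"
      by (simp add: pos')
  qed
  have C1: "inv \<sigma> \<circ> \<pi> \<circ> \<sigma> \<in> C" if "\<pi> \<in> T'.C" for \<pi>
  proof -
    have "col (inv \<sigma> (\<pi> (\<sigma> k))) = col k" if "k < m" for k
    proof -
      have "\<sigma> k < m" using permutes_in_image[OF \<sigma>, of k] that by simp
      then show ?thesis using \<open>\<pi> \<in> T'.C\<close> C' permutes_inverses(2)[OF \<sigma>] by metis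
    qed
    then show ?thesis using that \<sigma> C' by (auto simp: C_iff intro!: permutes_compose permutes_inv)
  qed
  have C2: "\<sigma> \<circ> \<pi> \<circ> inv \<sigma> \<in> T'.C" if "\<pi> \<in> C" for \<pi>
    using that isg \<sigma> permutes_inverses(2)[OF \<sigma>] by (auto simp: C' C_iff intro!: permutes_compose permutes_inv)
  show ?thesis
  proof
    fix r
    show "polytabloid lam T' r = (ract \<sigma> e r :: 'a)"
    proof (cases "length r = m")
      case True
      have "polytabloid lam T' r = (\<Sum>\<pi>\<in>T'.C. if tact \<pi> T'.t = r then sgn' \<pi> else (0::'a))"
        using T'.e_eval unfolding T'.e_def .
      also have "\<dots> = (\<Sum>\<pi>\<in>C. if tact \<pi> t = tact (inv \<sigma>) r then sgn' \<pi> else (0::'a))"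
      proof (rule sum.reindex_bij_witness[of _ "\<lambda>\<pi>. \<sigma> \<circ> \<pi> \<circ> inv \<sigma>" "\<lambda>\<pi>. inv \<sigma> \<circ> \<pi> \<circ> \<sigma>"])
        fix \<pi> assume \<pi>: "\<pi> \<in> T'.C"
        show "\<sigma> \<circ> (inv \<sigma> \<circ> \<pi> \<circ> \<sigma>) \<circ> inv \<sigma> = \<pi>" using permutes_inverses[OF \<sigma>] by (auto simp: fun_eq_iff)
        show "inv \<sigma> \<circ> \<pi> \<circ> \<sigma> \<in> C" by (rule C1[OF \<pi>])
        note p = T'.C_PS[OF \<pi>]
        have s: "(sgn' (inv \<sigma> \<circ> \<pi> \<circ> \<sigma>) :: 'a) = sgn' \<pi>"
        proof -
          have "(sgn' (inv \<sigma> \<circ> \<pi> \<circ> \<sigma>) :: 'a) = sgn' \<sigma> * sgn' \<pi> * sgn' \<sigma>"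
            using sgn_comp[OF permutes_compose[OF p permutes_inv[OF \<sigma>]] \<sigma>, where 'a = 'a]
              sgn_comp[OF permutes_inv[OF \<sigma>] p, where 'a = 'a] sgn_inv[OF \<sigma>, where 'a = 'a] by simp
          also have "\<dots> = (sgn' \<sigma> * sgn' \<sigma>) * sgn' \<pi>" by (simp only: mult_ac)
          finally show ?thesis by (simp only: sgn_sq mult_1)
        qed
        have "tact (inv \<sigma> \<circ> \<pi> \<circ> \<sigma>) t = tact (inv \<sigma>) (tact \<pi> (tact \<sigma> t))"
          using tact_comp[OF p \<sigma> length_t] tact_comp[OF permutes_inv[OF \<sigma>] permutes_compose[OF \<sigma> p] length_t]
          by (simp add: o_assoc)
        moreover have "tact (inv \<sigma>) (tact \<pi> (tact \<sigma> t)) = tact (inv \<sigma>) r \<longleftrightarrow> tact \<pi> (tact \<sigma> t) = r"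
          using tact_inverse(2)[OF \<sigma>, of r] tact_inverse(2)[OF \<sigma>, of "tact \<pi> (tact \<sigma> t)"] True by auto
        ultimately show "(if tact (inv \<sigma> \<circ> \<pi> \<circ> \<sigma>) t = tact (inv \<sigma>) r then sgn' (inv \<sigma> \<circ> \<pi> \<circ> \<sigma>) else (0::'a)) = (if tact \<pi> T'.t = r then sgn' \<pi> else 0)"
          by (simp only: t' s)
      next
        fix \<pi> assume \<pi>: "\<pi> \<in> C"
        show "inv \<sigma> \<circ> (\<sigma> \<circ> \<pi> \<circ> inv \<sigma>) \<circ> \<sigma> = \<pi>" using permutes_inverses[OF \<sigma>] by (auto simp: fun_eq_iff)
        show "\<sigma> \<circ> \<pi> \<circ> inv \<sigma> \<in> T'.C" by (rule C2[OF \<pi>])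
      qed
      finally show ?thesis by (simp add: ract_def e_eval)
    next
      case False
      then show ?thesis using Mmod_length[OF T'.e_Mmod[where 'a = 'a] False] Mmod_length[OF ract_Mmod[OF \<sigma> e_Mmod[where 'a = 'a]] False]
        by (simp add: T'.e_def)
    qed
  qed
qed

text \<open>Two tableaux of the same shape differ by a permutation of the entries, so the module is
  generated by a single polytabloid.\<close>

lemma Specht_eq: "Specht lam = (fspan {ract \<sigma> e | \<sigma>. \<sigma> permutes {..<m}} :: (nat list \<Rightarrow> 'a::field) set)"
proof -
  have "{polytabloid lam T' | T'. bij_betw T' (cells lam) {..<sum_list lam}} = ({ract \<sigma> e | \<sigma>. \<sigma> permutes {..<m}} :: (nat list \<Rightarrow> 'a) set)"
  proof (intro set_eqI iffI)
    fix f :: "nat list \<Rightarrow> 'a" assume "f \<in> {polytabloid lam T' | T'. bij_betw T' (cells lam) {..<sum_list lam}}"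
    then obtain T' where f: "f = polytabloid lam T'" and b: "bij_betw T' (cells lam) {..<m}" by (auto simp: sum_lam)
    define \<sigma> where "\<sigma> k = (if k < m then T' (pos k) else k)" for k
    have "bij_betw pos {..<m} (cells lam)" unfolding pos_def using bij_betw_inv_into[OF bij] .
    then have "bij_betw (T' \<circ> pos) {..<m} {..<m}" using b by (rule bij_betw_trans)
    then have "bij_betw \<sigma> {..<m} {..<m}" by (rule bij_betw_cong[THEN iffD1, rotated]) (simp add: \<sigma>_def)
    then have s: "\<sigma> permutes {..<m}" by (rule bij_imp_permutes) (simp add: \<sigma>_def)
    have "T' c = \<sigma> (T c)" if "c \<in> cells lam" for c using that by (simp add: \<sigma>_def T_less pos_T)
    from transport[OF s this] show "f \<in> {ract \<sigma> e | \<sigma>. \<sigma> permutes {..<m}}" using f s by auto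
  next
    fix f :: "nat list \<Rightarrow> 'a" assume "f \<in> {ract \<sigma> e | \<sigma>. \<sigma> permutes {..<m}}"
    then obtain \<sigma> where f: "f = ract \<sigma> e" and s: "\<sigma> permutes {..<m}" by auto
    have "f = polytabloid lam (\<sigma> \<circ> T)" unfolding f by (rule transport[OF s, symmetric]) simp
    moreover have "bij_betw (\<sigma> \<circ> T) (cells lam) {..<m}" using bij permutes_imp_bij[OF s] by (rule bij_betw_trans)
    ultimately show "f \<in> {polytabloid lam T' | T'. bij_betw T' (cells lam) {..<sum_list lam}}" using sum_lam by blast
  qed
  then show ?thesis unfolding Specht_def by simp
qed

lemma ract_e_Specht: "\<sigma> permutes {..<m} \<Longrightarrow> ract \<sigma> e \<in> Specht lam"
  unfolding Specht_eq by (rule fspan_base) blast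

lemma e_Specht: "e \<in> Specht lam" using ract_e_Specht[OF permutes_id] by (simp add: ract_id)

lemma Specht_Mmod: "Specht lam \<subseteq> Mmod m lam"
  unfolding Specht_eq by (rule fspan_minimal[OF subsp_Mmod]) (auto intro: ract_Mmod e_Mmod)

lemma ract_Specht:
  assumes "\<sigma> permutes {..<m}" "f \<in> Specht lam"
  shows "ract \<sigma> f \<in> Specht lam"
proof -
  have "subsp {f. ract \<sigma> f \<in> Specht lam}" using subsp_fspan unfolding Specht_def
    by (auto simp: subsp_def ract_add ract_scale) (simp add: ract_def)
  moreover have "{ract \<tau> e | \<tau>. \<tau> permutes {..<m}} \<subseteq> {f. ract \<sigma> f \<in> Specht lam}"
    by (auto simp: ract_comp[OF assms(1) _ e_Mmod] intro!: ract_e_Specht permutes_compose assms(1))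
  ultimately show ?thesis using assms(2) fspan_minimal unfolding Specht_eq by blast
qed

section \<open>The pairing with a polytabloid and its nondegeneracy\<close>

text \<open>By \<open>bet_eq\<close> this is the standard bilinear pairing of \<open>f\<close> with
  the polytabloid \<open>e\<close>; by \<open>kap_eq\<close> it is also the scalar by which the
  antisymmetrized \<open>f\<close> is a multiple of \<open>e\<close>.\<close>

definition bet :: "(nat list \<Rightarrow> 'a::field) \<Rightarrow> 'a" where "bet f = kap f t"

lemma bet_eq: "bet f = (\<Sum>\<pi>\<in>C. sgn' \<pi> * f (tact \<pi> t))"
  unfolding bet_def kap_def
  by (rule sum.reindex_bij_witness[of _ inv inv])
    (auto simp: C_inv permutes_inv_inv[OF C_PS] sgn_inv[OF C_PS])

lemma kap_ract: "kap f r = (\<Sum>\<pi>\<in>C. sgn' \<pi> * ract \<pi> f r)"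
  by (simp add: kap_def ract_def)

lemma bet_lcomb: "bet (\<lambda>r. \<Sum>i\<in>I. c i * f i r) = (\<Sum>i\<in>I. c i * bet (f i))"
proof -
  have "bet (\<lambda>r. \<Sum>i\<in>I. c i * f i r) = (\<Sum>\<pi>\<in>C. \<Sum>i\<in>I. c i * (sgn' \<pi> * f i (tact \<pi> t)))"
    by (simp add: bet_eq sum_distrib_left mult_ac)
  then show ?thesis by (subst (asm) sum.swap) (simp add: bet_eq sum_distrib_left)
qed
lemma bet_sum: "bet (\<lambda>r. \<Sum>i\<in>I. f i r) = (\<Sum>i\<in>I. bet (f i))"
  using bet_lcomb[of "\<lambda>_. 1" f I] by simp

text \<open>The pairing of the \<open>\<sigma>\<close>-translate of \<open>e\<close> with
  \<open>e\<close>, kept as an integer so that its square is nonnegative whatever the field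
  is.\<close>

definition gram :: "(nat \<Rightarrow> nat) \<Rightarrow> int" where
  "gram \<sigma> = (\<Sum>\<pi>\<in>C. \<Sum>\<rho>\<in>C. if tact \<sigma> (tact \<rho> t) = tact \<pi> t then sign \<pi> * sign \<rho> else 0)"

lemma bet_ract_e:
  assumes "\<sigma> permutes {..<m}"
  shows "bet (ract \<sigma> e) = (of_int (gram \<sigma>) :: 'a::field)"
proof -
  have "tact \<rho> t = tact (inv \<sigma>) (tact \<pi> t) \<longleftrightarrow> tact \<sigma> (tact \<rho> t) = tact \<pi> t" for \<rho> \<pi>
    using tact_eq_iff[OF assms, of "tact \<rho> t" "tact \<pi> t"] by simp
  then show ?thesis
    by (simp add: bet_eq ract_def e_eval gram_def sum_distrib_left if_distrib[of "\<lambda>z. _ * z"] if_distrib[of of_int] cong: if_cong)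
qed

lemma gram_inv:
  assumes "\<sigma> permutes {..<m}"
  shows "gram (inv \<sigma>) = gram \<sigma>"
proof -
  have "tact (inv \<sigma>) (tact \<rho> t) = tact \<pi> t \<longleftrightarrow> tact \<sigma> (tact \<pi> t) = tact \<rho> t" for \<rho> \<pi>
    using tact_eq_iff[OF assms, of "tact \<pi> t" "tact \<rho> t"] by auto
  then show ?thesis unfolding gram_def by (subst sum.swap) (auto intro!: sum.cong)
qed

lemma bet_e: "bet e = (of_nat (card C) :: 'a::field)"
proof -
  have "bet e = (\<Sum>\<pi>\<in>C. 1 :: 'a)" unfolding bet_eq by (rule sum.cong[OF refl]) (simp only: e_tact sgn_sq)
  then show ?thesis by simp
qed

lemma card_C_pos: "card C > 0" using C_id finite_C by (auto simp: card_gt_0_iff)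

text \<open>An operator commuting with the group whose coefficients are pairings with translates of
  \<open>e\<close>: it vanishes on any vector orthogonal to all of these, yet acts on the Specht
  module by a scalar.\<close>

definition Zop :: "(nat list \<Rightarrow> 'a::field) \<Rightarrow> nat list \<Rightarrow> 'a" where
  "Zop v = (\<lambda>r. \<Sum>\<sigma>\<in>PS m. bet (ract (inv \<sigma>) v) * ract \<sigma> e r)"

lemma Zop_lcomb: "Zop (\<lambda>r. \<Sum>i\<in>I. c i * f i r) = (\<lambda>r. \<Sum>i\<in>I. c i * Zop (f i) r)"
proof
  fix r
  have "Zop (\<lambda>r. \<Sum>i\<in>I. c i * f i r) r = (\<Sum>\<sigma>\<in>PS m. \<Sum>i\<in>I. c i * (bet (ract (inv \<sigma>) (f i)) * ract \<sigma> e r))"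
    by (simp add: Zop_def ract_lcomb bet_lcomb sum_distrib_right mult.assoc)
  then show "Zop (\<lambda>r. \<Sum>i\<in>I. c i * f i r) r = (\<Sum>i\<in>I. c i * Zop (f i) r)"
    by (subst (asm) sum.swap) (simp add: Zop_def sum_distrib_left)
qed

lemma Zop_ract:
  assumes \<tau>: "\<tau> permutes {..<m}" and v: "v \<in> Mmod m lam"
  shows "Zop (ract \<tau> v) = ract \<tau> (Zop v)"
proof
  fix r
  have "ract \<tau> (Zop v) r = (\<Sum>\<sigma>\<in>PS m. bet (ract (inv \<sigma>) v) * ract \<tau> (ract \<sigma> e) r)"
    by (simp add: ract_def Zop_def)
  also have "\<dots> = (\<Sum>\<sigma>\<in>PS m. bet (ract (inv \<sigma>) (ract \<tau> v)) * ract \<sigma> e r)"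
  proof (rule sum.reindex_bij_witness[of _ "\<lambda>\<sigma>. inv \<tau> \<circ> \<sigma>" "\<lambda>\<sigma>. \<tau> \<circ> \<sigma>"])
    fix \<sigma> assume s: "\<sigma> \<in> PS m"
    show "inv \<tau> \<circ> (\<tau> \<circ> \<sigma>) = \<sigma>" "\<tau> \<circ> (inv \<tau> \<circ> \<sigma>) = \<sigma>" using permutes_cancel[OF \<tau>] by auto
    show "\<tau> \<circ> \<sigma> \<in> PS m" "inv \<tau> \<circ> \<sigma> \<in> PS m" using s \<tau> by (auto intro: permutes_compose permutes_inv)
    have "ract (inv (\<tau> \<circ> \<sigma>)) (ract \<tau> v) = ract (inv \<sigma>) v"
      using s ract_comp[OF permutes_inv[OF permutes_compose[OF _ \<tau>]] \<tau> v, of \<sigma>] permutes_cancel[OF \<tau>]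
      by (simp add: inv_comp_permutes[OF \<tau>])
    moreover have "ract \<tau> (ract \<sigma> e) = (ract (\<tau> \<circ> \<sigma>) e :: nat list \<Rightarrow> 'a)" using s by (intro ract_comp[OF \<tau> _ e_Mmod]) simp
    ultimately show "bet (ract (inv (\<tau> \<circ> \<sigma>)) (ract \<tau> v)) * ract (\<tau> \<circ> \<sigma>) e r = bet (ract (inv \<sigma>) v) * ract \<tau> (ract \<sigma> e) r"
      by simp
  qed
  finally show "Zop (ract \<tau> v) r = ract \<tau> (Zop v) r" by (simp add: Zop_def)
qed

lemma Zop_Mmod: "Zop v \<in> Mmod m lam"
  unfolding Zop_def by (rule subsp_lcomb[OF subsp_Mmod]) (auto intro: ract_Mmod e_Mmod)

text \<open>The scalar by which \<open>Zop\<close> acts on the Specht module is a positive multiple of a sum of squares of integers.\<close>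
lemma Zop_e: "\<exists>z. z \<noteq> 0 \<and> Zop e = (\<lambda>r. z * e r :: 'a::field_char_0)"
proof -
  let ?e = "e :: nat list \<Rightarrow> 'a"
  have ke: "kap ?e = (\<lambda>r. bet ?e * e r)" using kap_eq[OF e_Mmod] by (simp add: bet_def)
  \<comment> \<open>\<open>Zop\<close> commutes with the antisymmetrizer, for which \<open>e\<close>
    is an eigenvector; by \<open>kap_eq\<close> the image of \<open>e\<close> is then a multiple of
    \<open>e\<close>.\<close>
  have "kap (Zop ?e) r = bet ?e * Zop ?e r" for r
  proof -
    have "kap (Zop ?e) r = (\<Sum>\<pi>\<in>C. sgn' \<pi> * Zop (ract \<pi> ?e) r)"
      unfolding kap_ract by (rule sum.cong[OF refl]) (simp add: Zop_ract[OF C_PS e_Mmod])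
    also have "\<dots> = Zop (kap ?e) r"
      unfolding Zop_lcomb[symmetric, THEN fun_cong] by (rule arg_cong[of _ _ "\<lambda>f. Zop f r"]) (simp add: kap_ract fun_eq_iff)
    also have "\<dots> = bet ?e * Zop ?e r"
      unfolding ke using Zop_lcomb[of "\<lambda>_. bet ?e" "\<lambda>_. ?e" "{()}"] by simp
    finally show ?thesis .
  qed
  moreover have "kap (Zop ?e) r = bet (Zop ?e) * e r" for r
    using kap_eq[OF Zop_Mmod, of ?e] by (metis bet_def)
  ultimately have eq: "bet ?e * Zop ?e r = bet (Zop ?e) * e r" for r by metis
  have "bet (Zop ?e) = (\<Sum>\<sigma>\<in>PS m. bet (ract (inv \<sigma>) ?e) * bet (ract \<sigma> ?e))"
    unfolding Zop_def by (rule bet_lcomb)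
  also have "\<dots> = (\<Sum>\<sigma>\<in>PS m. of_int (gram \<sigma> * gram \<sigma>))"
    by (rule sum.cong[OF refl]) (simp add: bet_ract_e permutes_inv gram_inv)
  also have "\<dots> = of_int (\<Sum>\<sigma>\<in>PS m. gram \<sigma> * gram \<sigma>)" by simp
  finally have b: "bet (Zop ?e) = of_int (\<Sum>\<sigma>\<in>PS m. gram \<sigma> * gram \<sigma>)" .
  have g: "gram id = int (card C)"
    using bet_ract_e[OF permutes_id, where 'a = rat] bet_e[where 'a = rat] by (simp add: ract_id)
  \<comment> \<open>The identity contributes \<open>card C\<close> squared, which makes the sum of
    squares a positive integer.\<close>
  have "gram id * gram id \<le> (\<Sum>\<sigma>\<in>PS m. gram \<sigma> * gram \<sigma>)"
    by (rule member_le_sum) (auto simp: permutes_id[unfolded id_def] permutes_id finite_PS)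
  moreover have "0 < gram id * gram id" using g card_C_pos by simp
  ultimately have "(\<Sum>\<sigma>\<in>PS m. gram \<sigma> * gram \<sigma>) \<noteq> 0" by linarith
  then have nz: "bet (Zop ?e) \<noteq> 0" unfolding b of_int_eq_0_iff .
  have be: "bet ?e \<noteq> 0" using bet_e[where 'a = 'a] card_C_pos by simp
  show ?thesis
  proof (intro exI conjI ext)
    show "bet (Zop ?e) / bet ?e \<noteq> 0" using nz be by simp
    show "Zop e r = bet (Zop ?e) / bet ?e * e r" for r using eq[of r] be by (simp add: field_simps)
  qed
qed

text \<open>On the Specht module \<open>Zop\<close> is a nonzero scalar, and its coefficients at
  \<open>v\<close> are exactly the pairings assumed to vanish.\<close>

lemma Specht_nondegenerate:
  assumes v: "v \<in> Specht lam" and z: "\<And>\<sigma>. \<sigma> permutes {..<m} \<Longrightarrow> bet (ract \<sigma> v) = (0 :: 'a::field_char_0)"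
  shows "v = (\<lambda>r. 0)"
proof -
  obtain z where z: "z \<noteq> 0" "Zop e = (\<lambda>r. z * e r :: 'a)" using Zop_e by blast
  let ?X = "{v. Zop v = (\<lambda>r. z * v r)}"
  have "subsp ?X"
  proof (rule subspI)
    show "(\<lambda>x. 0) \<in> ?X" using Zop_lcomb[of "\<lambda>_. 0" "\<lambda>_ _. 0" "{}"] by simp
  next
    fix p q assume "p \<in> ?X" "q \<in> ?X"
    then have pq: "Zop p = (\<lambda>r. z * p r)" "Zop q = (\<lambda>r. z * q r)" by auto
    have "(\<lambda>r. \<Sum>b\<in>UNIV. 1 * (if b then p else q) r) = (\<lambda>r. p r + q r)" by (simp add: UNIV_bool add.commute)
    then have "Zop (\<lambda>r. p r + q r) = (\<lambda>r. z * p r + z * q r)"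
      using Zop_lcomb[of "\<lambda>_. 1" "\<lambda>b. if b then p else q" UNIV] pq by (simp add: UNIV_bool add.commute)
    then show "(\<lambda>x. p x + q x) \<in> ?X" by (simp add: distrib_left)
  next
    fix c p assume "p \<in> ?X"
    then show "(\<lambda>x. c * p x) \<in> ?X" using Zop_lcomb[of "\<lambda>_. c" "\<lambda>_. p" "{()}"] by (simp add: mult_ac)
  qed
  moreover have "{ract \<sigma> e | \<sigma>. \<sigma> permutes {..<m}} \<subseteq> ?X"
    by (auto simp: Zop_ract[OF _ e_Mmod] z ract_scale)
  ultimately have "Specht lam \<subseteq> ?X" unfolding Specht_eq by (rule fspan_minimal)
  then have "Zop v = (\<lambda>r. z * v r)" using v by blast
  moreover have "Zop v = (\<lambda>r. 0)" unfolding Zop_def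
    using assms(2) by (simp add: permutes_inv)
  ultimately show ?thesis using z(1) by (auto simp: fun_eq_iff)
qed

section \<open>Row stabilizer and Young symmetrizer\<close>

definition R :: "(nat \<Rightarrow> nat) set" where "R = {\<rho>. \<rho> permutes {..<m} \<and> tact \<rho> t = t}"

lemma finite_R: "finite R" by (rule finite_subset[OF _ finite_PS[of m]]) (auto simp: R_def)
lemma R_id: "id \<in> R" by (simp add: R_def permutes_id)
lemma R_PS: "\<rho> \<in> R \<Longrightarrow> \<rho> permutes {..<m}" by (simp add: R_def)
lemma R_inv: "\<rho> \<in> R \<Longrightarrow> inv \<rho> \<in> R"
  using tact_inverse(1)[of \<rho> m t] by (auto simp: R_def permutes_inv)

lemma sum_over_PS_eq:
  assumes \<pi>: "\<pi> \<in> C"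
  shows "(\<Sum>\<sigma>\<in>PS m. if tact \<pi> t = tact \<sigma> t then g \<sigma> else 0) = (\<Sum>\<rho>\<in>R. g (\<pi> \<circ> \<rho>))"
proof -
  note p = C_PS[OF \<pi>]
  have "(\<Sum>\<sigma>\<in>PS m. if tact \<pi> t = tact \<sigma> t then g \<sigma> else 0) = (\<Sum>\<sigma>\<in>{\<sigma> \<in> PS m. tact \<pi> t = tact \<sigma> t}. g \<sigma>)"
    by (rule sum.inter_filter[symmetric, OF finite_PS])
  also have "\<dots> = (\<Sum>\<rho>\<in>R. g (\<pi> \<circ> \<rho>))"
  proof (rule sum.reindex_bij_witness[of _ "\<lambda>\<rho>. \<pi> \<circ> \<rho>" "\<lambda>\<sigma>. inv \<pi> \<circ> \<sigma>"])
    fix \<sigma> assume s: "\<sigma> \<in> {\<sigma> \<in> PS m. tact \<pi> t = tact \<sigma> t}"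
    show "\<pi> \<circ> (inv \<pi> \<circ> \<sigma>) = \<sigma>" using permutes_cancel[OF p] by auto
    then show "g (\<pi> \<circ> (inv \<pi> \<circ> \<sigma>)) = g \<sigma>" by simp
    have "tact (inv \<pi> \<circ> \<sigma>) t = tact (inv \<pi>) (tact \<sigma> t)" using s by (intro tact_comp[OF permutes_inv[OF p] _ length_t, symmetric]) simp
    also have "\<dots> = t" using s tact_inverse(1)[OF p length_t] by auto
    finally show "inv \<pi> \<circ> \<sigma> \<in> R" using s p by (auto simp: R_def intro: permutes_compose permutes_inv)
  next
    fix \<rho> assume r: "\<rho> \<in> R"
    show "inv \<pi> \<circ> (\<pi> \<circ> \<rho>) = \<rho>" using permutes_cancel[OF p] by auto
    have "tact (\<pi> \<circ> \<rho>) t = tact \<pi> t" using tact_comp[OF p R_PS[OF r] length_t] r by (simp add: R_def)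
    then show "\<pi> \<circ> \<rho> \<in> {\<sigma> \<in> PS m. tact \<pi> t = tact \<sigma> t}" using p r by (auto simp: R_def intro: permutes_compose)
  qed
  finally show ?thesis .
qed

text \<open>By \<open>eop_split\<close> this is the Young symmetrizer: row sum first, then column
  antisymmetrizer. Using the values of \<open>e\<close> as coefficients makes it the image of
  \<open>e\<close> under the map \<open>th x\<close>.\<close>

definition eop :: "((nat \<Rightarrow> nat) \<Rightarrow> ('x \<Rightarrow> 'a::field) \<Rightarrow> 'x \<Rightarrow> 'a) \<Rightarrow> ('x \<Rightarrow> 'a) \<Rightarrow> 'x \<Rightarrow> 'a" where
  "eop act = gact (PS m) (\<lambda>\<sigma>. e (tact \<sigma> t)) (\<lambda>\<sigma>. \<sigma>) act"

lemma eop_split: "eop act x y = (\<Sum>\<pi>\<in>C. \<Sum>\<rho>\<in>R. sgn' \<pi> * (act (\<pi> \<circ> \<rho>) x y :: 'a::field))"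
proof -
  have "eop act x y = (\<Sum>\<sigma>\<in>PS m. \<Sum>\<pi>\<in>C. if tact \<pi> t = tact \<sigma> t then sgn' \<pi> * act \<sigma> x y else 0)"
    by (simp add: eop_def gact_def e_eval sum_distrib_right if_distrib[of "\<lambda>z. z * _"] cong: if_cong)
  also have "\<dots> = (\<Sum>\<pi>\<in>C. \<Sum>\<sigma>\<in>PS m. if tact \<pi> t = tact \<sigma> t then sgn' \<pi> * act \<sigma> x y else 0)" by (rule sum.swap)
  also have "\<dots> = (\<Sum>\<pi>\<in>C. \<Sum>\<rho>\<in>R. sgn' \<pi> * act (\<pi> \<circ> \<rho>) x y)"
    by (rule sum.cong[OF refl]) (rule sum_over_PS_eq)
  finally show ?thesis .
qed

definition Rsym :: "(nat list \<Rightarrow> 'a::field) \<Rightarrow> nat list \<Rightarrow> 'a" where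
  "Rsym f = (\<lambda>r. \<Sum>\<rho>\<in>R. ract \<rho> f r)"

lemma Rsym_Specht: "f \<in> Specht lam \<Longrightarrow> Rsym f \<in> Specht lam"
  unfolding Rsym_def by (rule subsp_sum) (auto simp: Specht_def subsp_fspan intro!: ract_Specht[unfolded Specht_def] R_PS)

lemma eop_ract:
  assumes "f \<in> Specht lam"
  shows "eop ract f = (\<lambda>r. bet (Rsym f) * e r :: 'a::field_char_0)"
proof
  fix r
  have fM: "f \<in> Mmod m lam" using assms Specht_Mmod by blast
  have "eop ract f r = (\<Sum>\<pi>\<in>C. sgn' \<pi> * ract \<pi> (Rsym f) r)"
    unfolding eop_split Rsym_def ract_sum sum_distrib_left
    by (intro sum.cong refl) (simp add: ract_comp[OF C_PS R_PS fM])
  also have "\<dots> = bet (Rsym f) * e r"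
    unfolding kap_ract[symmetric] bet_def using kap_eq[of "Rsym f"] Rsym_Specht[OF assms] Specht_Mmod by (metis subsetD)
  finally show "eop ract f r = bet (Rsym f) * e r" .
qed

text \<open>Otherwise the row sum of every translate of \<open>e\<close> is orthogonal to
  \<open>e\<close>. The pairing is symmetric and invariant, so the row sum moves to the other side:
  \<open>Rsym e\<close> is orthogonal to all translates of \<open>e\<close>, hence zero, although
  its value at \<open>t\<close> is \<open>card R\<close>.\<close>

lemma eop_ract_nonzero: "\<exists>f\<in>Specht lam. bet (Rsym f) \<noteq> (0 :: 'a::field_char_0)"
proof (rule ccontr)
  assume "\<not> ?thesis"
  then have z: "bet (Rsym f) = 0" if "f \<in> Specht lam" for f :: "nat list \<Rightarrow> 'a" using that by blast
  let ?e = "e :: nat list \<Rightarrow> 'a"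
  have "bet (ract (inv \<sigma>) (Rsym ?e)) = 0" if s: "\<sigma> permutes {..<m}" for \<sigma>
  proof -
    have 1: "bet (ract (inv \<sigma>) (ract \<rho> ?e)) = bet (ract (inv \<rho>) (ract \<sigma> ?e))" if "\<rho> \<in> R" for \<rho>
    proof -
      note p = R_PS[OF that]
      have "bet (ract (inv \<sigma>) (ract \<rho> ?e)) = of_int (gram (inv \<sigma> \<circ> \<rho>))"
        unfolding ract_comp[OF permutes_inv[OF s] p e_Mmod] by (rule bet_ract_e) (intro permutes_compose p permutes_inv s)
      also have "gram (inv \<sigma> \<circ> \<rho>) = gram (inv \<rho> \<circ> \<sigma>)"
        using gram_inv[OF permutes_compose[OF p permutes_inv[OF s]]]
        by (simp add: inv_comp_permutes[OF permutes_inv[OF s] p] permutes_inv_inv[OF s])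
      also have "of_int \<dots> = bet (ract (inv \<rho>) (ract \<sigma> ?e))"
        unfolding ract_comp[OF permutes_inv[OF p] s e_Mmod]
        by (rule bet_ract_e[symmetric]) (intro permutes_compose p permutes_inv s)
      finally show ?thesis .
    qed
    have "bet (ract (inv \<sigma>) (Rsym ?e)) = (\<Sum>\<rho>\<in>R. bet (ract (inv \<sigma>) (ract \<rho> ?e)))"
      unfolding Rsym_def ract_sum bet_sum ..
    also have "\<dots> = (\<Sum>\<rho>\<in>R. bet (ract (inv \<rho>) (ract \<sigma> ?e)))" by (rule sum.cong[OF refl]) (rule 1)
    also have "\<dots> = (\<Sum>\<rho>\<in>R. bet (ract \<rho> (ract \<sigma> ?e)))"
      by (rule sum.reindex_bij_witness[of _ inv inv]) (auto simp: R_inv permutes_inv_inv[OF R_PS])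
    also have "\<dots> = bet (Rsym (ract \<sigma> ?e))" unfolding Rsym_def bet_sum ..
    also have "\<dots> = 0" by (rule z[OF ract_e_Specht[OF s]])
    finally show ?thesis .
  qed
  then have "bet (ract \<sigma> (Rsym ?e)) = 0" if "\<sigma> permutes {..<m}" for \<sigma>
    using permutes_inv[OF that] permutes_inv_inv[OF that] by metis
  then have "Rsym ?e = (\<lambda>r. 0)" by (rule Specht_nondegenerate[OF Rsym_Specht[OF e_Specht]])
  moreover have "Rsym ?e t = (\<Sum>\<rho>\<in>R. 1)"
    unfolding Rsym_def by (rule sum.cong[OF refl]) (use R_inv in \<open>auto simp: ract_def e_t R_def\<close>)
  moreover have "card R > 0" using R_id finite_R by (auto simp: card_gt_0_iff)
  ultimately show False by simp
qed

text \<open>For a fixed vector \<open>x\<close> this is an equivariant map from functions on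
  tabloids to functions on words; it sends \<open>e\<close> to the Young symmetrization of
  \<open>x\<close>, and it is the source of the embeddings of Specht modules.\<close>

definition th :: "(nat list \<Rightarrow> 'a::field) \<Rightarrow> (nat list \<Rightarrow> 'a) \<Rightarrow> nat list \<Rightarrow> 'a" where
  "th x f = gact (PS m) (\<lambda>\<sigma>. f (tact \<sigma> t)) (\<lambda>\<sigma>. \<sigma>) wact x"

lemma th_e: "th x e = eop wact x" by (simp add: th_def eop_def)

lemma th_lcomb: "th x (\<lambda>r. \<Sum>i\<in>I. c i * f i r) = (\<lambda>w. \<Sum>i\<in>I. c i * th x (f i) w)"
proof
  fix w
  have "th x (\<lambda>r. \<Sum>i\<in>I. c i * f i r) w = (\<Sum>\<sigma>\<in>PS m. \<Sum>i\<in>I. c i * (f i (tact \<sigma> t) * wact \<sigma> x w))"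
    by (simp add: th_def gact_def sum_distrib_right mult.assoc)
  then show "th x (\<lambda>r. \<Sum>i\<in>I. c i * f i r) w = (\<Sum>i\<in>I. c i * th x (f i) w)"
    by (subst (asm) sum.swap) (simp add: th_def gact_def sum_distrib_left)
qed

lemma th_scale: "th x (\<lambda>r. c * f r) = (\<lambda>w. c * th x f w)"
  using th_lcomb[of x "\<lambda>_. c" "\<lambda>_. f" "{()}"] by simp
lemma th_add: "th x (\<lambda>r. f r + g r) = (\<lambda>w. th x f w + th x g w)"
  by (simp add: th_def gact_def distrib_right sum.distrib)

lemma th_ract:
  assumes \<tau>: "\<tau> permutes {..<m}"
  shows "th x (ract \<tau> f) = wact \<tau> (th x f)"
proof
  fix w
  have "wact \<tau> (th x f) w = (\<Sum>\<sigma>\<in>PS m. f (tact \<sigma> t) * wact \<sigma> x (map (inv \<tau>) w))"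
    by (simp add: th_def gact_def wact_def)
  also have "\<dots> = (\<Sum>\<sigma>\<in>PS m. ract \<tau> f (tact \<sigma> t) * wact \<sigma> x w)"
  proof (rule sum.reindex_bij_witness[of _ "\<lambda>\<sigma>. inv \<tau> \<circ> \<sigma>" "\<lambda>\<sigma>. \<tau> \<circ> \<sigma>"])
    fix \<sigma> assume s: "\<sigma> \<in> PS m"
    show "inv \<tau> \<circ> (\<tau> \<circ> \<sigma>) = \<sigma>" "\<tau> \<circ> (inv \<tau> \<circ> \<sigma>) = \<sigma>" using permutes_cancel[OF \<tau>] by auto
    show "\<tau> \<circ> \<sigma> \<in> PS m" "inv \<tau> \<circ> \<sigma> \<in> PS m" using s \<tau> by (auto intro: permutes_compose permutes_inv)
    have "tact (inv \<tau>) (tact (\<tau> \<circ> \<sigma>) t) = tact \<sigma> t"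
      using s tact_comp[OF \<tau> _ length_t, of \<sigma>] tact_inverse(1)[OF \<tau>, of "tact \<sigma> t"] by simp
    moreover have "inv (\<tau> \<circ> \<sigma>) = inv \<sigma> \<circ> inv \<tau>" using s by (intro inv_comp_permutes[OF \<tau>]) simp
    ultimately show "ract \<tau> f (tact (\<tau> \<circ> \<sigma>) t) * wact (\<tau> \<circ> \<sigma>) x w = f (tact \<sigma> t) * wact \<sigma> x (map (inv \<tau>) w)"
      by (simp add: ract_def wact_def)
  qed
  finally show "th x (ract \<tau> f) w = wact \<tau> (th x f) w" by (simp add: th_def gact_def)
qed

definition kapw :: "(nat list \<Rightarrow> 'a::field) \<Rightarrow> nat list \<Rightarrow> 'a" where
  "kapw y = (\<lambda>w. \<Sum>\<pi>\<in>C. sgn' \<pi> * wact \<pi> y w)"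

end

section \<open>Tableaux with a growing first row\<close>

lemma finite_cells: "finite (cells lam)"
proof -
  have "cells lam = (SIGMA i:{..<length lam}. {..<lam ! i})" by (auto simp: cells_def)
  then show ?thesis by simp
qed

lemma card_cells: "card (cells lam) = sum_list lam"
proof -
  have "cells lam = (SIGMA i:{..<length lam}. {..<lam ! i})" by (auto simp: cells_def)
  then show ?thesis by (simp add: sum_list_sum_nth atLeast0LessThan)
qed

lemma cells_Cons: "cells (a # mu) = Pair 0 ` {..<a} \<union> (\<lambda>(i, j). (Suc i, j)) ` cells mu"
proof (intro set_eqI iffI)
  fix c assume c: "c \<in> cells (a # mu)"
  obtain i j where ij: "c = (i, j)" by fastforce
  show "c \<in> Pair 0 ` {..<a} \<union> (\<lambda>(i, j). (Suc i, j)) ` cells mu"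
  proof (cases i)
    case 0 then show ?thesis using c ij by (auto simp: cells_def)
  next
    case (Suc i')
    then have "(i', j) \<in> cells mu" using c ij by (auto simp: cells_def)
    then show ?thesis using ij Suc by force
  qed
qed (auto simp: cells_def)

definition tail_tab :: "nat list \<Rightarrow> nat \<times> nat \<Rightarrow> nat" where
  "tail_tab mu = (SOME T. bij_betw T (cells mu) {..<sum_list mu})"

lemma tail_tab: "bij_betw (tail_tab mu) (cells mu) {..<sum_list mu}"
proof -
  have "\<exists>T. bij_betw T (cells mu) {..<sum_list mu}"
    by (rule finite_same_card_bij) (simp_all add: finite_cells card_cells)
  then show ?thesis unfolding tail_tab_def by (rule someI_ex)
qed

text \<open>The entries below the first row come first, so that the column group only moves
  the entries below twice \<open>sum_list mu\<close>, whatever the length of the first row.\<close>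
definition std_tab :: "nat list \<Rightarrow> nat \<times> nat \<Rightarrow> nat" where
  "std_tab mu = (\<lambda>(i, j). if i = 0 then sum_list mu + j else tail_tab mu (i - 1, j))"

text \<open>Together with \<open>std_row\<close> this gives the cell of an entry by formulas in
  which the length of the first row does not occur.\<close>

definition std_col :: "nat list \<Rightarrow> nat \<Rightarrow> nat" where
  "std_col mu k = (if k < sum_list mu then snd (inv_into (cells mu) (tail_tab mu) k) else k - sum_list mu)"

definition std_row :: "nat list \<Rightarrow> nat \<Rightarrow> nat" where
  "std_row mu k = (if k < sum_list mu then Suc (fst (inv_into (cells mu) (tail_tab mu) k)) else 0)"

text \<open>The tail only has columns with index below \<open>sum_list mu\<close>; the first-row
  entries in those columns run from \<open>sum_list mu\<close> to below twice that number, whence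
  the bound.\<close>

definition std_C :: "nat list \<Rightarrow> (nat \<Rightarrow> nat) set" where
  "std_C mu = {\<pi>. \<pi> permutes {..<2 * sum_list mu} \<and> (\<forall>k<2 * sum_list mu. std_col mu (\<pi> k) = std_col mu k)}"

definition std_R :: "nat list \<Rightarrow> (nat \<Rightarrow> nat) set" where
  "std_R mu = {\<rho>. \<rho> permutes {..<sum_list mu} \<and> (\<forall>k<sum_list mu. std_row mu (\<rho> k) = std_row mu k)}"

lemma bij_std_tab: "bij_betw (std_tab mu) (cells (a # mu)) {..<a + sum_list mu}"
proof -
  let ?b = "sum_list mu"
  have "bij_betw (std_tab mu) (Pair 0 ` {..<a} \<union> (\<lambda>(i, j). (Suc i, j)) ` cells mu) ({?b..<a + ?b} \<union> {..<?b})"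
  proof (rule bij_betw_combine)
    show "bij_betw (std_tab mu) (Pair 0 ` {..<a}) {?b..<a + ?b}"
      by (rule bij_betwI[of _ _ _ "\<lambda>k. (0, k - ?b)"]) (auto simp: std_tab_def)
    have "bij_betw (\<lambda>(i, j). (i - 1, j)) ((\<lambda>(i, j). (Suc i, j)) ` cells mu) (cells mu)"
      by (rule bij_betwI[of _ _ _ "\<lambda>(i, j). (Suc i, j)"]) auto
    then have "bij_betw (tail_tab mu \<circ> (\<lambda>(i, j). (i - 1, j))) ((\<lambda>(i, j). (Suc i, j)) ` cells mu) {..<?b}"
      by (rule bij_betw_trans[OF _ tail_tab])
    then show "bij_betw (std_tab mu) ((\<lambda>(i, j). (Suc i, j)) ` cells mu) {..<?b}"
      by (rule bij_betw_cong[THEN iffD1, rotated]) (auto simp: std_tab_def)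
  qed auto
  moreover have "{?b..<a + ?b} \<union> {..<?b} = {..<a + ?b}" by auto
  ultimately show ?thesis unfolding cells_Cons by simp
qed

locale std_tableau =
  fixes a :: nat and mu :: "nat list" and b :: nat
  assumes std_part: "is_partition (a + b) (a # mu)" and b: "b = sum_list mu" and ba: "b \<le> a"
begin

sublocale tableau "a # mu" "a + b" "std_tab mu"
  by unfold_locales (use std_part bij_std_tab b in auto)

lemma pos_std: "k < a + b \<Longrightarrow> pos k = (if k < b then (\<lambda>(i, j). (Suc i, j)) (inv_into (cells mu) (tail_tab mu) k) else (0, k - b))"
proof -
  assume k: "k < a + b"
  let ?p = "if k < b then (\<lambda>(i, j). (Suc i, j)) (inv_into (cells mu) (tail_tab mu) k) else (0, k - b)"
  have p: "?p \<in> cells (a # mu) \<and> std_tab mu ?p = k"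
  proof (cases "k < b")
    case True
    have im: "tail_tab mu ` cells mu = {..<b}" using tail_tab[of mu] by (simp add: bij_betw_def b)
    then have i: "inv_into (cells mu) (tail_tab mu) k \<in> cells mu" "tail_tab mu (inv_into (cells mu) (tail_tab mu) k) = k"
      using True by (auto intro: inv_into_into f_inv_into_f)
    then show ?thesis using True unfolding cells_Cons by (auto simp: std_tab_def split: prod.splits)
  next
    case False
    then show ?thesis using k by (auto simp: cells_def std_tab_def b)
  qed
  show ?thesis using pos_T[OF conjunct1[OF p]] unfolding conjunct2[OF p] .
qed

lemma col_std: "k < a + b \<Longrightarrow> col k = std_col mu k"
  by (simp add: col_def std_col_def pos_std b case_prod_unfold)

lemma row_std: "k < a + b \<Longrightarrow> row k = std_row mu k"
  by (simp add: row_def std_row_def pos_std b case_prod_unfold)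

lemma std_col_less: assumes "k < b" shows "std_col mu k < b"
proof -
  have im: "tail_tab mu ` cells mu = {..<b}" using tail_tab[of mu] by (simp add: bij_betw_def b)
  then have "inv_into (cells mu) (tail_tab mu) k \<in> cells mu" using assms by (auto intro: inv_into_into)
  then obtain i j where ij: "inv_into (cells mu) (tail_tab mu) k = (i, j)" "i < length mu" "j < mu ! i" by (auto simp: cells_def)
  have "mu ! i \<le> sum_list mu" using ij(2) by (simp add: elem_le_sum_list)
  then show ?thesis using ij assms by (simp add: std_col_def b)
qed

text \<open>An entry from \<open>2 * b\<close> on is alone in its column and must be fixed. The
  condition \<open>ba\<close> puts the numbers below \<open>2 * b\<close> among the entries,
  whatever \<open>a\<close> is.\<close>

lemma C_std: "C = std_C mu"
proof (intro set_eqI iffI)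
  fix \<pi> assume \<pi>: "\<pi> \<in> C"
  note p = C_PS[OF \<pi>]
  have colpi: "std_col mu (\<pi> k) = std_col mu k" if "k < a + b" for k
  proof -
    have "col (\<pi> k) = col k" using \<pi> that by (simp add: C_iff)
    moreover have "\<pi> k < a + b" using that permutes_in_image[OF p, of k] by simp
    ultimately show ?thesis using that by (simp only: col_std)
  qed
  have fx: "\<pi> k = k" if "k \<in> {..<a + b} - {..<2 * b}" for k
  proof -
    have k: "k < a + b" "2 * b \<le> k" using that by auto
    have e: "std_col mu (\<pi> k) = k - b" using colpi[OF k(1)] k by (simp add: std_col_def b[symmetric])
    then have "\<not> \<pi> k < b" using std_col_less[of "\<pi> k"] k by linarith
    then show ?thesis using e k by (simp add: std_col_def b[symmetric])
  qed
  have "\<pi> permutes {..<2 * b}" by (rule permutes_superset[OF p]) (use fx in auto)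
  then show "\<pi> \<in> std_C mu" using colpi ba by (auto simp: std_C_def b[symmetric])
next
  fix \<pi> assume \<pi>: "\<pi> \<in> std_C mu"
  then have p2: "\<pi> permutes {..<2 * b}" by (simp add: std_C_def b)
  then have p: "\<pi> permutes {..<a + b}" by (rule permutes_subset) (use ba in auto)
  have "col (\<pi> k) = col k" if "k < a + b" for k
  proof (cases "k < 2 * b")
    case True
    then show ?thesis using \<pi> that permutes_in_image[OF p, of k] by (auto simp: col_std std_C_def b[symmetric])
  next
    case False then show ?thesis using permutes_not_in[OF p2, of k] by simp
  qed
  then show "\<pi> \<in> C" using p by (simp add: C_iff)
qed

lemma R_iff: "\<rho> \<in> R \<longleftrightarrow> \<rho> permutes {..<a + b} \<and> (\<forall>k<a + b. std_row mu (\<rho> k) = std_row mu k)"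
proof -
  have "tact \<rho> t = t \<longleftrightarrow> (\<forall>k<a + b. std_row mu (\<rho> k) = std_row mu k)" if p: "\<rho> permutes {..<a + b}"
  proof
    assume e: "tact \<rho> t = t"
    show "\<forall>k<a + b. std_row mu (\<rho> k) = std_row mu k"
    proof (intro allI impI)
      fix k assume k: "k < a + b"
      then have pk: "\<rho> k < a + b" using permutes_in_image[OF p, of k] by simp
      have "t ! \<rho> k = tact \<rho> t ! \<rho> k" using e by simp
      also have "\<dots> = t ! k" using pk permutes_inverses(2)[OF p] by (simp add: tact_nth)
      finally show "std_row mu (\<rho> k) = std_row mu k" using pk k by (simp add: t_nth row_std)
    qed
  next
    assume e: "\<forall>k<a + b. std_row mu (\<rho> k) = std_row mu k"
    show "tact \<rho> t = t"
    proof (rule nth_equalityI)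
      fix k assume "k < length (tact \<rho> t)"
      then have k: "k < a + b" by simp
      then have ik: "inv \<rho> k < a + b" using permutes_in_image[OF permutes_inv[OF p], of k] by simp
      show "tact \<rho> t ! k = t ! k" using e[rule_format, OF ik] k ik permutes_inverses(1)[OF p]
        by (simp add: tact_nth t_nth row_std)
    qed simp
  qed
  then show ?thesis by (auto simp: R_def)
qed

text \<open>The row group is the product of the row group of the tail and the symmetric group of the
  first row; only the second factor grows with \<open>a\<close>.\<close>

lemma sum_R: "(\<Sum>\<rho>\<in>R. g \<rho>) = (\<Sum>\<rho>1\<in>std_R mu. \<Sum>\<rho>2\<in>{\<rho>. \<rho> permutes {b..<a + b}}. g (\<rho>1 \<circ> \<rho>2))"
proof -
  have zero: "std_row mu k = 0 \<longleftrightarrow> b \<le> k" for k by (simp add: std_row_def b not_less)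
  have "(\<Sum>\<rho>\<in>R. g \<rho>) = (\<Sum>(\<rho>1, \<rho>2)\<in>std_R mu \<times> {\<rho>. \<rho> permutes {b..<a + b}}. g (\<rho>1 \<circ> \<rho>2))"
  proof (rule sum.reindex_bij_witness[of _ "\<lambda>(\<rho>1, \<rho>2). \<rho>1 \<circ> \<rho>2"
        "\<lambda>\<rho>. (\<lambda>k. if k < b then \<rho> k else k, \<lambda>k. if k < b then k else \<rho> k)"])
    fix \<rho> assume \<rho>: "\<rho> \<in> R"
    then have p: "\<rho> permutes {..<a + b}" and r: "\<And>k. k < a + b \<Longrightarrow> std_row mu (\<rho> k) = std_row mu k" by (auto simp: R_iff)
    have lo: "\<rho> k < b \<longleftrightarrow> k < b" for k
      using r[of k] zero[of k] zero[of "\<rho> k"] permutes_not_in[OF p, of k] by (cases "k < a + b") auto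
    let ?p1 = "\<lambda>k. if k < b then \<rho> k else k" and ?p2 = "\<lambda>k. if k < b then k else \<rho> k"
    show "(case (?p1, ?p2) of (\<rho>1, \<rho>2) \<Rightarrow> \<rho>1 \<circ> \<rho>2) = \<rho>" using lo by (auto simp: fun_eq_iff)
    then show "(case (?p1, ?p2) of (\<rho>1, \<rho>2) \<Rightarrow> g (\<rho>1 \<circ> \<rho>2)) = g \<rho>" by simp
    have inj: "inj_on \<rho> X" for X using permutes_inj_on[OF p] .
    have "bij_betw \<rho> {..<b} {..<b}"
      unfolding bij_betw_def using inj endo_inj_surj[of "{..<b}" \<rho>] lo by auto
    then have "bij_betw ?p1 {..<b} {..<b}" by (rule bij_betw_cong[THEN iffD1, rotated]) simp
    then have 1: "?p1 permutes {..<b}" by (rule bij_imp_permutes) simp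
    have up: "\<rho> k \<in> {b..<a + b}" if "k \<in> {b..<a + b}" for k
      using that lo[of k] permutes_in_image[OF p, of k] by auto
    have "bij_betw \<rho> {b..<a + b} {b..<a + b}"
      unfolding bij_betw_def using inj endo_inj_surj[of "{b..<a + b}" \<rho>] up by blast
    then have "bij_betw ?p2 {b..<a + b} {b..<a + b}" by (rule bij_betw_cong[THEN iffD1, rotated]) simp
    then have 2: "?p2 permutes {b..<a + b}"
      by (rule bij_imp_permutes) (use permutes_not_in[OF p] in auto)
    show "(?p1, ?p2) \<in> std_R mu \<times> {\<rho>. \<rho> permutes {b..<a + b}}"
      using 1 2 r by (auto simp: std_R_def b[symmetric])
  next
    fix q assume "q \<in> std_R mu \<times> {\<rho>. \<rho> permutes {b..<a + b}}"
    then obtain \<rho>1 \<rho>2 where q: "q = (\<rho>1, \<rho>2)" and p1: "\<rho>1 permutes {..<b}" and r1: "\<And>k. k < b \<Longrightarrow> std_row mu (\<rho>1 k) = std_row mu k"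
       and p2: "\<rho>2 permutes {b..<a + b}" by (auto simp: std_R_def b[symmetric])
    have l1: "\<rho>1 k < b \<longleftrightarrow> k < b" for k using permutes_in_image[OF p1, of k] by simp
    have l2: "\<rho>2 k < b \<longleftrightarrow> k < b" for k
      using permutes_in_image[OF p2, of k] permutes_not_in[OF p2, of k] by (cases "k \<in> {b..<a + b}") auto
    have f1: "\<rho>1 k = k" if "\<not> k < b" for k using permutes_not_in[OF p1, of k] that by simp
    have f2: "\<rho>2 k = k" if "k < b" for k using permutes_not_in[OF p2, of k] that by simp
    have "(\<lambda>k. if k < b then (\<rho>1 \<circ> \<rho>2) k else k) = \<rho>1" "(\<lambda>k. if k < b then k else (\<rho>1 \<circ> \<rho>2) k) = \<rho>2"
      using l2 f1 f2 by (auto simp: fun_eq_iff)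
    then show "(\<lambda>k. if k < b then (case q of (\<rho>1, \<rho>2) \<Rightarrow> \<rho>1 \<circ> \<rho>2) k else k,
          \<lambda>k. if k < b then k else (case q of (\<rho>1, \<rho>2) \<Rightarrow> \<rho>1 \<circ> \<rho>2) k) = q" unfolding q prod.case by (simp only:)
    have "\<rho>1 \<circ> \<rho>2 permutes {..<a + b}"
      by (rule permutes_compose[OF permutes_subset[OF p2] permutes_subset[OF p1]]) auto
    moreover have "std_row mu (\<rho>1 (\<rho>2 k)) = std_row mu k" if "k < a + b" for k
    proof (cases "k < b")
      case True then show ?thesis using f2 r1 by simp
    next
      case False
      then have "\<not> \<rho>2 k < b" using l2 by simp
      then show ?thesis using f1[of "\<rho>2 k"] zero[of k] zero[of "\<rho>2 k"] False by simp
    qed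
    ultimately show "(case q of (\<rho>1, \<rho>2) \<Rightarrow> \<rho>1 \<circ> \<rho>2) \<in> R" by (simp add: q R_iff)
  qed
  then show ?thesis by (simp add: sum.cartesian_product)
qed

text \<open>The Young symmetrizer factors as a group algebra element depending on \<open>mu\<close>
  alone, applied after symmetrization over the first row. This is the form that
  \<open>stable_dim\<close> handles.\<close>

lemma eop_std:
  "eop wact x = gact (std_C mu \<times> std_R mu) (\<lambda>(\<pi>, \<rho>). of_int (sign \<pi>)) (\<lambda>(\<pi>, \<rho>). \<pi> \<circ> \<rho>) wact (psym {b..<a + b} wact (x :: nat list \<Rightarrow> 'a::field))"
proof
  fix w
  have comp: "wact (\<pi> \<circ> (\<rho>1 \<circ> \<rho>2)) x w = wact \<rho>2 x (map (inv (\<pi> \<circ> \<rho>1)) w)"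
    if "\<pi> \<in> std_C mu" "\<rho>1 \<in> std_R mu" "\<rho>2 permutes {b..<a + b}" for \<pi> \<rho>1 \<rho>2
  proof -
    have p: "\<pi> permutes {..<a + b}" using that(1) C_std C_PS by blast
    have p1: "\<rho>1 permutes {..<a + b}" by (rule permutes_subset[of _ "{..<b}"]) (use that(2) in \<open>auto simp: std_R_def b\<close>)
    have p2: "\<rho>2 permutes {..<a + b}" by (rule permutes_subset[OF that(3)]) auto
    have "inv (\<pi> \<circ> (\<rho>1 \<circ> \<rho>2)) = inv \<rho>2 \<circ> inv (\<pi> \<circ> \<rho>1)"
      using inv_comp_permutes[OF permutes_compose[OF p1 p] p2] by (simp add: o_assoc)
    then show ?thesis by (simp add: wact_def)
  qed
  have "eop wact x w = (\<Sum>\<pi>\<in>std_C mu. \<Sum>\<rho>1\<in>std_R mu. \<Sum>\<rho>2\<in>{\<rho>. \<rho> permutes {b..<a + b}}. of_int (sign \<pi>) * wact (\<pi> \<circ> (\<rho>1 \<circ> \<rho>2)) x w)"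
    unfolding eop_split sum_R C_std ..
  also have "\<dots> = (\<Sum>\<pi>\<in>std_C mu. \<Sum>\<rho>1\<in>std_R mu. \<Sum>\<rho>2\<in>{\<rho>. \<rho> permutes {b..<a + b}}. of_int (sign \<pi>) * wact \<rho>2 x (map (inv (\<pi> \<circ> \<rho>1)) w))"
    by (intro sum.cong refl) (simp add: comp)
  also have "\<dots> = gact (std_C mu \<times> std_R mu) (\<lambda>(\<pi>, \<rho>). of_int (sign \<pi>)) (\<lambda>(\<pi>, \<rho>). \<pi> \<circ> \<rho>) wact (psym {b..<a + b} wact x) w"
    unfolding sum.cartesian_product[of _ "std_R mu"] gact_def psym_def wact_def
    by (rule sum.cong[OF refl]) (auto simp: sum_distrib_left)
  finally show "eop wact x w = gact (std_C mu \<times> std_R mu) (\<lambda>(\<pi>, \<rho>). of_int (sign \<pi>)) (\<lambda>(\<pi>, \<rho>). \<pi> \<circ> \<rho>) wact (psym {b..<a + b} wact x) w" .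
qed

end

section \<open>Lengthening the first row of a tabloid\<close>

definition ext :: "nat \<Rightarrow> nat \<Rightarrow> (nat list \<Rightarrow> 'a::zero) \<Rightarrow> nat list \<Rightarrow> 'a" where
  "ext M s f = (\<lambda>r. if length r = M + s \<and> drop M r = replicate s 0 then f (take M r) else 0)"

text \<open>The new entries fill the cells of the first row from column \<open>a\<close> on. Every
  other row has length at most \<open>a\<close>, so each of them is alone in its column and the
  column group does not change.\<close>

lemma ext_polytabloid:
  assumes part: "is_partition M (a # mu)" and T: "bij_betw T (cells (a # mu)) {..<M}"
  shows "\<exists>T'. bij_betw T' (cells (shiftp s (a # mu))) {..<M + s} \<and>
     ext M s (polytabloid (a # mu) T) = (polytabloid (shiftp s (a # mu)) T' :: nat list \<Rightarrow> 'a::field)"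
proof -
  define T' where "T' = (\<lambda>(i, j). if i = 0 \<and> a \<le> j then M + (j - a) else T (i, j))"
  interpret A: tableau "a # mu" M T by unfold_locales (rule part, rule T)
  have cl: "cells ((a + s) # mu) = cells (a # mu) \<union> Pair 0 ` {a..<a + s}"
  proof (intro set_eqI iffI)
    fix c assume c: "c \<in> cells ((a + s) # mu)"
    obtain i j where ij: "c = (i, j)" by fastforce
    show "c \<in> cells (a # mu) \<union> Pair 0 ` {a..<a + s}"
      using c ij by (cases i; cases "j < a") (auto simp: cells_def)
  next
    fix c assume "c \<in> cells (a # mu) \<union> Pair 0 ` {a..<a + s}"
    moreover obtain i j where "c = (i, j)" by fastforce
    ultimately show "c \<in> cells ((a + s) # mu)" by (cases i) (auto simp: cells_def)
  qed
  have bij': "bij_betw T' (cells ((a + s) # mu)) {..<M + s}"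
  proof -
    have "bij_betw T' (cells (a # mu) \<union> Pair 0 ` {a..<a + s}) ({..<M} \<union> {M..<M + s})"
    proof (rule bij_betw_combine)
      show "bij_betw T' (cells (a # mu)) {..<M}" using T
        by (rule bij_betw_cong[THEN iffD1, rotated]) (auto simp: T'_def cells_def)
      show "bij_betw T' (Pair 0 ` {a..<a + s}) {M..<M + s}"
      proof (rule bij_betwI[of _ _ _ "\<lambda>k. (0, a + (k - M))"])
        show "(\<lambda>k. (0, a + (k - M))) \<in> {M..<M + s} \<rightarrow> Pair 0 ` {a..<a + s}" by (intro funcsetI imageI) auto
      qed (auto simp: T'_def)
    qed auto
    moreover have "{..<M} \<union> {M..<M + s} = {..<M + s}" by auto
    ultimately show ?thesis unfolding cl by simp
  qed
  have part': "is_partition (M + s) ((a + s) # mu)" using part by (auto simp: is_partition_def)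
  interpret B: tableau "(a + s) # mu" "M + s" T' by unfold_locales (rule part', rule bij')
  have posl: "B.pos k = A.pos k" if "k < M" for k
  proof -
    have c: "A.pos k \<in> cells (a # mu)" using A.pos_cells[OF that] .
    then have "T' (A.pos k) = k" using A.T_pos[OF that] by (auto simp: T'_def cells_def split: prod.splits)
    moreover have "A.pos k \<in> cells ((a + s) # mu)" using c cl by blast
    ultimately show ?thesis using B.pos_T by metis
  qed
  have posh: "B.pos k = (0, a + (k - M))" if "M \<le> k" "k < M + s" for k
  proof -
    have "T' (0, a + (k - M)) = k" "(0, a + (k - M)) \<in> cells ((a + s) # mu)" using that by (auto simp: T'_def cells_def)
    then show ?thesis using B.pos_T by metis
  qed
  have cola: "A.col k < a" if "k < M" for k
  proof -
    have "A.col k < (a # mu) ! A.row k" using A.row_less[OF that] by simp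
    also have "\<dots> \<le> (a # mu) ! 0" by (rule A.lam_mono) (use A.row_less[OF that] in auto)
    finally show ?thesis by simp
  qed
  have t': "B.t = A.t @ replicate s 0"
  proof (rule nth_equalityI)
    fix k assume "k < length B.t"
    then show "B.t ! k = (A.t @ replicate s 0) ! k"
      by (cases "k < M") (auto simp: B.t_nth A.t_nth B.row_def A.row_def posl posh nth_append)
  qed simp
  have C': "B.C = A.C"
  proof (intro set_eqI iffI)
    fix \<pi> assume \<pi>: "\<pi> \<in> B.C"
    note p = B.C_PS[OF \<pi>]
    have colB: "B.col k = (if k < M then A.col k else a + (k - M))" if "k < M + s" for k
      using that by (simp add: B.col_def A.col_def posl posh)
    have fx: "\<pi> k = k" if "k \<in> {..<M + s} - {..<M}" for k
    proof -
      have pk: "\<pi> k < M + s" using permutes_in_image[OF p, of k] that by simp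
      have "B.col (\<pi> k) = B.col k" using \<pi> that by (simp add: B.C_iff)
      then show ?thesis using colB[OF pk] colB[of k] cola[of "\<pi> k"] that by (auto split: if_splits)
    qed
    have p': "\<pi> permutes {..<M}" by (rule permutes_superset[OF p]) (use fx in auto)
    moreover have "A.col (\<pi> k) = A.col k" if "k < M" for k
      using \<pi> that permutes_in_image[OF p', of k] colB[of k] colB[of "\<pi> k"] by (simp add: B.C_iff)
    ultimately show "\<pi> \<in> A.C" by (simp add: A.C_iff)
  next
    fix \<pi> assume \<pi>: "\<pi> \<in> A.C"
    note p = A.C_PS[OF \<pi>]
    have "B.col (\<pi> k) = B.col k" if "k < M + s" for k
    proof (cases "k < M")
      case True
      then show ?thesis using \<pi> permutes_in_image[OF p, of k] by (simp add: A.C_iff B.col_def A.col_def posl)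
    next
      case False then show ?thesis using permutes_not_in[OF p, of k] by simp
    qed
    moreover have "\<pi> permutes {..<M + s}" by (rule permutes_subset[OF p]) auto
    ultimately show "\<pi> \<in> B.C" by (simp add: B.C_iff)
  qed
  have ta: "tact \<pi> (A.t @ replicate s 0) = tact \<pi> A.t @ replicate s 0" if "\<pi> \<in> A.C" for \<pi>
  proof (rule nth_equalityI)
    note p = permutes_inv[OF A.C_PS[OF that]]
    fix k assume k: "k < length (tact \<pi> (A.t @ replicate s 0))"
    show "tact \<pi> (A.t @ replicate s 0) ! k = (tact \<pi> A.t @ replicate s 0) ! k"
      using k permutes_in_image[OF p, of k] permutes_not_in[OF p, of k]
      by (cases "k < M") (auto simp: tact_nth nth_append)
  qed simp
  have "ext M s A.e r = (B.e r :: 'a)" for r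
  proof (cases "length r = M + s \<and> drop M r = replicate s 0")
    case True
    have "tact \<pi> A.t @ replicate s 0 = r \<longleftrightarrow> tact \<pi> A.t = take M r" for \<pi>
    proof -
      have "r = take M r @ replicate s 0" using True append_take_drop_id[of M r] by simp
      then show ?thesis using True by (metis append_same_eq)
    qed
    then have "B.e r = (\<Sum>\<pi>\<in>A.C. if tact \<pi> A.t = take M r then of_int (sign \<pi>) else (0::'a))"
      unfolding B.e_eval C' t' by (intro sum.cong refl) (simp add: ta)
    then show ?thesis using True by (simp add: ext_def A.e_eval)
  next
    case False
    have "tact \<pi> A.t @ replicate s 0 \<noteq> r" for \<pi> using False by auto
    then have "B.e r = (0::'a)" unfolding B.e_eval C' t' by (intro sum.neutral ballI) (simp add: ta)
    then show ?thesis using False by (auto simp: ext_def)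
  qed
  then have "ext M s (polytabloid (a # mu) T) = (polytabloid (shiftp s (a # mu)) T' :: nat list \<Rightarrow> 'a)"
    by (simp add: A.e_def B.e_def fun_eq_iff)
  then show ?thesis using bij' by auto
qed

lemma ext_Specht:
  assumes part: "is_partition M (a # mu)" and f: "f \<in> Specht (a # mu)"
  shows "ext M s f \<in> (Specht (shiftp s (a # mu)) :: (nat list \<Rightarrow> 'a::field) set)"
proof -
  have sm: "sum_list (a # mu) = M" "sum_list (shiftp s (a # mu)) = M + s" using part by (auto simp: is_partition_def)
  have "subsp {f. ext M s f \<in> (Specht (shiftp s (a # mu)) :: (nat list \<Rightarrow> 'a) set)}"
  proof -
    have e: "ext M s (\<lambda>r. f r + g r) = (\<lambda>r. ext M s f r + ext M s g r)" "ext M s (\<lambda>r. c * f r) = (\<lambda>r. c * ext M s f r)"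
       "ext M s (\<lambda>r. 0) = (\<lambda>r. 0)" for f g :: "nat list \<Rightarrow> 'a" and c by (auto simp: ext_def)
    have "subsp (Specht (shiftp s (a # mu)) :: (nat list \<Rightarrow> 'a) set)" unfolding Specht_def by (rule subsp_fspan)
    then show ?thesis unfolding subsp_def by (simp add: e)
  qed
  moreover have "{polytabloid (a # mu) T | T. bij_betw T (cells (a # mu)) {..<sum_list (a # mu)}} \<subseteq>
      {f. ext M s f \<in> (Specht (shiftp s (a # mu)) :: (nat list \<Rightarrow> 'a) set)}"
  proof
    fix g :: "nat list \<Rightarrow> 'a" assume "g \<in> {polytabloid (a # mu) T | T. bij_betw T (cells (a # mu)) {..<sum_list (a # mu)}}"
    then obtain T where g: "g = polytabloid (a # mu) T" and T: "bij_betw T (cells (a # mu)) {..<M}" using sm by auto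
    from ext_polytabloid[OF part T, of s, where 'a = 'a] obtain T' where
      T': "bij_betw T' (cells (shiftp s (a # mu))) {..<M + s}" "ext M s (polytabloid (a # mu) T) = (polytabloid (shiftp s (a # mu)) T' :: nat list \<Rightarrow> 'a)"
      by (elim exE conjE) (rule that)
    have "ext M s g \<in> {polytabloid (shiftp s (a # mu)) T | T. bij_betw T (cells (shiftp s (a # mu))) {..<sum_list (shiftp s (a # mu))}}"
      unfolding sm g by (intro CollectI exI[of _ T'] conjI T')
    then have "ext M s g \<in> Specht (shiftp s (a # mu))" unfolding Specht_def by (rule fspan_base)
    then show "g \<in> {f. ext M s f \<in> (Specht (shiftp s (a # mu)) :: (nat list \<Rightarrow> 'a) set)}" by simp
  qed
  ultimately have "Specht (a # mu) \<subseteq> {f. ext M s f \<in> (Specht (shiftp s (a # mu)) :: (nat list \<Rightarrow> 'a) set)}"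
    unfolding Specht_def[of "a # mu"] by (rule fspan_minimal)
  then show ?thesis using f by blast
qed

section \<open>Embedding sums of Specht modules\<close>

lemma tableau_std:
  assumes "is_partition m (a # mu)"
  shows "tableau (a # mu) m (std_tab mu)"
proof -
  have "a + sum_list mu = m" using assms by (simp add: is_partition_def)
  then show ?thesis using bij_std_tab[of mu a] assms by unfold_locales auto
qed

lemma eop_std_partition:
  fixes x :: "nat list \<Rightarrow> 'a::field"
  assumes "is_partition m (a # mu)" "sum_list mu \<le> a"
  shows "tableau.eop (a # mu) m (std_tab mu) wact x =
    gact (std_C mu \<times> std_R mu) (\<lambda>(\<pi>, \<rho>). of_int (sign \<pi>)) (\<lambda>(\<pi>, \<rho>). \<pi> \<circ> \<rho>) wact (psym {sum_list mu..<m} wact x)"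
proof -
  have m: "a + sum_list mu = m" using assms by (simp add: is_partition_def)
  interpret S: std_tableau a mu "sum_list mu" by unfold_locales (use assms m in auto)
  show ?thesis using S.eop_std[of x] unfolding m .
qed

lemma wact_comp: "\<sigma> permutes S \<Longrightarrow> \<tau> permutes S \<Longrightarrow> wact \<sigma> (wact \<tau> f) = wact (\<sigma> \<circ> \<tau>) f"
  by (simp add: wact_def inv_comp_permutes)

lemma wact_inv: "\<sigma> permutes S \<Longrightarrow> wact \<sigma> (wact (inv \<sigma>) f) = f" "\<sigma> permutes S \<Longrightarrow> wact (inv \<sigma>) (wact \<sigma> f) = f"
  using wact_comp[of \<sigma> S "inv \<sigma>" f] wact_comp[of "inv \<sigma>" S \<sigma> f] permutes_inv[of \<sigma> S] permutes_inv_o[of \<sigma> S]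
  by (auto simp: wact_def)

lemma wact_gen:
  assumes \<sigma>: "\<sigma> permutes S"
  shows "wact \<sigma> (gen u A v) = (gen (map \<sigma> u) (map \<sigma> ` A) (map \<sigma> v) :: nat list \<Rightarrow> 'a::field)"
proof
  fix w
  have inj: "inj (map \<sigma>)" using permutes_inj[OF \<sigma>] by (simp add: inj_mapI)
  then have injA: "inj_on (map \<sigma>) A" by (rule inj_on_subset) simp
  have ij: "inj_on (map (map \<sigma>)) (permutations_of_set A)"
    by (rule inj_on_subset[of _ UNIV]) (simp_all add: inj_mapI permutes_inj[OF \<sigma>])
  have eq: "map (inv \<sigma>) w = x \<longleftrightarrow> w = map \<sigma> x" for x
    using permutes_inverses[OF \<sigma>] by (auto simp: comp_def)
  have "(gen (map \<sigma> u) (map \<sigma> ` A) (map \<sigma> v) w :: 'a) = (\<Sum>ws\<in>permutations_of_set A. wmono (map \<sigma> u @ concat (map (map \<sigma>) ws) @ map \<sigma> v) w)"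
    unfolding gen_def permutations_of_set_image_inj[OF injA] sum.reindex[OF ij] by simp
  also have "\<dots> = (\<Sum>ws\<in>permutations_of_set A. wmono (u @ concat ws @ v) (map (inv \<sigma>) w))"
    unfolding wmono_def eq by (simp add: map_concat)
  finally show "wact \<sigma> (gen u A v) w = (gen (map \<sigma> u) (map \<sigma> ` A) (map \<sigma> v) w :: 'a)"
    by (simp add: wact_def gen_def)
qed

lemma gidx_wact:
  assumes \<sigma>: "\<sigma> permutes {..<m}" and g: "(u, A, v) \<in> gidx n m"
  shows "(map \<sigma> u, map \<sigma> ` A, map \<sigma> v) \<in> gidx n m"
proof -
  have A: "finite A" "card A = n" "[] \<notin> A" "\<And>ws. ws \<in> permutations_of_set A \<Longrightarrow> mlw m (u @ concat ws @ v)"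
    using g by (auto simp: gidx_def)
  have injA: "inj_on (map \<sigma>) A" by (rule inj_on_subset[OF inj_mapI[OF permutes_inj[OF \<sigma>]]]) simp
  have "mlw m (map \<sigma> u @ concat ws @ map \<sigma> v)" if wsA: "ws \<in> permutations_of_set (map \<sigma> ` A)" for ws
  proof -
    obtain ws' where ws': "ws' \<in> permutations_of_set A" "ws = map (map \<sigma>) ws'"
      using wsA unfolding permutations_of_set_image_inj[OF injA] by blast
    have "map \<sigma> u @ concat ws @ map \<sigma> v = map \<sigma> (u @ concat ws' @ v)" by (simp add: ws' map_concat)
    then show ?thesis using permutes_mlw[OF \<sigma>] A(4)[OF ws'(1)] by metis
  qed
  then show ?thesis using A card_image[OF injA] by (auto simp: gidx_def)
qed

lemma wact_add: "wact \<sigma> (\<lambda>w. f w + g w) = (\<lambda>w. wact \<sigma> f w + wact \<sigma> g w)" by (simp add: wact_def)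
lemma wact_scale: "wact \<sigma> (\<lambda>w. c * f w) = (\<lambda>w. c * wact \<sigma> f w)" by (simp add: wact_def)
lemma wact_zero: "wact \<sigma> (\<lambda>w. 0) = (\<lambda>w. 0)" by (simp add: wact_def)

lemma subsp_Wnm: "0 < n \<Longrightarrow> subsp (Wnm n m)"
  by (simp add: Wnm_eq_fspan subsp_fspan)

lemma wact_Wnm:
  assumes n: "0 < n" and \<sigma>: "\<sigma> permutes {..<m}" and f: "f \<in> Wnm n m"
  shows "wact \<sigma> f \<in> (Wnm n m :: (nat list \<Rightarrow> 'a::field) set)"
proof -
  have "subsp {f. wact \<sigma> f \<in> (Wnm n m :: (nat list \<Rightarrow> 'a) set)}"
    using subsp_Wnm[OF n, of m, where 'a = 'a] unfolding subsp_def by (simp add: wact_add wact_scale wact_zero)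
  moreover have "gens n m \<subseteq> {f. wact \<sigma> f \<in> (Wnm n m :: (nat list \<Rightarrow> 'a) set)}"
  proof
    fix g :: "nat list \<Rightarrow> 'a" assume "g \<in> gens n m"
    then obtain u A v where g: "g = gen u A v" "(u, A, v) \<in> gidx n m" by (auto simp: gens_def)
    have "wact \<sigma> g \<in> gens n m" unfolding g wact_gen[OF \<sigma>] gens_def using gidx_wact[OF \<sigma> g(2)] by blast
    then show "g \<in> {f. wact \<sigma> f \<in> Wnm n m}" using gens_subset_Wnm[OF n] by blast
  qed
  ultimately show ?thesis using f fspan_minimal unfolding Wnm_eq_fspan[OF n] by blast
qed

lemma gact_closed:
  assumes "subsp V" "\<And>i. i \<in> I \<Longrightarrow> act (\<tau> i) v \<in> V"
  shows "gact I c \<tau> act v \<in> V"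
  unfolding gact_def by (rule subsp_lcomb[OF assms])

section \<open>One-letter words and the length of the first row\<close>

definition singles :: "nat list set \<Rightarrow> nat set" where "singles A = {z. [z] \<in> A}"

lemma singles_card:
  assumes "(u, A, v) \<in> gidx n (n + K)"
  shows "n - K \<le> card (singles A)" "singles A \<subseteq> {..<n + K}"
proof -
  have A: "finite A" "card A = n" using assms by (auto simp: gidx_def)
  have "bij_betw (\<lambda>z. [z]) (singles A) {x \<in> A. length x = 1}"
    by (rule bij_betwI[of _ _ _ hd]) (auto simp: singles_def length_Suc_conv)
  then have "card (singles A) = card {x \<in> A. length x = 1}" by (rule bij_betw_same_card)
  moreover have "card A = card {x \<in> A. length x = 1} + card {x \<in> A. length x \<noteq> 1}"
  proof -
    have "A = {x \<in> A. length x = 1} \<union> {x \<in> A. length x \<noteq> 1}" by auto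
    then have "card A = card ({x \<in> A. length x = 1} \<union> {x \<in> A. length x \<noteq> 1})" by simp
    also have "\<dots> = card {x \<in> A. length x = 1} + card {x \<in> A. length x \<noteq> 1}"
      by (rule card_Un_disjoint) (use A in auto)
    finally show ?thesis .
  qed
  ultimately show "n - K \<le> card (singles A)" using card_long_words[OF assms] A by simp
  obtain ws where ws: "ws \<in> permutations_of_set A" using permutations_of_set_empty_iff[of A] A by blast
  then have "mlw (n + K) (u @ concat ws @ v)" using assms by (simp add: gidx_def)
  moreover have "z \<in> set (concat ws)" if "z \<in> singles A" for z
    using that ws by (force simp: singles_def permutations_of_set_def)
  ultimately show "singles A \<subseteq> {..<n + K}" unfolding mlw_def by auto
qed

text \<open>Letters of one-letter words occur nowhere else in a multilinear product, so permuting
  them permutes the set \<open>A\<close> and fixes both outer words.\<close>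

lemma gen_invariant:
  assumes g: "(u, A, v) \<in> gidx n m" and \<pi>: "\<pi> permutes S" and S: "S \<subseteq> singles A"
  shows "wact \<pi> (gen u A v) = gen u A v"
proof -
  have A: "finite A" using g by (auto simp: gidx_def)
  obtain ws where ws: "ws \<in> permutations_of_set A" using permutations_of_set_empty_iff[of A] A by blast
  then have ml: "distinct (u @ concat ws @ v)" using g by (auto simp: gidx_def mlw_def)
  have sw: "set ws = A" using ws by (simp add: permutations_of_set_def)
  have zc: "z \<in> set (concat ws)" if "z \<in> S" for z
    using that S sw by (force simp: singles_def)
  have fix1: "map \<pi> x = x" if "set x \<inter> S = {}" for x
    using permutes_not_in[OF \<pi>] that by (intro map_idI) auto
  have "set u \<inter> S = {}" "set v \<inter> S = {}" using zc ml by auto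
  then have uv: "map \<pi> u = u" "map \<pi> v = v" using fix1 by auto
  have word: "x = [z]" if "x \<in> A" "z \<in> set x" "z \<in> S" for x z
  proof (rule ccontr)
    assume ne: "x \<noteq> [z]"
    have "[z] \<in> set ws" "x \<in> set ws" using that S sw by (auto simp: singles_def)
    moreover have "distinct (concat ws)" using ml by simp
    ultimately have "set x \<inter> set [z] = {}" using ne unfolding distinct_concat_iff by blast
    then show False using that by simp
  qed
  have sub: "map \<pi>' ` A \<subseteq> A" if p: "\<pi>' permutes S" for \<pi>'
  proof
    fix y assume "y \<in> map \<pi>' ` A"
    then obtain x where x: "x \<in> A" "y = map \<pi>' x" by auto
    show "y \<in> A"
    proof (cases "set x \<inter> S = {}")
      case True
      then have "map \<pi>' x = x" using permutes_not_in[OF p] by (intro map_idI) auto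
      then show ?thesis using x by simp
    next
      case False
      then obtain z where z: "z \<in> set x" "z \<in> S" by auto
      then have "x = [z]" using word x by blast
      moreover have "\<pi>' z \<in> S" using permutes_in_image[OF p] z by simp
      ultimately show ?thesis using x S by (auto simp: singles_def)
    qed
  qed
  have "map \<pi> ` A = A"
    by (rule endo_inj_surj[OF A sub[OF \<pi>]]) (simp add: inj_on_subset[OF inj_mapI[OF permutes_inj[OF \<pi>]]])
  then show ?thesis unfolding wact_gen[OF \<pi>] using uv by simp
qed

context tableau
begin

lemma kapw_wact:
  assumes \<tau>: "\<tau> \<in> C"
  shows "kapw (wact \<tau> y) = (\<lambda>w. sgn' \<tau> * kapw y w)"
proof
  fix w
  have "kapw (wact \<tau> y) w = (\<Sum>\<pi>\<in>C. sgn' \<pi> * wact (\<pi> \<circ> \<tau>) y w)"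
    unfolding kapw_def by (rule sum.cong[OF refl]) (simp add: wact_comp[OF C_PS C_PS[OF \<tau>]])
  also have "\<dots> = (\<Sum>\<pi>\<in>C. sgn' (\<pi> \<circ> inv \<tau>) * wact \<pi> y w)"
  proof (rule sum.reindex_bij_witness[of _ "\<lambda>\<pi>. \<pi> \<circ> inv \<tau>" "\<lambda>\<pi>. \<pi> \<circ> \<tau>"])
    fix \<pi> assume p: "\<pi> \<in> C"
    show "\<pi> \<circ> \<tau> \<circ> inv \<tau> = \<pi>" "\<pi> \<circ> inv \<tau> \<circ> \<tau> = \<pi>" using permutes_cancel[OF C_PS[OF \<tau>]] by auto
    then show "sgn' (\<pi> \<circ> \<tau> \<circ> inv \<tau>) * wact (\<pi> \<circ> \<tau>) y w = sgn' \<pi> * wact (\<pi> \<circ> \<tau>) y w" by simp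
    show "\<pi> \<circ> \<tau> \<in> C" "\<pi> \<circ> inv \<tau> \<in> C" using p \<tau> C_comp C_inv by auto
  qed
  also have "\<dots> = (\<Sum>\<pi>\<in>C. sgn' \<tau> * (sgn' \<pi> * wact \<pi> y w))"
  proof (rule sum.cong[OF refl])
    fix \<pi> assume p: "\<pi> \<in> C"
    show "sgn' (\<pi> \<circ> inv \<tau>) * wact \<pi> y w = sgn' \<tau> * (sgn' \<pi> * wact \<pi> y w)"
      unfolding sgn_comp[OF C_PS[OF p] permutes_inv[OF C_PS[OF \<tau>]]] sgn_inv[OF C_PS[OF \<tau>]] by (simp only: mult_ac)
  qed
  finally show "kapw (wact \<tau> y) w = sgn' \<tau> * kapw y w" unfolding kapw_def sum_distrib_left .
qed

text \<open>With more one-letter words than columns, two of their letters share a column; the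
  transposition of these fixes the generator, while the antisymmetrizer turns it into a
  sign.\<close>

lemma kapw_gen_zero:
  assumes g: "(u, A, v) \<in> gidx n m" and c: "hd lam < card (singles A)" and sA: "singles A \<subseteq> {..<m}"
  shows "kapw (gen u A v) = (\<lambda>w. 0 :: 'a::field_char_0)"
proof -
  have "col k \<in> {..<hd lam}" if "k \<in> singles A" for k
  proof -
    have k: "k < m" using that sA by auto
    have "col k < lam ! row k" using row_less[OF k] by simp
    also have "\<dots> \<le> lam ! 0" by (rule lam_mono) (use row_less[OF k] in auto)
    also have "\<dots> = hd lam" using row_less[OF k] by (cases lam) auto
    finally show ?thesis by simp
  qed
  then have "\<not> inj_on col (singles A)"
    using card_inj_on_le[of col "singles A" "{..<hd lam}"] c by auto
  then obtain k l where kl: "k \<in> singles A" "l \<in> singles A" "k \<noteq> l" "col k = col l" by (auto simp: inj_on_def)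
  then have km: "k < m" "l < m" using sA by auto
  let ?p = "transpose k l"
  have p: "?p \<in> C" by (rule transpose_C[OF km kl(4)])
  have "wact ?p (gen u A v) = (gen u A v :: nat list \<Rightarrow> 'a)"
    by (rule gen_invariant[OF g, of _ "{k, l}"]) (use kl in \<open>auto intro: permutes_swap_id\<close>)
  then have "kapw (gen u A v) = (\<lambda>w. sgn' ?p * kapw (gen u A v) w :: 'a)" using kapw_wact[OF p, of "gen u A v :: nat list \<Rightarrow> 'a"] by simp
  then have e: "kapw (gen u A v) w = sgn' ?p * (kapw (gen u A v) w :: 'a)" for w by (rule fun_cong)
  show ?thesis
  proof
    fix w
    have "kapw (gen u A v) w = - (kapw (gen u A v) w :: 'a)" using e[of w] kl(3) by (simp add: sign_swap_id)
    then have "2 * (kapw (gen u A v) w :: 'a) = 0" unfolding eq_neg_iff_add_eq_0 mult_2 .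
    then show "kapw (gen u A v) w = (0 :: 'a)" by simp
  qed
qed

text \<open>If the first row were shorter than \<open>n - K\<close>, the column antisymmetrizer
  would kill every generator, hence all of \<open>Wnm n m\<close>. This space is closed under the
  row group, so the Young symmetrizer would be zero on it.\<close>

lemma first_row_bound:
  assumes n: "0 < n" and m: "m = n + K" and x: "x \<in> Wnm n m" and nz: "eop wact x \<noteq> (\<lambda>w. 0 :: 'a::field_char_0)"
  shows "n - K \<le> hd lam"
proof (rule ccontr)
  assume lt: "\<not> ?thesis"
  have kl: "kapw (\<lambda>w. f w + g w) = (\<lambda>w. kapw f w + kapw g w)" "kapw (\<lambda>w. c * f w) = (\<lambda>w. c * kapw f w)" "kapw (\<lambda>w. 0) = (\<lambda>w. 0)"
    for f g :: "nat list \<Rightarrow> 'a" and c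
    unfolding kapw_def wact_def distrib_left sum.distrib sum_distrib_left by (simp_all only: mult.left_commute mult_zero_right sum.neutral_const)
  have "subsp {f. kapw f = (\<lambda>w. 0 :: 'a)}" unfolding subsp_def by (simp add: kl)
  moreover have "gens n m \<subseteq> {f. kapw f = (\<lambda>w. 0 :: 'a)}"
  proof
    fix f :: "nat list \<Rightarrow> 'a" assume "f \<in> gens n m"
    then obtain u A v where f: "f = gen u A v" "(u, A, v) \<in> gidx n (n + K)" by (auto simp: gens_def m)
    have "kapw f = (\<lambda>w. 0)" unfolding f
      by (rule kapw_gen_zero[of _ _ _ n]) (use f(2) m singles_card[OF f(2)] lt in auto)
    then show "f \<in> {f. kapw f = (\<lambda>w. 0 :: 'a)}" by simp
  qed
  ultimately have k0: "kapw f = (\<lambda>w. 0)" if "f \<in> Wnm n m" for f :: "nat list \<Rightarrow> 'a"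
    using fspan_minimal that unfolding Wnm_eq_fspan[OF n] by blast
  have "eop wact x w = 0" for w
  proof -
    have "eop wact x w = (\<Sum>\<rho>\<in>R. \<Sum>\<pi>\<in>C. sgn' \<pi> * wact (\<pi> \<circ> \<rho>) x w)"
      unfolding eop_split by (rule sum.swap)
    also have "\<dots> = (\<Sum>\<rho>\<in>R. kapw (wact \<rho> x) w)"
      unfolding kapw_def by (intro sum.cong refl) (simp add: wact_comp[OF C_PS R_PS])
    also have "\<dots> = 0" by (rule sum.neutral) (simp add: k0 wact_Wnm[OF n R_PS x])
    finally show ?thesis .
  qed
  then show False using nz by auto
qed

lemma th_sum_ract:
  assumes "\<And>\<pi>. \<pi> \<in> S \<Longrightarrow> \<pi> permutes {..<m}"
  shows "th x (\<lambda>r. \<Sum>\<pi>\<in>S. c \<pi> * ract \<pi> f r) = (\<lambda>w. \<Sum>\<pi>\<in>S. c \<pi> * wact \<pi> (th x f) w)"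
  unfolding th_lcomb by (intro ext sum.cong refl) (simp add: th_ract assms)

lemma th_zero: "th x (\<lambda>r. 0) = (\<lambda>w. 0)" by (simp add: th_def gact_def)

end

lemma length_le_sum_list: "0 \<notin> set l \<Longrightarrow> length l \<le> sum_list (l :: nat list)"
  by (induction l) auto

lemma take_sums_inj:
  assumes "0 \<notin> set l" "0 \<notin> set l'" "\<And>i. sum_list (take i l) = sum_list (take i (l' :: nat list))"
  shows "l = l'"
  using assms
proof (induction l arbitrary: l')
  case Nil
  then show ?case using Nil.prems(3)[of 1] by (cases l') auto
next
  case (Cons x xs)
  have "l' \<noteq> []" using Cons.prems(1) Cons.prems(3)[of 1] by auto
  then obtain y ys where l': "l' = y # ys" by (cases l') auto
  have xy: "x = y" using Cons.prems(3)[of 1] l' by simp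
  have "xs = ys" by (rule Cons.IH) (use Cons.prems(1,2) Cons.prems(3)[of "Suc _"] l' xy in auto)
  then show ?case using l' xy by simp
qed

lemma subsp_Specht: "subsp (Specht lam)" unfolding Specht_def by (rule subsp_fspan)

lemma subsp_addD: "subsp X \<Longrightarrow> p \<in> X \<Longrightarrow> q \<in> X \<Longrightarrow> (\<lambda>x. p x + q x) \<in> X"
  by (simp add: subsp_def)
lemma subsp_scaleD: "subsp X \<Longrightarrow> p \<in> X \<Longrightarrow> (\<lambda>x. c * p x) \<in> X"
  by (simp add: subsp_def)
lemma subsp_zeroD: "subsp X \<Longrightarrow> (\<lambda>x. 0) \<in> X"
  by (simp add: subsp_def)

lemma DSum_supp: "F \<in> DSum P mlt f \<Longrightarrow> F (lam, j, r) \<noteq> 0 \<Longrightarrow> lam \<in> P \<and> j < mlt lam"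
  unfolding DSum_def by blast
lemma DSum_Specht: "F \<in> DSum P mlt f \<Longrightarrow> (\<lambda>r. F (lam, j, r)) \<in> Specht (f lam)"
  unfolding DSum_def by blast
lemma DSumI:
  assumes "\<And>lam j r. F (lam, j, r) \<noteq> 0 \<Longrightarrow> lam \<in> P \<and> j < mlt lam" "\<And>lam j. (\<lambda>r. F (lam, j, r)) \<in> Specht (f lam)"
  shows "F \<in> DSum P mlt f"
  unfolding DSum_def using assms by blast

lemma subsp_DSum: "subsp (DSum P mlt f :: (nat list \<times> nat \<times> nat list \<Rightarrow> 'a::field) set)"
proof (rule subspI)
  show "(\<lambda>x. 0) \<in> DSum P mlt f" by (rule DSumI) (simp_all add: subsp_zeroD[OF subsp_Specht])
next
  fix p q :: "nat list \<times> nat \<times> nat list \<Rightarrow> 'a" assume p: "p \<in> DSum P mlt f" and q: "q \<in> DSum P mlt f"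
  show "(\<lambda>x. p x + q x) \<in> DSum P mlt f"
  proof (rule DSumI)
    fix lam j r assume "p (lam, j, r) + q (lam, j, r) \<noteq> 0"
    then have "p (lam, j, r) \<noteq> 0 \<or> q (lam, j, r) \<noteq> 0" by auto
    then show "lam \<in> P \<and> j < mlt lam" using DSum_supp[OF p] DSum_supp[OF q] by blast
  qed (rule subsp_addD[OF subsp_Specht DSum_Specht[OF p] DSum_Specht[OF q]])
next
  fix c and p :: "nat list \<times> nat \<times> nat list \<Rightarrow> 'a" assume p: "p \<in> DSum P mlt f"
  show "(\<lambda>x. c * p x) \<in> DSum P mlt f"
  proof (rule DSumI)
    fix lam j r assume "c * p (lam, j, r) \<noteq> 0"
    then show "lam \<in> P \<and> j < mlt lam" using DSum_supp[OF p, of lam j r] by simp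
  qed (rule subsp_scaleD[OF subsp_Specht DSum_Specht[OF p]])
qed

lemma dsact_slice: "(\<lambda>r. dsact \<sigma> F (lam, j, r)) = ract \<sigma> (\<lambda>r. F (lam, j, r))"
  by (simp add: dsact_def ract_def)

lemma DSum_slice_zero: "F \<in> DSum P mlt f \<Longrightarrow> \<not> (lam \<in> P \<and> j < mlt lam) \<Longrightarrow> (\<lambda>r. F (lam, j, r)) = (\<lambda>r. 0)"
  using DSum_supp[of F P mlt f lam j] by blast

text \<open>The labels \<open>lam\<close> may be partitions of a smaller number; the shape of the
  summand is \<open>sh lam\<close>. The vectors \<open>x lam j\<close> carry the copies of one
  Specht module, and \<open>ind\<close> asks for independence of their Young
  symmetrizations.\<close>

locale specht_sum =
  fixes P :: "nat list set" and mlt :: "nat list \<Rightarrow> nat" and sh :: "nat list \<Rightarrow> nat list" and m :: nat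
    and TT :: "nat list \<Rightarrow> nat \<times> nat \<Rightarrow> nat" and x :: "nat list \<Rightarrow> nat \<Rightarrow> nat list \<Rightarrow> 'a::field_char_0"
  assumes fin: "finite {lam \<in> P. 0 < mlt lam}"
    and tab: "\<And>lam. lam \<in> P \<Longrightarrow> 0 < mlt lam \<Longrightarrow> tableau (sh lam) m (TT lam)"
    and inj_sh: "inj_on sh P"
    and ind: "\<And>lam. lam \<in> P \<Longrightarrow> 0 < mlt lam \<Longrightarrow>
        findep {..<mlt lam} (\<lambda>j. tableau.eop (sh lam) m (TT lam) wact (x lam j))"
begin

definition PP where "PP = {lam \<in> P. 0 < mlt lam}"
definition TH where "TH lam = tableau.th (sh lam) m (TT lam)"
definition emb :: "(nat list \<times> nat \<times> nat list \<Rightarrow> 'a) \<Rightarrow> nat list \<Rightarrow> 'a" where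
  "emb F = (\<lambda>w. \<Sum>lam\<in>PP. \<Sum>j<mlt lam. TH lam (x lam j) (\<lambda>r. F (lam, j, r)) w)"

abbreviation DS where "DS \<equiv> DSum P mlt sh :: (nat list \<times> nat \<times> nat list \<Rightarrow> 'a) set"

lemma tabPP: "lam \<in> PP \<Longrightarrow> tableau (sh lam) m (TT lam)" using tab by (simp add: PP_def)

lemma dsact_DS:
  assumes \<sigma>: "\<sigma> permutes {..<m}" and F: "F \<in> DS"
  shows "dsact \<sigma> F \<in> DS"
proof -
  have "(\<lambda>r. dsact \<sigma> F (lam, j, r)) \<in> Specht (sh lam)" for lam j
  proof (cases "lam \<in> P \<and> j < mlt lam")
    case True
    then interpret tableau "sh lam" m "TT lam" by (intro tab) auto
    show ?thesis unfolding dsact_slice by (rule ract_Specht[OF \<sigma> DSum_Specht[OF F]])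
  next
    case False
    then have "(\<lambda>r. dsact \<sigma> F (lam, j, r)) = (\<lambda>r. 0)" unfolding dsact_slice DSum_slice_zero[OF F False] by (simp add: ract_def)
    then show ?thesis using subsp_Specht[of "sh lam", where 'a = 'a] by (simp add: subsp_def)
  qed
  moreover have "lam \<in> P \<and> j < mlt lam" if "dsact \<sigma> F (lam, j, r) \<noteq> 0" for lam j r
    using that unfolding dsact_def prod.case by (rule DSum_supp[OF F])
  ultimately show ?thesis by (intro DSumI) blast+
qed

lemma emb_add: "emb (\<lambda>y. F y + G y) = (\<lambda>w. emb F w + emb G w)"
proof
  fix w
  have "TH lam (x lam j) (\<lambda>r. F (lam, j, r) + G (lam, j, r)) w = TH lam (x lam j) (\<lambda>r. F (lam, j, r)) w + TH lam (x lam j) (\<lambda>r. G (lam, j, r)) w"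
    if "lam \<in> PP" for lam j unfolding TH_def tableau.th_add[OF tabPP[OF that]] ..
  then show "emb (\<lambda>y. F y + G y) w = emb F w + emb G w" by (simp add: emb_def sum.distrib)
qed

lemma emb_scale: "emb (\<lambda>y. c * F y) = (\<lambda>w. c * emb F w)"
proof
  fix w
  have "TH lam (x lam j) (\<lambda>r. c * F (lam, j, r)) w = c * TH lam (x lam j) (\<lambda>r. F (lam, j, r)) w"
    if "lam \<in> PP" for lam j unfolding TH_def tableau.th_scale[OF tabPP[OF that]] ..
  then show "emb (\<lambda>y. c * F y) w = c * emb F w" by (simp add: emb_def sum_distrib_left)
qed

lemma emb_dsact:
  assumes \<sigma>: "\<sigma> permutes {..<m}"
  shows "emb (dsact \<sigma> F) = wact \<sigma> (emb F)"
proof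
  fix w
  have "TH lam (x lam j) (\<lambda>r. dsact \<sigma> F (lam, j, r)) w = wact \<sigma> (TH lam (x lam j) (\<lambda>r. F (lam, j, r))) w"
    if "lam \<in> PP" for lam j unfolding TH_def dsact_slice tableau.th_ract[OF tabPP[OF that] \<sigma>] ..
  then show "emb (dsact \<sigma> F) w = wact \<sigma> (emb F) w" by (simp add: emb_def wact_def)
qed

text \<open>Take a minimal shape in dominance among the nonzero components and apply its column
  antisymmetrizer after any \<open>\<sigma>\<close>. By \<open>kap_dominated\<close> other shapes
  are killed, and each remaining component becomes its pairing times \<open>e\<close>; independence
  of the symmetrized vectors makes all pairings vanish, which contradicts nondegeneracy.\<close>

lemma emb_zero_imp:
  assumes F: "F \<in> DS" and z: "emb F = (\<lambda>w. 0)"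
  shows "F = (\<lambda>y. 0)"
proof (rule ccontr)
  assume "F \<noteq> (\<lambda>y. 0)"
  then obtain l0 j0 r0 where "F (l0, j0, r0) \<noteq> 0" by (metis prod_cases3)
  then have l0: "l0 \<in> PP" "(\<lambda>r. F (l0, j0, r)) \<noteq> (\<lambda>r. 0)"
    using DSum_supp[OF F, of l0 j0 r0] by (auto simp: PP_def dest: fun_cong[of _ _ r0])
  let ?NZ = "{lam \<in> PP. \<exists>j. (\<lambda>r. F (lam, j, r)) \<noteq> (\<lambda>r. 0)}"
  \<comment> \<open>The sum of the prefix sums is strictly monotone for dominance, so a minimum of
    \<open>DD\<close> is a minimal shape.\<close>
  define DD where "DD lam = (\<Sum>i\<le>m. sum_list (take i (sh lam)))" for lam
  have "finite ?NZ" by (rule finite_subset[OF _ fin]) (auto simp: PP_def)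
  moreover have "?NZ \<noteq> {}" using l0 by blast
  ultimately obtain lam where lam: "lam \<in> ?NZ" and min: "\<And>l. l \<in> ?NZ \<Longrightarrow> DD lam \<le> DD l"
    using arg_min_if_finite(1)[of ?NZ DD] arg_min_least[of ?NZ _ DD] by blast
  have lP: "lam \<in> PP" using lam by simp
  interpret L: tableau "sh lam" m "TT lam" by (rule tabPP[OF lP])
  have part: "0 \<notin> set (sh l)" "sum_list (sh l) = m" if "l \<in> PP" for l
    using tabPP[OF that] by (auto simp: tableau_def is_partition_def)
  have kz: "L.kap (ract \<sigma> (\<lambda>r. F (l, j, r))) = (\<lambda>r. 0)"
    if l: "l \<in> PP" "l \<noteq> lam" and \<sigma>: "\<sigma> permutes {..<m}" for l j \<sigma>
  proof (rule ccontr)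
    assume nz: "L.kap (ract \<sigma> (\<lambda>r. F (l, j, r))) \<noteq> (\<lambda>r. 0)"
    then obtain r where r: "L.kap (ract \<sigma> (\<lambda>r. F (l, j, r))) r \<noteq> 0" by auto
    have "(\<lambda>r. F (l, j, r)) \<noteq> (\<lambda>r. 0)"
    proof
      assume "(\<lambda>r. F (l, j, r)) = (\<lambda>r. 0)"
      then have "L.kap (ract \<sigma> (\<lambda>r. F (l, j, r))) r = 0" unfolding L.kap_def ract_def by (simp add: fun_eq_iff)
      then show False using r by simp
    qed
    then have lN: "l \<in> ?NZ" using l by blast
    interpret L': tableau "sh l" m "TT l" by (rule tabPP[OF l(1)])
    have "(\<lambda>r. F (l, j, r)) \<in> Specht (sh l)" by (rule DSum_Specht[OF F])
    then have "ract \<sigma> (\<lambda>r. F (l, j, r)) \<in> Mmod m (sh l)" using L'.Specht_Mmod ract_Mmod[OF \<sigma>] by blast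
    from L.kap_dominated[OF this r] have dom: "sum_list (take i (sh l)) \<le> sum_list (take i (sh lam))" for i .
    have "sum_list (take i (sh l)) = sum_list (take i (sh lam))" for i
    proof (cases "i \<le> m")
      case True
      show ?thesis
      proof (rule ccontr)
        assume "sum_list (take i (sh l)) \<noteq> sum_list (take i (sh lam))"
        then have "sum_list (take i (sh l)) < sum_list (take i (sh lam))" using dom[of i] by simp
        then have "DD l < DD lam" unfolding DD_def by (intro sum_strict_mono_ex1) (use dom True in auto)
        then show False using min[OF lN] by simp
      qed
    next
      case False
      have "length (sh l) \<le> m" "length (sh lam) \<le> m"
        using length_le_sum_list[OF part(1)[OF l(1)]] part(2)[OF l(1)] length_le_sum_list[OF part(1)[OF lP]] part(2)[OF lP] by auto
      then show ?thesis using False part(2)[OF l(1)] part(2)[OF lP] by simp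
    qed
    then have "sh l = sh lam" by (intro take_sums_inj part(1) l(1) lP)
    then show False using inj_sh l lP by (auto simp: PP_def inj_on_def)
  qed
  have betz: "L.bet (ract \<sigma> (\<lambda>r. F (lam, j, r))) = 0" if \<sigma>: "\<sigma> permutes {..<m}" and j: "j < mlt lam" for \<sigma> j
  proof -
    have Kw: "(\<Sum>\<pi>\<in>L.C. of_int (sign \<pi>) * wact \<pi> (wact \<sigma> (emb F)) w) = 0" for w
      unfolding z by (simp add: wact_def)
    have "(\<Sum>i<mlt lam. L.bet (ract \<sigma> (\<lambda>r. F (lam, i, r))) * L.eop wact (x lam i) w) = 0" for w
    proof -
      have G: "(\<Sum>\<pi>\<in>L.C. of_int (sign \<pi>) * wact \<pi> (wact \<sigma> (TH l (x l i) (\<lambda>r. F (l, i, r)))) w)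
          = TH l (x l i) (L.kap (ract \<sigma> (\<lambda>r. F (l, i, r)))) w" if "l \<in> PP" for l i
      proof -
        interpret L': tableau "sh l" m "TT l" by (rule tabPP[OF that])
        have "L.kap (ract \<sigma> (\<lambda>r. F (l, i, r))) = (\<lambda>r. \<Sum>\<pi>\<in>L.C. of_int (sign \<pi>) * ract \<pi> (ract \<sigma> (\<lambda>r. F (l, i, r))) r)"
          by (rule ext) (rule L.kap_ract)
        then show ?thesis
          using L'.th_sum_ract[of L.C "x l i" "\<lambda>\<pi>. of_int (sign \<pi>)" "ract \<sigma> (\<lambda>r. F (l, i, r))", OF L.C_PS]
          unfolding TH_def by (simp only: L'.th_ract[OF \<sigma>])
      qed
      have "0 = (\<Sum>\<pi>\<in>L.C. \<Sum>l\<in>PP. \<Sum>i<mlt l. of_int (sign \<pi>) * wact \<pi> (wact \<sigma> (TH l (x l i) (\<lambda>r. F (l, i, r)))) w)"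
        using Kw[of w] by (simp add: emb_def wact_def sum_distrib_left)
      also have "\<dots> = (\<Sum>l\<in>PP. \<Sum>i<mlt l. \<Sum>\<pi>\<in>L.C. of_int (sign \<pi>) * wact \<pi> (wact \<sigma> (TH l (x l i) (\<lambda>r. F (l, i, r)))) w)"
        by (subst sum.swap, rule sum.cong[OF refl], rule sum.swap)
      also have "\<dots> = (\<Sum>l\<in>PP. \<Sum>i<mlt l. TH l (x l i) (L.kap (ract \<sigma> (\<lambda>r. F (l, i, r)))) w)"
        by (intro sum.cong refl) (simp add: G)
      also have "\<dots> = (\<Sum>l\<in>PP. if l = lam then (\<Sum>i<mlt l. TH l (x l i) (L.kap (ract \<sigma> (\<lambda>r. F (l, i, r)))) w) else 0)"
      proof (rule sum.cong[OF refl])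
        fix l assume l: "l \<in> PP"
        have "(\<Sum>i<mlt l. TH l (x l i) (L.kap (ract \<sigma> (\<lambda>r. F (l, i, r)))) w) = 0" if "l \<noteq> lam"
          using kz[OF l that \<sigma>] by (simp add: TH_def tableau.th_zero[OF tabPP[OF l]])
        then show "(\<Sum>i<mlt l. TH l (x l i) (L.kap (ract \<sigma> (\<lambda>r. F (l, i, r)))) w) =
          (if l = lam then (\<Sum>i<mlt l. TH l (x l i) (L.kap (ract \<sigma> (\<lambda>r. F (l, i, r)))) w) else 0)" by simp
      qed
      also have "\<dots> = (\<Sum>i<mlt lam. TH lam (x lam i) (L.kap (ract \<sigma> (\<lambda>r. F (lam, i, r)))) w)"
        using lP fin by (simp add: PP_def)
      also have "\<dots> = (\<Sum>i<mlt lam. L.bet (ract \<sigma> (\<lambda>r. F (lam, i, r))) * L.eop wact (x lam i) w)"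
      proof (rule sum.cong[OF refl])
        fix i
        have "(\<lambda>r. F (lam, i, r)) \<in> Specht (sh lam)" by (rule DSum_Specht[OF F])
        then have "ract \<sigma> (\<lambda>r. F (lam, i, r)) \<in> Mmod m (sh lam)" using L.Specht_Mmod ract_Mmod[OF \<sigma>] by blast
        from L.kap_eq[OF this] have "L.kap (ract \<sigma> (\<lambda>r. F (lam, i, r))) = (\<lambda>r. L.bet (ract \<sigma> (\<lambda>r. F (lam, i, r))) * L.e r)"
          by (simp add: L.bet_def)
        then show "TH lam (x lam i) (L.kap (ract \<sigma> (\<lambda>r. F (lam, i, r)))) w = L.bet (ract \<sigma> (\<lambda>r. F (lam, i, r))) * L.eop wact (x lam i) w"
          unfolding TH_def by (simp only: L.th_scale L.th_e)
      qed
      finally show ?thesis by simp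
    qed
    then show ?thesis
      using ind[of lam, unfolded findep_def, rule_format, of "\<lambda>i. L.bet (ract \<sigma> (\<lambda>r. F (lam, i, r)))" j] lP j
      by (simp add: PP_def)
  qed
  have "(\<lambda>r. F (lam, j, r)) = (\<lambda>r. 0)" for j
  proof (cases "j < mlt lam")
    case True
    show ?thesis by (rule L.Specht_nondegenerate) (use DSum_Specht[OF F] betz True in auto)
  next
    case False then show ?thesis using DSum_slice_zero[OF F] by blast
  qed
  then show False using lam by blast
qed

lemma emb_inj: "inj_on emb DS"
proof (rule inj_onI)
  fix F G assume FG: "F \<in> DS" "G \<in> DS" "emb F = emb G"
  note sub = subsp_DSum[of P mlt sh, where 'a = 'a]
  have "(\<lambda>y. F y + - 1 * G y) \<in> DS" by (rule subsp_addD[OF sub FG(1) subsp_scaleD[OF sub FG(2)]])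
  moreover have "emb (\<lambda>y. F y + - 1 * G y) = (\<lambda>w. 0)" unfolding emb_add emb_scale using FG(3) by simp
  ultimately have "(\<lambda>y. F y + - 1 * G y) = (\<lambda>y. 0)" by (rule emb_zero_imp)
  then show "F = G" by (auto simp: fun_eq_iff)
qed

end

section \<open>Representation stability\<close>

lemma lin_on_lcomb:
  assumes V: "subsp V" and add: "\<And>u v. u \<in> V \<Longrightarrow> v \<in> V \<Longrightarrow> \<phi> (\<lambda>x. u x + v x) = (\<lambda>y. \<phi> u y + \<phi> v y)"
    and scale: "\<And>c u. u \<in> V \<Longrightarrow> \<phi> (\<lambda>x. c * u x) = (\<lambda>y. c * \<phi> u y)" and f: "\<And>i. i \<in> I \<Longrightarrow> f i \<in> V"
  shows "\<phi> (\<lambda>x. \<Sum>i\<in>I. c i * f i x) = (\<lambda>y. \<Sum>i\<in>I. c i * \<phi> (f i) y)"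
proof -
  have z: "\<phi> (\<lambda>x. 0) = (\<lambda>y. 0)" using scale[OF subsp_zeroD[OF V], of 0] by simp
  show ?thesis using f
  proof (induction I rule: infinite_finite_induct)
    case (insert i I)
    have "\<phi> (\<lambda>x. c i * f i x + (\<Sum>i\<in>I. c i * f i x)) = (\<lambda>y. \<phi> (\<lambda>x. c i * f i x) y + \<phi> (\<lambda>x. \<Sum>i\<in>I. c i * f i x) y)"
      by (rule add) (use insert in \<open>auto intro: subsp_scaleD[OF V] subsp_lcomb[OF V]\<close>)
    then show ?case using insert scale[of "f i" "c i"] by simp
  qed (simp_all add: z)
qed

lemma gact_equivariant:
  assumes V: "subsp V" and add: "\<And>u v. u \<in> V \<Longrightarrow> v \<in> V \<Longrightarrow> \<phi> (\<lambda>x. u x + v x) = (\<lambda>y. \<phi> u y + \<phi> v y)"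
    and scale: "\<And>c u. u \<in> V \<Longrightarrow> \<phi> (\<lambda>x. c * u x) = (\<lambda>y. c * \<phi> u y)"
    and cl: "\<And>i. i \<in> I \<Longrightarrow> actV (\<tau> i) v \<in> V" and eq: "\<And>i. i \<in> I \<Longrightarrow> \<phi> (actV (\<tau> i) v) = actU (\<tau> i) (\<phi> v)"
  shows "\<phi> (gact I c \<tau> actV v) = gact I c \<tau> actU (\<phi> v)"
proof -
  have "\<phi> (gact I c \<tau> actV v) = (\<lambda>y. \<Sum>i\<in>I. c i * \<phi> (actV (\<tau> i) v) y)"
    unfolding gact_def by (rule lin_on_lcomb[OF V add scale cl])
  also have "\<dots> = gact I c \<tau> actU (\<phi> v)" unfolding gact_def by (intro ext sum.cong refl) (simp add: eq)
  finally show ?thesis .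
qed

lemma sym_stable:
  "\<exists>r n0. \<forall>n\<ge>n0. hasdim (psym {2 * K..<n + K} wact ` (Wnm n (n + K) :: (nat list \<Rightarrow> 'a::field_char_0) set)) r"
proof -
  have "gact {()} (\<lambda>_. 1) (\<lambda>_. id) wact f = f" for f :: "nat list \<Rightarrow> 'a"
    by (simp add: gact_def wact_def)
  then show ?thesis
    using stable_dim[of "2 * K" "2 * K" "{()}" "\<lambda>_. id" "\<lambda>_. 1 :: 'a" K] by (simp add: permutes_id)
qed

text \<open>One \<open>r\<close> serves all first-row lengths, since the group algebra element of
  \<open>eop_std_partition\<close> depends on \<open>mu\<close> only.\<close>

lemma eop_stable:
  "\<exists>r n0. \<forall>n\<ge>n0. \<forall>a. is_partition (n + K) (a # mu) \<longrightarrow> sum_list mu \<le> a \<longrightarrow>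
     hasdim (tableau.eop (a # mu) (n + K) (std_tab mu) wact ` (Wnm n (n + K) :: (nat list \<Rightarrow> 'a::field_char_0) set)) r"
proof -
  let ?b = "sum_list mu"
  let ?I = "std_C mu \<times> std_R mu"
  have fC: "finite (std_C mu)" by (rule finite_subset[OF _ finite_permutations[of "{..<2 * ?b}"]]) (auto simp: std_C_def)
  have fR: "finite (std_R mu)" by (rule finite_subset[OF _ finite_permutations[of "{..<?b}"]]) (auto simp: std_R_def)
  have p: "(case i of (\<pi>, \<rho>) \<Rightarrow> \<pi> \<circ> \<rho>) permutes {..<2 * ?b}" if i: "i \<in> ?I" for i
  proof -
    obtain \<pi> \<rho> where i': "i = (\<pi>, \<rho>)" "\<pi> permutes {..<2 * ?b}" "\<rho> permutes {..<?b}" using i by (auto simp: std_C_def std_R_def)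
    have "\<rho> permutes {..<2 * ?b}" by (rule permutes_subset[OF i'(3)]) auto
    then show ?thesis using i' by (auto intro: permutes_compose)
  qed
  obtain r n0 where r: "\<And>n. n \<ge> n0 \<Longrightarrow> hasdim ((\<lambda>f. gact ?I (\<lambda>(\<pi>, \<rho>). of_int (sign \<pi>) :: 'a) (\<lambda>(\<pi>, \<rho>). \<pi> \<circ> \<rho>) wact (psym {?b..<n + K} wact f)) ` Wnm n (n + K)) r"
    using stable_dim[of ?b "2 * ?b" ?I "\<lambda>(\<pi>, \<rho>). \<pi> \<circ> \<rho>" "\<lambda>(\<pi>, \<rho>). of_int (sign \<pi>) :: 'a" K] fC fR p by auto
  show ?thesis
  proof (intro exI allI impI)
    fix n a assume n: "n0 \<le> n" and a: "is_partition (n + K) (a # mu)" "?b \<le> a"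
    have "tableau.eop (a # mu) (n + K) (std_tab mu) wact ` (Wnm n (n + K) :: (nat list \<Rightarrow> 'a) set) =
      (\<lambda>f. gact ?I (\<lambda>(\<pi>, \<rho>). of_int (sign \<pi>) :: 'a) (\<lambda>(\<pi>, \<rho>). \<pi> \<circ> \<rho>) wact (psym {?b..<n + K} wact f)) ` Wnm n (n + K)"
      by (rule image_cong[OF refl]) (rule eop_std_partition[OF a])
    then show "hasdim (tableau.eop (a # mu) (n + K) (std_tab mu) wact ` (Wnm n (n + K) :: (nat list \<Rightarrow> 'a) set)) r"
      using r[OF n] by simp
  qed
qed

lemma perm_fixing_prefix:
  assumes l: "length q = M" "length r = M" and k: "k \<le> M" and t: "take k q = take k r" and ms: "mset q = mset r"
  shows "\<exists>\<rho>. \<rho> permutes {k..<M} \<and> tact (inv \<rho>) r = q"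
proof -
  have "mset (take k q) + mset (drop k q) = mset (take k r) + mset (drop k r)"
    using ms by (metis append_take_drop_id mset_append)
  then have "mset (drop k q) = mset (drop k r)" using t by simp
  then obtain p where p: "p permutes {..<length (drop k r)}" "permute_list p (drop k r) = drop k q"
    by (rule mset_eq_permutation)
  define \<rho> where "\<rho> i = (if k \<le> i then k + p (i - k) else i)" for i
  have pM: "p permutes {..<M - k}" using p(1) l by simp
  have "bij_betw \<rho> {k..<M} {k..<M}"
  proof (rule bij_betwI[of _ _ _ "\<lambda>i. k + inv p (i - k)"])
    show "\<rho> \<in> {k..<M} \<rightarrow> {k..<M}"
    proof
      fix i assume "i \<in> {k..<M}"
      then show "\<rho> i \<in> {k..<M}" using permutes_in_image[OF pM, of "i - k"] by (auto simp: \<rho>_def)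
    qed
    show "(\<lambda>i. k + inv p (i - k)) \<in> {k..<M} \<rightarrow> {k..<M}"
    proof
      fix i assume "i \<in> {k..<M}"
      then show "k + inv p (i - k) \<in> {k..<M}" using permutes_in_image[OF permutes_inv[OF pM], of "i - k"] by auto
    qed
  qed (auto simp: \<rho>_def permutes_inverses[OF pM])
  then have \<rho>: "\<rho> permutes {k..<M}"
  proof (rule bij_imp_permutes)
    fix i assume "i \<notin> {k..<M}"
    then show "\<rho> i = i" using permutes_not_in[OF pM, of "i - k"] by (auto simp: \<rho>_def)
  qed
  have "tact (inv \<rho>) r = q"
  proof (rule nth_equalityI)
    fix i assume "i < length (tact (inv \<rho>) r)"
    then have i: "i < M" using l by simp
    have e: "tact (inv \<rho>) r ! i = r ! \<rho> i" using i l by (simp add: tact_nth permutes_inv_inv[OF \<rho>])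
    show "tact (inv \<rho>) r ! i = q ! i"
    proof (cases "k \<le> i")
      case True
      have pi: "p (i - k) < M - k" using permutes_in_image[OF pM, of "i - k"] True i by simp
      have "q ! i = drop k q ! (i - k)" using True i l by simp
      also have "\<dots> = permute_list p (drop k r) ! (i - k)" using p by simp
      also have "\<dots> = drop k r ! p (i - k)" using True i l p(1) by (intro permute_list_nth) auto
      also have "\<dots> = r ! (k + p (i - k))" using pi l k by simp
      finally show ?thesis using e True by (simp add: \<rho>_def)
    next
      case False
      then have "q ! i = r ! i" using t by (metis not_le nth_take)
      then show ?thesis using e False by (simp add: \<rho>_def)
    qed
  qed (use l in simp)
  then show ?thesis using \<rho> by blast
qed

lemma tact_permute_list: "tact \<sigma> r = permute_list (inv \<sigma>) r"
  by (simp add: tact_def permute_list_def)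

text \<open>Evaluate at \<open>r0\<close> followed by zeros. A permuted word contributes only if it
  still ends in \<open>s\<close> zeros; its first \<open>M\<close> entries then rearrange
  \<open>r0\<close> with the same first \<open>k\<close> entries, so invariance makes the
  contribution \<open>f r0\<close>. The identity is one such permutation, so \<open>f r0\<close>
  appears with a positive integer factor.\<close>

lemma psym_ext_zero:
  fixes f :: "nat list \<Rightarrow> 'a::field_char_0"
  assumes k: "k \<le> M" and len: "\<And>r. f r \<noteq> 0 \<Longrightarrow> length r = M"
    and inv: "\<And>\<rho>. \<rho> permutes {k..<M} \<Longrightarrow> ract \<rho> f = f" and z: "psym {k..<M + s} ract (ext M s f) = (\<lambda>r. 0)"
  shows "f = (\<lambda>r. 0)"
proof (rule ccontr)
  assume "f \<noteq> (\<lambda>r. 0)"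
  then obtain r0 where r0: "f r0 \<noteq> 0" by auto
  have l0: "length r0 = M" by (rule len[OF r0])
  let ?r = "r0 @ replicate s 0"
  let ?P = "{\<pi>. \<pi> permutes {k..<M + s}}"
  have tm: "ext M s f (tact (inv \<pi>) ?r) = (if drop M (tact (inv \<pi>) ?r) = replicate s 0 then f r0 else 0)"
    if \<pi>: "\<pi> permutes {k..<M + s}" for \<pi>
  proof (cases "drop M (tact (inv \<pi>) ?r) = replicate s 0")
    case True
    let ?q = "take M (tact (inv \<pi>) ?r)"
    have \<pi>': "\<pi> permutes {..<length ?r}" by (rule permutes_subset[OF \<pi>]) (use l0 in auto)
    have "mset (tact (inv \<pi>) ?r) = mset ?r"
      unfolding tact_permute_list permutes_inv_inv[OF \<pi>] by (rule mset_permute_list[OF \<pi>'])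
    moreover have "tact (inv \<pi>) ?r = ?q @ replicate s 0" using True append_take_drop_id[of M "tact (inv \<pi>) ?r"] by simp
    ultimately have "mset (?q @ replicate s 0) = mset ?r" by simp
    then have ms: "mset ?q = mset r0" by simp
    have tk: "take k ?q = take k r0"
    proof (rule nth_equalityI)
      fix i assume "i < length (take k ?q)"
      then have i: "i < k" "i < M" using l0 k by auto
      have "\<pi> i = i" using permutes_not_in[OF \<pi>, of i] i by simp
      then show "take k ?q ! i = take k r0 ! i"
        using i l0 by (simp add: tact_nth permutes_inv_inv[OF \<pi>] nth_append)
    qed (use l0 in simp)
    obtain \<rho> where \<rho>: "\<rho> permutes {k..<M}" "tact (inv \<rho>) r0 = ?q"
      using perm_fixing_prefix[of ?q M r0 k] l0 k tk ms by auto
    have "f ?q = f r0" using fun_cong[OF inv[OF \<rho>(1)], of r0] \<rho>(2) by (simp add: ract_def)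
    then show ?thesis using True l0 by (simp add: ext_def)
  qed (simp add: ext_def)
  have "0 = psym {k..<M + s} ract (ext M s f) ?r" using z by simp
  also have "\<dots> = (\<Sum>\<pi>\<in>?P. if drop M (tact (inv \<pi>) ?r) = replicate s 0 then f r0 else 0)"
    unfolding psym_def gact_def ract_def by (rule sum.cong) (auto simp: tm)
  also have "\<dots> = (\<Sum>\<pi>\<in>{\<pi> \<in> ?P. drop M (tact (inv \<pi>) ?r) = replicate s 0}. f r0)"
    by (rule sum.inter_filter[symmetric]) (simp add: finite_permutations)
  also have "\<dots> = of_nat (card {\<pi> \<in> ?P. drop M (tact (inv \<pi>) ?r) = replicate s 0}) * f r0" by simp
  finally have "card {\<pi> \<in> ?P. drop M (tact (inv \<pi>) ?r) = replicate s 0} = 0" using r0 by simp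
  moreover have "id \<in> {\<pi> \<in> ?P. drop M (tact (inv \<pi>) ?r) = replicate s 0}" using l0 by (simp add: permutes_id)
  moreover have "finite {\<pi> \<in> ?P. drop M (tact (inv \<pi>) ?r) = replicate s 0}"
    by (rule finite_subset[OF _ finite_permutations[of "{k..<M + s}"]]) auto
  ultimately show False unfolding card_eq_0_iff by blast
qed

lemma exists_perm_onto:
  assumes "B \<subseteq> {..<m}" "card B = m - k" "k \<le> m"
  shows "\<exists>\<sigma>. \<sigma> permutes {..<m} \<and> \<sigma> ` {k..<m} = B"
proof -
  have fB: "finite B" using assms finite_subset by blast
  obtain f where f: "bij_betw f {k..<m} B" using finite_same_card_bij[of "{k..<m}" B] fB assms by auto
  have "card ({..<m} - B) = k" using assms fB by (simp add: card_Diff_subset)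
  then obtain g where g: "bij_betw g {..<k} ({..<m} - B)" using finite_same_card_bij[of "{..<k}" "{..<m} - B"] by auto
  define \<sigma> where "\<sigma> i = (if i < k then g i else if i < m then f i else i)" for i
  have f': "bij_betw \<sigma> {k..<m} B" using f by (rule bij_betw_cong[THEN iffD1, rotated]) (simp add: \<sigma>_def)
  have g': "bij_betw \<sigma> {..<k} ({..<m} - B)" using g by (rule bij_betw_cong[THEN iffD1, rotated]) (simp add: \<sigma>_def)
  have "bij_betw \<sigma> ({k..<m} \<union> {..<k}) (B \<union> ({..<m} - B))" by (rule bij_betw_combine[OF f' g']) auto
  moreover have "{k..<m} \<union> {..<k} = {..<m}" "B \<union> ({..<m} - B) = {..<m}" using assms by auto
  ultimately have "bij_betw \<sigma> {..<m} {..<m}" by simp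
  then have "\<sigma> permutes {..<m}" by (rule bij_imp_permutes) (use assms in \<open>simp add: \<sigma>_def\<close>)
  then show ?thesis using f' by (auto simp: bij_betw_def)
qed

lemma permutes_conj:
  assumes "\<sigma> permutes A" "\<pi> permutes S"
  shows "\<sigma> \<circ> \<pi> \<circ> inv \<sigma> permutes \<sigma> ` S"
proof -
  have "bij (\<sigma> \<circ> \<pi> \<circ> inv \<sigma>)"
    by (intro bij_comp permutes_bij[OF assms(2)] permutes_bij[OF assms(1)] permutes_bij[OF permutes_inv[OF assms(1)]])
  moreover have "(\<sigma> \<circ> \<pi> \<circ> inv \<sigma>) x = x" if "x \<notin> \<sigma> ` S" for x
  proof -
    have "inv \<sigma> x \<notin> S" using that permutes_inverses(1)[OF assms(1), of x] by (metis imageI)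
    then show ?thesis using permutes_not_in[OF assms(2)] permutes_inverses(1)[OF assms(1)] by simp
  qed
  ultimately show ?thesis unfolding permutes_def bij_iff by blast
qed

text \<open>Each generator is invariant under the permutations of its one-letter words.\<close>
lemma Wnm_subset_of_sym:
  fixes U :: "(nat list \<Rightarrow> 'a::field_char_0) set"
  assumes n: "0 < n" "K \<le> n" and m: "m = n + K" and U: "subsp U" and act: "\<And>\<sigma> f. \<sigma> permutes {..<m} \<Longrightarrow> f \<in> U \<Longrightarrow> wact \<sigma> f \<in> U"
    and sym: "psym {2 * K..<m} wact ` Wnm n m \<subseteq> U"
  shows "Wnm n m \<subseteq> U"
proof -
  have "gens n m \<subseteq> U"
  proof
    fix g :: "nat list \<Rightarrow> 'a" assume "g \<in> gens n m"
    then obtain u A v where g: "g = gen u A v" "(u, A, v) \<in> gidx n (n + K)" by (auto simp: gens_def m)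
    have gW: "g \<in> Wnm n m" using \<open>g \<in> gens n m\<close> gens_subset_Wnm[OF n(1)] by blast
    \<comment> \<open>Exactly \<open>n - K\<close> of these letters are kept, which is
      \<open>m - 2 * K\<close>; conjugation by \<open>\<sigma>\<close> moves them to the positions
      \<open>2 * K\<close>, ..., \<open>m - 1\<close>.\<close>
    obtain B where B: "B \<subseteq> singles A" "card B = n - K" using obtain_subset_with_card_n[OF singles_card(1)[OF g(2)]] by metis
    have "B \<subseteq> {..<m}" using B singles_card(2)[OF g(2)] m by auto
    moreover have "card B = m - 2 * K" "2 * K \<le> m" using B m n by auto
    ultimately obtain \<sigma> where \<sigma>: "\<sigma> permutes {..<m}" "\<sigma> ` {2 * K..<m} = B" using exists_perm_onto by blast
    define g' where "g' = wact (inv \<sigma>) g"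
    have g'W: "g' \<in> Wnm n m" unfolding g'_def by (rule wact_Wnm[OF n(1) permutes_inv[OF \<sigma>(1)] gW])
    have inv: "wact \<pi> g' = g'" if \<pi>: "\<pi> permutes {2 * K..<m}" for \<pi>
    proof -
      have \<pi>': "\<pi> permutes {..<m}" by (rule permutes_subset[OF \<pi>]) auto
      let ?c = "\<sigma> \<circ> \<pi> \<circ> inv \<sigma>"
      have c: "?c permutes B" using permutes_conj[OF \<sigma>(1) \<pi>] \<sigma>(2) by simp
      have c': "?c permutes {..<m}" by (intro permutes_compose \<sigma>(1) \<pi>' permutes_inv)
      have "wact \<pi> g' = wact (\<pi> \<circ> inv \<sigma>) g" unfolding g'_def by (rule wact_comp[OF \<pi>' permutes_inv[OF \<sigma>(1)]])
      also have "\<pi> \<circ> inv \<sigma> = inv \<sigma> \<circ> ?c" using permutes_inverses[OF \<sigma>(1)] by (auto simp: fun_eq_iff)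
      also have "wact (inv \<sigma> \<circ> ?c) g = wact (inv \<sigma>) (wact ?c g)" by (rule wact_comp[OF permutes_inv[OF \<sigma>(1)] c', symmetric])
      also have "wact ?c g = g" unfolding g(1) by (rule gen_invariant[OF g(2) c B(1)])
      finally show ?thesis by (simp add: g'_def)
    qed
    have "psym {2 * K..<m} wact g' = (\<lambda>w. fact (m - 2 * K) * g' w)"
    proof
      fix w
      have "psym {2 * K..<m} wact g' w = (\<Sum>\<pi>\<in>{\<pi>. \<pi> permutes {2 * K..<m}}. g' w)"
        unfolding psym_def gact_def by (rule sum.cong) (auto simp: inv)
      then show "psym {2 * K..<m} wact g' w = fact (m - 2 * K) * g' w" by (simp add: card_permutations[of _ "m - 2 * K"])
    qed
    then have "(\<lambda>w. fact (m - 2 * K) * g' w) \<in> U" using sym g'W by (metis image_subset_iff)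
    from subsp_scaleD[OF U this, of "1 / fact (m - 2 * K)"] have "g' \<in> U" by simp
    then have "wact \<sigma> g' \<in> U" by (rule act[OF \<sigma>(1)])
    then show "g \<in> U" by (simp add: g'_def wact_inv[OF \<sigma>(1)])
  qed
  then show ?thesis unfolding Wnm_eq_fspan[OF n(1)] by (rule fspan_minimal[OF U])
qed

lemma psym_wact_invariant:
  assumes "\<pi> permutes B"
  shows "wact \<pi> (psym B wact f) = psym B wact f"
proof
  fix w
  have "wact \<pi> (psym B wact f) w = (\<Sum>\<rho>\<in>{\<rho>. \<rho> permutes B}. wact (\<pi> \<circ> \<rho>) f w)"
  proof -
    have "wact \<rho> f (map (inv \<pi>) w) = wact (\<pi> \<circ> \<rho>) f w" if "\<rho> permutes B" for \<rho>
      using fun_cong[OF wact_comp[OF assms that, of f], of w] unfolding wact_def[of \<pi>] .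
    then show ?thesis unfolding psym_def gact_def by (simp add: wact_def[of \<pi>])
  qed
  also have "\<dots> = (\<Sum>\<rho>\<in>{\<rho>. \<rho> permutes B}. wact \<rho> f w)"
    by (rule sum.reindex_bij_witness[of _ "\<lambda>\<rho>. inv \<pi> \<circ> \<rho>" "\<lambda>\<rho>. \<pi> \<circ> \<rho>"])
      (auto simp: permutes_cancel[OF assms] intro: permutes_compose permutes_inv assms)
  finally show "wact \<pi> (psym B wact f) w = psym B wact f w" by (simp add: psym_def gact_def)
qed

lemma shiftp_inj: "shiftp s l = shiftp s l' \<Longrightarrow> l = l'"
  by (cases l; cases l') auto

lemma is_partition_shiftp: "is_partition M (a # mu) \<Longrightarrow> is_partition (M + s) ((a + s) # mu)"
  by (auto simp: is_partition_def)

definition place :: "nat list \<Rightarrow> nat \<Rightarrow> (nat list \<Rightarrow> 'a::zero) \<Rightarrow> nat list \<times> nat \<times> nat list \<Rightarrow> 'a" where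
  "place lam j f = (\<lambda>(l, i, r). if l = lam \<and> i = j then f r else 0)"

lemma place_DSum:
  assumes "lam \<in> P" "j < mlt lam" "f \<in> Specht (g lam)"
  shows "place lam j f \<in> DSum P mlt g"
proof (rule DSumI)
  show "l \<in> P \<and> i < mlt l" if "place lam j f (l, i, r) \<noteq> 0" for l i r
    using that assms by (auto simp: place_def split: if_splits)
  show "(\<lambda>r. place lam j f (l, i, r)) \<in> Specht (g l)" for l i
    using assms(3) subsp_zeroD[OF subsp_Specht] by (cases "l = lam \<and> i = j") (auto simp: place_def)
qed

lemma gact_dsact_slice: "gact I c \<tau> dsact F (lam, j, r) = gact I c \<tau> ract (\<lambda>r. F (lam, j, r)) r"
  by (simp add: gact_def dsact_def ract_def)

lemma findep_cong:
  assumes "\<And>i. i \<in> I \<Longrightarrow> v i = w i"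
  shows "findep I v \<longleftrightarrow> findep I w"
proof -
  have "(\<Sum>i\<in>I. c i * v i x) = (\<Sum>i\<in>I. c i * w i x)" for c x
    by (rule sum.cong) (simp_all add: assms)
  then show ?thesis by (simp add: findep_def)
qed

text \<open>The map \<open>\<phi>\<close> is the given decomposition in degree \<open>N + K\<close>;
  dimensions are compared at \<open>N\<close> and \<open>n\<close> only. The bound
  \<open>3 * K \<le> N\<close> gives \<open>2 * K \<le> N - K\<close>, so a tail of at most
  \<open>2 * K\<close> cells is no larger than the first row, as the standard tableaux
  require.\<close>

locale stability_step =
  fixes K N n :: nat and mlt :: "nat list \<Rightarrow> nat"
    and \<phi> :: "(nat list \<Rightarrow> 'a::field_char_0) \<Rightarrow> nat list \<times> nat \<times> nat list \<Rightarrow> 'a" and r0 :: nat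
  assumes N: "0 < N" "3 * K \<le> N" "N \<le> n"
    and dsym: "hasdim (psym {2 * K..<N + K} wact ` (Wnm N (N + K) :: (nat list \<Rightarrow> 'a) set)) r0"
      "hasdim (psym {2 * K..<n + K} wact ` (Wnm n (n + K) :: (nat list \<Rightarrow> 'a) set)) r0"
    and deop: "\<And>mu. sum_list mu \<le> 2 * K \<Longrightarrow> 0 \<notin> set mu \<Longrightarrow> \<exists>r. \<forall>k\<in>{N, n}. \<forall>a. is_partition (k + K) (a # mu) \<longrightarrow> sum_list mu \<le> a \<longrightarrow>
       hasdim (tableau.eop (a # mu) (k + K) (std_tab mu) wact ` (Wnm k (k + K) :: (nat list \<Rightarrow> 'a) set)) r"
    and bij: "bij_betw \<phi> (Wnm N (N + K)) (DSum {lam. is_partition (N + K) lam} mlt id)"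
    and add: "\<And>u v. u \<in> Wnm N (N + K) \<Longrightarrow> v \<in> Wnm N (N + K) \<Longrightarrow> \<phi> (\<lambda>x. u x + v x) = (\<lambda>y. \<phi> u y + \<phi> v y)"
    and scale: "\<And>c u. u \<in> Wnm N (N + K) \<Longrightarrow> \<phi> (\<lambda>x. c * u x) = (\<lambda>y. c * \<phi> u y)"
    and equi: "\<And>\<sigma> v. \<sigma> permutes {..<N + K} \<Longrightarrow> v \<in> Wnm N (N + K) \<Longrightarrow> \<phi> (wact \<sigma> v) = dsact \<sigma> (\<phi> v)"
begin

abbreviation "M \<equiv> N + K"
abbreviation "m \<equiv> n + K"
abbreviation "s \<equiv> n - N"
abbreviation "P \<equiv> {lam. is_partition M lam}"
abbreviation "WN \<equiv> Wnm N M :: (nat list \<Rightarrow> 'a) set"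
abbreviation "Wn \<equiv> Wnm n m :: (nat list \<Rightarrow> 'a) set"

lemma m_eq: "m = M + s" using N by simp
lemma n_pos: "0 < n" using N by simp

lemma subsp_WN: "subsp WN" by (rule subsp_Wnm[OF N(1)])
lemma subsp_Wn: "subsp Wn" by (rule subsp_Wnm[OF n_pos])

lemma phi_gact:
  assumes "\<And>i. i \<in> I \<Longrightarrow> \<tau> i permutes {..<M}" "v \<in> WN"
  shows "\<phi> (gact I c \<tau> wact v) = gact I c \<tau> dsact (\<phi> v)"
proof (rule gact_equivariant[where V = WN])
  show "wact (\<tau> i) v \<in> WN" "\<phi> (wact (\<tau> i) v) = dsact (\<tau> i) (\<phi> v)" if "i \<in> I" for i
    using wact_Wnm[OF N(1) assms(1)[OF that] assms(2)] equi[OF assms(1)[OF that] assms(2)] by auto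
qed (fact subsp_WN, fact add, fact scale)

lemma phi_zero: "\<phi> (\<lambda>x. 0) = (\<lambda>y. 0)"
  using scale[OF subsp_zeroD[OF subsp_WN], of 0] by simp

lemma phi_surj: "F \<in> DSum P mlt id \<Longrightarrow> \<exists>w\<in>WN. \<phi> w = F"
  using bij by (metis bij_betw_imp_surj_on imageE)

text \<open>A summand that occurs gives, through the inverse of \<open>\<phi>\<close>, a vector of
  \<open>WN\<close> with nonzero Young symmetrization, to which \<open>first_row_bound\<close>
  applies.\<close>

lemma part_shape:
  assumes lam: "lam \<in> P" "0 < mlt lam"
  shows "\<exists>a mu. lam = a # mu \<and> is_partition M (a # mu) \<and> sum_list mu \<le> 2 * K \<and> sum_list mu \<le> a \<and> 0 \<notin> set mu"
proof -
  have p: "is_partition M lam" using lam by simp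
  have "lam \<noteq> []" using p N by (auto simp: is_partition_def)
  then obtain a mu where l: "lam = a # mu" by (cases lam) auto
  interpret tableau "a # mu" M "std_tab mu" by (rule tableau_std) (use p l in simp)
  obtain f where f: "f \<in> Specht (a # mu)" "bet (Rsym f) \<noteq> (0::'a)" using eop_ract_nonzero by blast
  have "place lam 0 f \<in> DSum P mlt id" by (rule place_DSum) (use lam f l in auto)
  then obtain w where w: "w \<in> WN" "\<phi> w = place lam 0 f" using phi_surj by blast
  have "eop wact w \<noteq> (\<lambda>x. 0)"
  proof
    assume z: "eop wact w = (\<lambda>x. 0)"
    have h: "\<phi> (eop wact w) = eop dsact (place lam 0 f)" unfolding eop_def w(2)[symmetric] by (rule phi_gact) (use w in auto)
    have "eop dsact (place lam 0 f) (lam, 0, t) = 0" unfolding h[symmetric] z phi_zero ..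
    then have "eop ract f t = 0" unfolding eop_def gact_dsact_slice by (simp add: place_def)
    then show False using eop_ract[OF f(1)] f(2) e_t[where 'a = 'a] by simp
  qed
  from first_row_bound[OF N(1) refl w(1) this] have "N - K \<le> a" by simp
  then show ?thesis using p l N by (intro exI[of _ a] exI[of _ mu]) (auto simp: is_partition_def)
qed

text \<open>One vector is placed in each copy. Its Young symmetrization is a nonzero multiple of
  \<open>e\<close> in that copy and zero in all others, so the symmetrized preimages in
  \<open>WN\<close> are independent.\<close>

lemma mlt_le:
  assumes lam: "is_partition M (a # mu)"
    and r: "hasdim (tableau.eop (a # mu) M (std_tab mu) wact ` WN) r"
  shows "mlt (a # mu) \<le> r"
proof -
  let ?l = "a # mu"
  interpret tableau ?l M "std_tab mu" by (rule tableau_std[OF lam])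
  obtain f where f: "f \<in> Specht ?l" "bet (Rsym f) \<noteq> (0::'a)" using eop_ract_nonzero by blast
  have "\<exists>w\<in>WN. \<phi> w = place ?l j f" if "j < mlt ?l" for j
    by (rule phi_surj, rule place_DSum) (use lam f that in auto)
  then obtain w where w: "\<And>j. j < mlt ?l \<Longrightarrow> w j \<in> WN" "\<And>j. j < mlt ?l \<Longrightarrow> \<phi> (w j) = place ?l j f" by metis
  have fe: "\<phi> (eop wact (w j)) = eop dsact (place ?l j f)" if "j < mlt ?l" for j
    unfolding eop_def w(2)[OF that, symmetric] by (rule phi_gact) (use w(1)[OF that] in auto)
  have cl: "eop wact (w j) \<in> WN" if "j < mlt ?l" for j
    unfolding eop_def by (rule gact_closed[OF subsp_WN], rule wact_Wnm[OF N(1)]) (use w(1)[OF that] in auto)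
  have ind: "findep {..<mlt ?l} (\<lambda>j. eop wact (w j))"
    unfolding findep_def
  proof (intro allI impI ballI)
    fix c j assume z: "\<forall>x. (\<Sum>i<mlt ?l. c i * eop wact (w i) x) = 0" and j: "j \<in> {..<mlt ?l}"
    have "\<phi> (\<lambda>x. \<Sum>i<mlt ?l. c i * eop wact (w i) x) = (\<lambda>y. \<Sum>i<mlt ?l. c i * \<phi> (eop wact (w i)) y)"
      by (rule lin_on_lcomb[OF subsp_WN add scale]) (use cl in auto)
    moreover have "(\<lambda>x. \<Sum>i<mlt ?l. c i * eop wact (w i) x) = (\<lambda>x. 0)" using z by (intro ext) (rule spec)
    ultimately have "(\<lambda>y. \<Sum>i<mlt ?l. c i * \<phi> (eop wact (w i)) y) = (\<lambda>y. 0)" by (simp only: phi_zero)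
    from fun_cong[OF this, of "(?l, j, t)"] have "(\<Sum>i<mlt ?l. c i * \<phi> (eop wact (w i)) (?l, j, t)) = 0" .
    moreover have "(\<Sum>i<mlt ?l. c i * \<phi> (eop wact (w i)) (?l, j, t)) = (\<Sum>i<mlt ?l. if i = j then c i * bet (Rsym f) else 0)"
    proof (rule sum.cong[OF refl])
      fix i assume i: "i \<in> {..<mlt ?l}"
      have "\<phi> (eop wact (w i)) (?l, j, t) = eop ract (\<lambda>r. place ?l i f (?l, j, r)) t"
        using fe[of i] i unfolding eop_def by (simp add: gact_dsact_slice)
      also have "\<dots> = (if i = j then bet (Rsym f) else 0)"
      proof (cases "i = j")
        case True
        then show ?thesis using fun_cong[OF eop_ract[OF f(1)], of t] e_t[where 'a = 'a] by (simp add: place_def)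
      next
        case False
        then show ?thesis by (simp add: place_def eop_def gact_def ract_def)
      qed
      finally show "c i * \<phi> (eop wact (w i)) (?l, j, t) = (if i = j then c i * bet (Rsym f) else 0)" by simp
    qed
    ultimately show "c j = 0" using j f(2) by simp
  qed
  obtain v where v: "eop wact ` WN \<subseteq> fspan (v ` {..<r})" using r by (auto simp: hasdim_def)
  have "card {..<mlt ?l} \<le> card (v ` {..<r})"
    by (rule findep_card_le[OF _ _ ind]) (use v w(1) in auto)
  also have "\<dots> \<le> r" using card_image_le[of "{..<r}" v] by simp
  finally show ?thesis by simp
qed

text \<open>The symmetrized spaces at \<open>N\<close> and at \<open>n\<close> have the same
  dimension \<open>r\<close>, which is at least the multiplicity; preimages of basis vectors in
  degree \<open>m\<close> serve as the vectors carrying the copies.\<close>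

lemma choose_vectors:
  assumes lam: "lam \<in> P" "0 < mlt lam"
  shows "tableau (shiftp s lam) m (std_tab (tl lam)) \<and>
    (\<exists>y. (\<forall>j. j < mlt lam \<longrightarrow> y j \<in> Wn) \<and>
        findep {..<mlt lam} (\<lambda>j. tableau.eop (shiftp s lam) m (std_tab (tl lam)) wact (y j)))"
proof -
  obtain a mu where l: "lam = a # mu" "is_partition M (a # mu)" "sum_list mu \<le> 2 * K" "sum_list mu \<le> a" "0 \<notin> set mu"
    using part_shape[OF lam] by blast
  have p': "is_partition m ((a + s) # mu)" using is_partition_shiftp[OF l(2), of s] unfolding m_eq[symmetric] .
  obtain r where r: "hasdim (tableau.eop (a # mu) M (std_tab mu) wact ` WN) r"
     "hasdim (tableau.eop ((a + s) # mu) m (std_tab mu) wact ` Wn) r"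
  proof -
    obtain r where r: "\<forall>k\<in>{N, n}. \<forall>a. is_partition (k + K) (a # mu) \<longrightarrow> sum_list mu \<le> a \<longrightarrow>
       hasdim (tableau.eop (a # mu) (k + K) (std_tab mu) wact ` (Wnm k (k + K) :: (nat list \<Rightarrow> 'a) set)) r"
      using deop[OF l(3,5)] by blast
    have "hasdim (tableau.eop (a # mu) M (std_tab mu) wact ` WN) r" using r l by simp
    moreover have "hasdim (tableau.eop ((a + s) # mu) m (std_tab mu) wact ` Wn) r"
      using r[rule_format, of n "a + s"] p' l by simp
    ultimately show ?thesis by (rule that)
  qed
  have le: "mlt lam \<le> r" using mlt_le[OF l(2) r(1)] l by simp
  obtain v where v: "\<forall>i<r. v i \<in> tableau.eop ((a + s) # mu) m (std_tab mu) wact ` Wn" "findep {..<r} v"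
    using r(2) by (auto simp: hasdim_def)
  then have "\<forall>i. \<exists>y. i < r \<longrightarrow> y \<in> Wn \<and> v i = tableau.eop ((a + s) # mu) m (std_tab mu) wact y" by blast
  then obtain y where y: "\<And>i. i < r \<Longrightarrow> y i \<in> Wn \<and> v i = tableau.eop ((a + s) # mu) m (std_tab mu) wact (y i)" by metis
  have "findep {..<mlt lam} v" by (rule findep_subset[OF v(2)]) (use le in auto)
  moreover have "findep {..<mlt lam} v \<longleftrightarrow> findep {..<mlt lam} (\<lambda>j. tableau.eop ((a + s) # mu) m (std_tab mu) wact (y j))"
    by (rule findep_cong) (use y le in auto)
  ultimately show ?thesis using tableau_std[OF p'] y le l by (intro conjI exI[of _ y]) auto
qed

lemma finite_PP: "finite {lam \<in> P. 0 < mlt lam}"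
proof -
  have "{lam \<in> P. 0 < mlt lam} \<subseteq> {l. set l \<subseteq> {..M} \<and> length l \<le> M}"
  proof
    fix l assume "l \<in> {lam \<in> P. 0 < mlt lam}"
    then have l: "0 \<notin> set l" "sum_list l = M" by (auto simp: is_partition_def)
    then show "l \<in> {l. set l \<subseteq> {..M} \<and> length l \<le> M}"
      using length_le_sum_list[OF l(1)] member_le_sum_list[of _ l] by auto
  qed
  then show ?thesis by (rule finite_subset) (simp add: finite_lists_length_le)
qed

definition pad :: "(nat list \<times> nat \<times> nat list \<Rightarrow> 'a) \<Rightarrow> nat list \<times> nat \<times> nat list \<Rightarrow> 'a" where
  "pad F = (\<lambda>(l, j, r). ext M s (\<lambda>r. F (l, j, r)) r)"

lemma pad_DSum:
  assumes F: "F \<in> DSum P mlt id"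
  shows "pad F \<in> DSum P mlt (shiftp s)"
proof (rule DSumI)
  show "l \<in> P \<and> j < mlt l" if nz: "pad F (l, j, r) \<noteq> 0" for l j r
    by (rule DSum_supp[OF F, of l j "take M r"]) (use nz in \<open>auto simp: pad_def ext_def split: if_splits\<close>)
  show "(\<lambda>r. pad F (l, j, r)) \<in> Specht (shiftp s l)" for l j
  proof (cases "l \<in> P \<and> j < mlt l")
    case True
    then have p: "is_partition M l" by simp
    then have "l \<noteq> []" using N by (auto simp: is_partition_def)
    then obtain a mu where l: "l = a # mu" by (cases l) auto
    have "(\<lambda>r. F (l, j, r)) \<in> Specht (a # mu)" using DSum_Specht[OF F, of l j] l by simp
    from ext_Specht[OF p[unfolded l] this, of s] show ?thesis by (simp add: pad_def l)
  next
    case False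
    from DSum_slice_zero[OF F False] have "(\<lambda>r. pad F (l, j, r)) = (\<lambda>r. 0)" by (auto simp: pad_def ext_def fun_eq_iff)
    then show ?thesis using subsp_zeroD[OF subsp_Specht] by simp
  qed
qed

text \<open>Carries invariants from degree \<open>M\<close> to degree \<open>m\<close>: the first
  rows are lengthened, which destroys invariance under the new letters, and symmetrization over all
  letters from \<open>2 * K\<close> on restores it.\<close>

definition HH where "HH F = psym {2 * K..<m} dsact (pad F)"

lemma HH_add: "HH (\<lambda>y. F y + G y) = (\<lambda>y. HH F y + HH G y)"
proof
  fix y :: "nat list \<times> nat \<times> nat list"
  obtain l j r where y: "y = (l, j, r)" by (metis prod_cases3)
  show "HH (\<lambda>y. F y + G y) y = HH F y + HH G y"
    unfolding y HH_def psym_def gact_dsact_slice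
    by (simp add: gact_def ract_def pad_def ext_def sum.distrib[symmetric] if_distrib cong: if_cong)
qed

lemma HH_scale: "HH (\<lambda>y. c * F y) = (\<lambda>y. c * HH F y)"
proof
  fix y :: "nat list \<times> nat \<times> nat list"
  obtain l j r where y: "y = (l, j, r)" by (metis prod_cases3)
  show "HH (\<lambda>y. c * F y) y = c * HH F y"
    unfolding y HH_def psym_def gact_dsact_slice
    by (simp add: gact_def ract_def pad_def ext_def sum_distrib_left if_distrib cong: if_cong)
qed

lemma HH_zero_imp:
  assumes F: "F \<in> DSum P mlt id" and inv: "\<And>\<pi>. \<pi> permutes {2 * K..<M} \<Longrightarrow> dsact \<pi> F = F" and z: "HH F = (\<lambda>y. 0)"
  shows "F = (\<lambda>y. 0)"
proof
  fix y :: "nat list \<times> nat \<times> nat list"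
  obtain l j r where y: "y = (l, j, r)" by (metis prod_cases3)
  have "(\<lambda>r. F (l, j, r)) = (\<lambda>r. 0)"
  proof (cases "l \<in> P \<and> j < mlt l")
    case True
    then have "is_partition M l" by simp
    moreover from this have "l \<noteq> []" using N by (auto simp: is_partition_def)
    ultimately obtain a mu where l: "l = a # mu" "is_partition M (a # mu)" by (cases l) auto
    interpret tableau "a # mu" M "std_tab mu" by (rule tableau_std[OF l(2)])
    have "(\<lambda>r. F (l, j, r)) \<in> Specht (a # mu)" using DSum_Specht[OF F, of l j] l by simp
    then have fM: "(\<lambda>r. F (l, j, r)) \<in> Mmod M (a # mu)" using Specht_Mmod by blast
    show ?thesis
    proof (rule psym_ext_zero[of "2 * K" M _ s])
      show "2 * K \<le> M" using N by simp
      show "length r = M" if "F (l, j, r) \<noteq> 0" for r using Mmod_length[OF fM, of r] that by auto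
      show "ract \<rho> (\<lambda>r. F (l, j, r)) = (\<lambda>r. F (l, j, r))" if "\<rho> permutes {2 * K..<M}" for \<rho>
        using dsact_slice[of \<rho> F l j] inv[OF that] by simp
      show "psym {2 * K..<M + s} ract (ext M s (\<lambda>r. F (l, j, r))) = (\<lambda>r. 0)"
      proof
        fix r
        have "HH F (l, j, r) = psym {2 * K..<m} ract (\<lambda>r. pad F (l, j, r)) r" unfolding HH_def psym_def by (rule gact_dsact_slice)
        then show "psym {2 * K..<M + s} ract (ext M s (\<lambda>r. F (l, j, r))) r = 0" using z m_eq by (simp add: pad_def)
      qed
    qed
  next
    case False then show ?thesis by (rule DSum_slice_zero[OF F])
  qed
  then show "F y = 0" unfolding y by (rule fun_cong)
qed

lemma rep_iso_step: "rep_iso m Wn wact (DSum P mlt (shiftp s)) dsact"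
proof -
  have "\<forall>lam. \<exists>y. lam \<in> P \<longrightarrow> 0 < mlt lam \<longrightarrow> (\<forall>j. j < mlt lam \<longrightarrow> y j \<in> Wn) \<and>
        findep {..<mlt lam} (\<lambda>j. tableau.eop (shiftp s lam) m (std_tab (tl lam)) wact (y j))"
    using choose_vectors by blast
  then obtain x where x: "\<And>lam. lam \<in> P \<Longrightarrow> 0 < mlt lam \<Longrightarrow> (\<forall>j. j < mlt lam \<longrightarrow> x lam j \<in> Wn) \<and>
        findep {..<mlt lam} (\<lambda>j. tableau.eop (shiftp s lam) m (std_tab (tl lam)) wact (x lam j))"
    by metis
  interpret S: specht_sum P mlt "shiftp s" m "\<lambda>lam. std_tab (tl lam)" x
  proof (rule specht_sum.intro, goal_cases)
    case 1
    show ?case by (rule finite_PP)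
  next
    case (2 lam)
    then show ?case by (rule conjunct1[OF choose_vectors])
  next
    case 3
    show ?case using shiftp_inj by (auto simp: inj_on_def)
  next
    case (4 lam)
    from x[OF this] show ?case by (rule conjunct2)
  qed
  have embW: "S.emb F \<in> Wn" for F
    unfolding S.emb_def
  proof (intro subsp_sum[OF subsp_Wn])
    fix lam j assume lam: "lam \<in> S.PP" and j: "j \<in> {..<mlt lam}"
    interpret L: tableau "shiftp s lam" m "std_tab (tl lam)" by (rule S.tabPP[OF lam])
    have "x lam j \<in> Wn" using x[of lam] lam j by (simp add: S.PP_def)
    then show "S.TH lam (x lam j) (\<lambda>r. F (lam, j, r)) \<in> Wn"
      unfolding S.TH_def L.th_def by (intro gact_closed[OF subsp_Wn] wact_Wnm[OF n_pos]) auto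
  qed
  let ?U = "S.emb ` S.DS"
  have subDS: "subsp S.DS" by (rule subsp_DSum)
  have subU: "subsp ?U"
  proof (rule subspI)
    have "S.emb (\<lambda>y. 0) = (\<lambda>w. 0)" using S.emb_scale[of 0 "\<lambda>y. 0"] by simp
    then show "(\<lambda>x. 0) \<in> ?U" using subsp_zeroD[OF subDS] by (metis imageI)
    show "(\<lambda>x. p x + q x) \<in> ?U" if "p \<in> ?U" "q \<in> ?U" for p q
      using that subsp_addD[OF subDS] by (auto simp: S.emb_add[symmetric])
    show "(\<lambda>x. c * p x) \<in> ?U" if "p \<in> ?U" for c p
      using that subsp_scaleD[OF subDS] by (auto simp: S.emb_scale[symmetric])
  qed
  have PB: "\<pi> permutes {..<m}" if "\<pi> permutes {2 * K..<m}" for \<pi> by (rule permutes_subset[OF that]) auto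
  have HHDS: "HH F \<in> S.DS" if "F \<in> DSum P mlt id" for F
    unfolding HH_def psym_def by (rule gact_closed[OF subDS], rule S.dsact_DS[OF PB pad_DSum[OF that]]) simp
  have embHH: "S.emb (HH F) = psym {2 * K..<m} wact (S.emb (pad F))" if "F \<in> DSum P mlt id" for F
    unfolding HH_def psym_def
  proof (rule gact_equivariant[where V = S.DS])
    fix \<pi> assume "\<pi> \<in> {\<pi>. \<pi> permutes {2 * K..<m}}"
    then have \<pi>: "\<pi> permutes {..<m}" using PB by simp
    show "dsact \<pi> (pad F) \<in> S.DS" by (rule S.dsact_DS[OF \<pi> pad_DSum[OF that]])
    show "S.emb (dsact \<pi> (pad F)) = wact \<pi> (S.emb (pad F))" by (rule S.emb_dsact[OF \<pi>])
  qed (rule subDS S.emb_add S.emb_scale)+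
  obtain v where v: "\<forall>i<r0. v i \<in> psym {2 * K..<M} wact ` WN" "findep {..<r0} v" using dsym(1) by (auto simp: hasdim_def)
  have PM: "\<pi> permutes {..<M}" if "\<pi> permutes {2 * K..<M}" for \<pi> by (rule permutes_subset[OF that]) auto
  have vW: "v i \<in> WN" if ir: "i < r0" for i
  proof -
    obtain u where u: "u \<in> WN" "v i = psym {2 * K..<M} wact u" using v(1)[rule_format, OF ir] by blast
    show ?thesis unfolding u(2) psym_def by (rule gact_closed[OF subsp_WN], rule wact_Wnm[OF N(1) PM u(1)]) simp
  qed
  have vinv: "wact \<pi> (v i) = v i" if "i < r0" "\<pi> permutes {2 * K..<M}" for i \<pi>
    using v(1)[rule_format, OF that(1)] by (auto simp: psym_wact_invariant[OF that(2)])
  have phiDS: "\<phi> u \<in> DSum P mlt id" if "u \<in> WN" for u using bij that by (auto simp: bij_betw_def)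
  \<comment> \<open>The symmetrized vectors of \<open>WN\<close>, carried to degree \<open>m\<close>
    and embedded. By \<open>embHH\<close> they lie in the symmetrized part of
    \<open>Wn\<close>.\<close>
  define h where "h i = S.emb (HH (\<phi> (v i)))" for i
  have hind: "findep {..<r0} h"
    unfolding findep_def
  proof (intro allI impI)
    fix c assume z: "\<forall>w. (\<Sum>i<r0. c i * h i w) = 0"
    define u where "u = (\<lambda>x. \<Sum>i<r0. c i * v i x)"
    have uW: "u \<in> WN" unfolding u_def by (rule subsp_lcomb[OF subsp_WN]) (use vW in auto)
    have uinv: "wact \<pi> u = u" if "\<pi> permutes {2 * K..<M}" for \<pi>
    proof
      fix w
      have "v i (map (inv \<pi>) w) = v i w" if "i < r0" for i
        using fun_cong[OF vinv[OF that \<open>\<pi> permutes {2 * K..<M}\<close>], of w] by (simp add: wact_def)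
      then show "wact \<pi> u w = u w" by (simp add: u_def wact_def)
    qed
    have "\<phi> u = (\<lambda>y. \<Sum>i<r0. c i * \<phi> (v i) y)" unfolding u_def
      by (rule lin_on_lcomb[OF subsp_WN add scale]) (use vW in auto)
    moreover have "HH (\<lambda>y. \<Sum>i<r0. c i * \<phi> (v i) y) = (\<lambda>y. \<Sum>i<r0. c i * HH (\<phi> (v i)) y)"
      by (rule lin_on_lcomb[of UNIV HH, OF _ HH_add HH_scale]) (auto simp: subsp_def)
    moreover have "S.emb (\<lambda>y. \<Sum>i<r0. c i * HH (\<phi> (v i)) y) = (\<lambda>w. \<Sum>i<r0. c i * h i w)"
      unfolding h_def by (rule lin_on_lcomb[of UNIV S.emb, OF _ S.emb_add S.emb_scale]) (auto simp: subsp_def)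
    ultimately have "S.emb (HH (\<phi> u)) = (\<lambda>w. 0)" using z by simp
    then have "HH (\<phi> u) = (\<lambda>y. 0)" by (rule S.emb_zero_imp[OF HHDS[OF phiDS[OF uW]]])
    then have "\<phi> u = (\<lambda>y. 0)"
      by (rule HH_zero_imp[OF phiDS[OF uW], rotated]) (simp add: equi[OF PM uW, symmetric] uinv)
    then have "\<phi> u = \<phi> (\<lambda>x. 0)" by (simp add: phi_zero)
    then have "u = (\<lambda>x. 0)" using bij uW subsp_zeroD[OF subsp_WN] unfolding bij_betw_def inj_on_def by blast
    then have "\<forall>x. (\<Sum>i<r0. c i * v i x) = 0" unfolding u_def by (simp add: fun_eq_iff)
    then show "\<forall>i\<in>{..<r0}. c i = 0" using v(2)[unfolded findep_def] by blast
  qed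
  obtain v' where v': "psym {2 * K..<m} wact ` Wn \<subseteq> fspan (v' ` {..<r0})" using dsym(2) by (auto simp: hasdim_def)
  \<comment> \<open>The symmetrized part of \<open>Wn\<close> has the same dimension
    \<open>r0\<close>, so the \<open>r0\<close> independent vectors \<open>h\<close> span all of it,
    and it lies in the image of the embedding.\<close>
  have "fspan (v' ` {..<r0}) \<subseteq> fspan (h ` {..<r0})"
  proof (rule findep_spans[OF _ _ hind])
    show "h i \<in> fspan (v' ` {..<r0})" if "i \<in> {..<r0}" for i
      unfolding h_def using v' embHH[OF phiDS[OF vW]] embW that by (simp add: image_subset_iff)
    show "card (v' ` {..<r0}) \<le> card {..<r0}" by (rule card_image_le) simp
  qed auto
  also have "\<dots> \<subseteq> ?U" by (rule fspan_minimal[OF subU]) (use HHDS phiDS vW in \<open>auto simp: h_def\<close>)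
  finally have sym: "psym {2 * K..<m} wact ` Wn \<subseteq> ?U" using v' by blast
  have "Wn \<subseteq> ?U"
  proof (rule Wnm_subset_of_sym[OF n_pos _ refl subU _ sym])
    show "K \<le> n" using N by simp
    show "wact \<sigma> f \<in> ?U" if s: "\<sigma> permutes {..<m}" and f: "f \<in> ?U" for \<sigma> f
    proof -
      obtain F where F: "F \<in> S.DS" "f = S.emb F" using f by auto
      then have "wact \<sigma> f = S.emb (dsact \<sigma> F)" using S.emb_dsact[OF s] by simp
      then show ?thesis using S.dsact_DS[OF s F(1)] by simp
    qed
  qed
  then have im: "S.emb ` S.DS = Wn" using embW by auto
  define \<psi> where "\<psi> = inv_into S.DS S.emb"
  have \<psi>emb: "\<psi> (S.emb F) = F" if "F \<in> S.DS" for F unfolding \<psi>_def using S.emb_inj that by simp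
  have \<psi>W: "\<psi> w \<in> S.DS" "S.emb (\<psi> w) = w" if "w \<in> Wn" for w
    using that im inv_into_into[of w S.emb S.DS] f_inv_into_f[of w S.emb S.DS] by (auto simp: \<psi>_def)
  show ?thesis unfolding rep_iso_def
  proof (intro exI[of _ \<psi>] conjI ballI allI impI)
    show "bij_betw \<psi> Wn S.DS" unfolding \<psi>_def
      by (rule bij_betw_inv_into) (simp add: bij_betw_def S.emb_inj im)
  next
    fix u v assume uv: "u \<in> Wn" "v \<in> Wn"
    have "S.emb (\<lambda>y. \<psi> u y + \<psi> v y) = (\<lambda>x. u x + v x)" using uv by (simp add: S.emb_add \<psi>W)
    then show "\<psi> (\<lambda>x. u x + v x) = (\<lambda>y. \<psi> u y + \<psi> v y)"
      using \<psi>emb[OF subsp_addD[OF subDS \<psi>W(1)[OF uv(1)] \<psi>W(1)[OF uv(2)]]] by simp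
  next
    fix c u assume u: "u \<in> Wn"
    have "S.emb (\<lambda>y. c * \<psi> u y) = (\<lambda>x. c * u x)" using u by (simp add: S.emb_scale \<psi>W)
    then show "\<psi> (\<lambda>x. c * u x) = (\<lambda>y. c * \<psi> u y)"
      using \<psi>emb[OF subsp_scaleD[OF subDS \<psi>W(1)[OF u]], of c] by simp
  next
    fix \<sigma> v assume s: "\<sigma> permutes {..<m}" and v: "v \<in> Wn"
    have "S.emb (dsact \<sigma> (\<psi> v)) = wact \<sigma> v" using S.emb_dsact[OF s] v by (simp add: \<psi>W)
    then show "\<psi> (wact \<sigma> v) = dsact \<sigma> (\<psi> v)" using \<psi>emb[OF S.dsact_DS[OF s \<psi>W(1)[OF v]]] by simp
  qed
qed

end

theorem theorem3p8:
  fixes K :: nat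
  shows "\<exists>N::nat. 1 \<le> N \<and>
    (\<forall>mlt :: nat list \<Rightarrow> nat.
       rep_iso (N + K) (Wnm N (N + K) :: (nat list \<Rightarrow> 'a::field_char_0) set) wact
               (DSum {lam. is_partition (N + K) lam} mlt id) dsact
       \<longrightarrow> (\<forall>n\<ge>N. rep_iso (n + K) (Wnm n (n + K) :: (nat list \<Rightarrow> 'a) set) wact
               (DSum {lam. is_partition (N + K) lam} mlt (shiftp (n - N))) dsact))"
proof -
  \<comment> \<open>The only tails that can occur below the first row, by
    \<open>part_shape\<close>.\<close>
  let ?MU = "{mu. sum_list mu \<le> 2 * K \<and> 0 \<notin> set (mu :: nat list)}"
  have fin: "finite ?MU"
  proof (rule finite_subset)
    show "?MU \<subseteq> {l. set l \<subseteq> {..2 * K} \<and> length l \<le> 2 * K}"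
    proof
      fix l :: "nat list" assume l: "l \<in> ?MU"
      then show "l \<in> {l. set l \<subseteq> {..2 * K} \<and> length l \<le> 2 * K}"
        using length_le_sum_list[of l] member_le_sum_list[of _ l] by fastforce
    qed
    show "finite {l. set l \<subseteq> {..2 * K} \<and> length l \<le> 2 * K}" by (simp add: finite_lists_length_le)
  qed
  obtain r0 n0 where sym: "\<And>n. n \<ge> n0 \<Longrightarrow> hasdim (psym {2 * K..<n + K} wact ` (Wnm n (n + K) :: (nat list \<Rightarrow> 'a) set)) r0"
    using sym_stable by metis
  have "\<forall>mu. \<exists>r n1. \<forall>n\<ge>n1. \<forall>a. is_partition (n + K) (a # mu) \<longrightarrow> sum_list mu \<le> a \<longrightarrow>
     hasdim (tableau.eop (a # mu) (n + K) (std_tab mu) wact ` (Wnm n (n + K) :: (nat list \<Rightarrow> 'a) set)) r"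
    using eop_stable by blast
  then obtain r n1 where eop: "\<And>mu n a. n \<ge> n1 mu \<Longrightarrow> is_partition (n + K) (a # mu) \<Longrightarrow> sum_list mu \<le> a \<Longrightarrow>
     hasdim (tableau.eop (a # mu) (n + K) (std_tab mu) wact ` (Wnm n (n + K) :: (nat list \<Rightarrow> 'a) set)) (r mu)"
    by metis
  \<comment> \<open>The term \<open>3 * K\<close> serves the shape condition, \<open>n0\<close> the
    symmetrized part and the sum all finitely many tails at once. The choice precedes the
    multiplicities \<open>mlt\<close>.\<close>
  define N where "N = 1 + 3 * K + n0 + sum n1 ?MU"
  have N1: "n1 mu \<le> N" if "mu \<in> ?MU" for mu using member_le_sum[OF that, of n1] fin by (simp add: N_def)
  show ?thesis
  proof (intro exI[of _ N] conjI allI impI)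
    show "1 \<le> N" by (simp add: N_def)
    fix mlt :: "nat list \<Rightarrow> nat" and n
    assume iso: "rep_iso (N + K) (Wnm N (N + K) :: (nat list \<Rightarrow> 'a) set) wact (DSum {lam. is_partition (N + K) lam} mlt id) dsact"
      and n: "N \<le> n"
    obtain \<phi> where bij: "bij_betw \<phi> (Wnm N (N + K) :: (nat list \<Rightarrow> 'a) set) (DSum {lam. is_partition (N + K) lam} mlt id)"
      and add: "\<And>u v. u \<in> Wnm N (N + K) \<Longrightarrow> v \<in> Wnm N (N + K) \<Longrightarrow> \<phi> (\<lambda>x. u x + v x) = (\<lambda>y. \<phi> u y + \<phi> v y)"
      and scale: "\<And>c u. u \<in> Wnm N (N + K) \<Longrightarrow> \<phi> (\<lambda>x. c * u x) = (\<lambda>y. c * \<phi> u y)"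
      and equi: "\<And>\<sigma> v. \<sigma> permutes {..<N + K} \<Longrightarrow> v \<in> Wnm N (N + K) \<Longrightarrow> \<phi> (wact \<sigma> v) = dsact \<sigma> (\<phi> v)"
      using iso unfolding rep_iso_def by blast
    have "stability_step K N n mlt \<phi> r0"
    proof
      show "0 < N" "3 * K \<le> N" "N \<le> n" using n by (auto simp: N_def)
      show "hasdim (psym {2 * K..<N + K} wact ` (Wnm N (N + K) :: (nat list \<Rightarrow> 'a) set)) r0"
        "hasdim (psym {2 * K..<n + K} wact ` (Wnm n (n + K) :: (nat list \<Rightarrow> 'a) set)) r0"
        by (rule sym, use n in \<open>simp add: N_def\<close>)+
      fix mu :: "nat list" assume mu: "sum_list mu \<le> 2 * K" "0 \<notin> set mu"
      then have "n1 mu \<le> N" by (intro N1) simp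
      then show "\<exists>r. \<forall>k\<in>{N, n}. \<forall>a. is_partition (k + K) (a # mu) \<longrightarrow> sum_list mu \<le> a \<longrightarrow>
         hasdim (tableau.eop (a # mu) (k + K) (std_tab mu) wact ` (Wnm k (k + K) :: (nat list \<Rightarrow> 'a) set)) r"
        using n by (intro exI[of _ "r mu"] ballI allI impI eop) auto
    qed (fact bij, fact add, fact scale, fact equi)
    then show "rep_iso (n + K) (Wnm n (n + K) :: (nat list \<Rightarrow> 'a) set) wact (DSum {lam. is_partition (N + K) lam} mlt (shiftp (n - N))) dsact"
      by (rule stability_step.rep_iso_step)
  qed
qed

end
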